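(* The problem of deciding, given a net $(G,s,t)$ with $G=(V,E)$ a directed multigraph, whether $(G,s,t)$ is vulnerable can be solved in time polynomial in the size of $G$; in particular, it can be solved in time $O(|V|\cdot|E|^2)$.
   Context: Graphs are finite. A multi-digraph $G=(V,E)$ has a set $V$ of nodes and a set $E$ of edges, each edge relating an ordered pair of nodes; parallel edges are allowed. A net $(G,s,t)$ is a multi-digraph with a chosen source $s$ and target $t$. A path is a sequence $u_1e_1u_2\dots e_{n-1}u_n$ ($n\ge 1$) with $e_i$ relating $(u_i,u_{i+1})$; it is simple if no node repeats. An $st$-path is a path from $s$ to $t$; $SP(G)$ is the set of simple $st$-paths. Let $\mathbb R^+$ be the non-negative reals. A flow is a function $\varphi:SP(G)\to\mathbb R^+$; its value is $\sum_p\varphi(p)$, and $\varphi(e)=\sum_{p\in SP(G):\,e\in p}\varphi(p)$ for an edge $e$ (an $st$-path that is not simple carries no flow). A latency function $l$ assigns to each edge $e$ a continuous non-decreasing function $l_e:\mathbb R^+\to\mathbb R^+$; the latency of an $st$-path $p$ is $l_p(\varphi)=\sum_{e\in p}l_e(\varphi(e))$. A flow of value $r\in\mathbb R^+$ is a Wardrop flow for $(G,r,l)$ if for all $st$-paths $p,q$ with $\varphi(p)>0$ one has $l_p(\varphi)\le l_q(\varphi)$. For $r>0$ (and $G$ having at least one $st$-path) a Wardrop flow exists, and $L(G,r,l)$ denotes the common latency of all $st$-paths with positive flow in a Wardrop flow (independent of the Wardrop flow chosen); $L(G,0,l)=0$. The net $G$ is vulnerable if there exist $r$, $l$ and a subgraph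 $H$ of $G$ (with the same $s,t$, and containing at least one $st$-path) such that $L(G,r,l)>L(H,r,l|_H)$, where $l|_H$ is the restriction of $l$ to the edges of $H$. *)

theory Defs
  imports Complex_Main "Graph_Theory.Arc_Walk" "Graph_Theory.Digraph_Component"
begin

section \<open>Nets, flows and vulnerability\<close>

text \<open>
  Multi-digraphs are \<^term>\<open>fin_digraph\<close>s. A path starting at a given node is represented by its
  list of arcs: \<^const>\<open>pre_digraph.awalk\<close> is the notion of a path (nodes may repeat, the empty
  list is the one-node path), \<^const>\<open>pre_digraph.apath\<close> that of a simple path.
\<close>

locale net = fin_digraph G for G :: "('a, 'b) pre_digraph" +
  fixes s t :: 'a
  assumes source_in_verts: "s \<in> verts G"
    and target_in_verts: "t \<in> verts G"

definition SP :: "('a, 'b) pre_digraph \<Rightarrow> 'a \<Rightarrow> 'a \<Rightarrow> 'b list set" where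
  "SP G s t = {p. pre_digraph.apath G s p t}"

text \<open>
  Flows are functions on \<^term>\<open>SP G s t\<close>, extended by zero to all arc lists.
\<close>

definition is_flow :: "('a, 'b) pre_digraph \<Rightarrow> 'a \<Rightarrow> 'a \<Rightarrow> ('b list \<Rightarrow> real) \<Rightarrow> bool" where
  "is_flow G s t \<phi> \<longleftrightarrow> (\<forall>p \<in> SP G s t. 0 \<le> \<phi> p) \<and> (\<forall>p. p \<notin> SP G s t \<longrightarrow> \<phi> p = 0)"

definition flow_value :: "('a, 'b) pre_digraph \<Rightarrow> 'a \<Rightarrow> 'a \<Rightarrow> ('b list \<Rightarrow> real) \<Rightarrow> real" where
  "flow_value G s t \<phi> = (\<Sum>p \<in> SP G s t. \<phi> p)"

definition edge_flow :: "('a, 'b) pre_digraph \<Rightarrow> 'a \<Rightarrow> 'a \<Rightarrow> ('b list \<Rightarrow> real) \<Rightarrow> 'b \<Rightarrow> real" where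
  "edge_flow G s t \<phi> e = (\<Sum>p \<in> {p \<in> SP G s t. e \<in> set p}. \<phi> p)"

text \<open>
  The values of a latency function at negative arguments are irrelevant.
\<close>

definition latency_function :: "('a, 'b) pre_digraph \<Rightarrow> ('b \<Rightarrow> real \<Rightarrow> real) \<Rightarrow> bool" where
  "latency_function G l \<longleftrightarrow>
     (\<forall>e \<in> arcs G. continuous_on {0..} (l e) \<and> mono_on {0..} (l e) \<and> (\<forall>x \<ge> 0. 0 \<le> l e x))"

text \<open>
  A non-simple path pays for an arc each time it traverses it.
\<close>

definition path_latency ::
  "('a, 'b) pre_digraph \<Rightarrow> 'a \<Rightarrow> 'a \<Rightarrow> ('b \<Rightarrow> real \<Rightarrow> real) \<Rightarrow> ('b list \<Rightarrow> real) \<Rightarrow> 'b list \<Rightarrow> real" where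
  "path_latency G s t l \<phi> p = (\<Sum>e \<leftarrow> p. l e (edge_flow G s t \<phi> e))"

definition wardrop_flow ::
  "('a, 'b) pre_digraph \<Rightarrow> 'a \<Rightarrow> 'a \<Rightarrow> real \<Rightarrow> ('b \<Rightarrow> real \<Rightarrow> real) \<Rightarrow> ('b list \<Rightarrow> real) \<Rightarrow> bool" where
  "wardrop_flow G s t r l \<phi> \<longleftrightarrow>
     is_flow G s t \<phi> \<and> flow_value G s t \<phi> = r \<and>
     (\<forall>p q. pre_digraph.awalk G s p t \<longrightarrow> pre_digraph.awalk G s q t \<longrightarrow> 0 < \<phi> p \<longrightarrow>
        path_latency G s t l \<phi> p \<le> path_latency G s t l \<phi> q)"

text \<open>
  For \<open>r > 0\<close> some path has positive flow, and for a graph with at least one \<open>st\<close>-path the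
  description below has exactly one solution; it is only meant for this case.
\<close>

definition wardrop_latency ::
  "('a, 'b) pre_digraph \<Rightarrow> 'a \<Rightarrow> 'a \<Rightarrow> real \<Rightarrow> ('b \<Rightarrow> real \<Rightarrow> real) \<Rightarrow> real" where
  "wardrop_latency G s t r l =
     (if r = 0 then 0
      else (THE x. \<exists>\<phi>. wardrop_flow G s t r l \<phi> \<and>
              (\<forall>p. pre_digraph.awalk G s p t \<longrightarrow> 0 < \<phi> p \<longrightarrow> path_latency G s t l \<phi> p = x)))"

text \<open>
  Restricting \<open>l\<close> to the arcs of \<open>H\<close> needs no notation: \<^const>\<open>wardrop_latency\<close> of \<open>H\<close> only uses
  the values of \<open>l\<close> there.
\<close>

definition vulnerable :: "('a, 'b) pre_digraph \<Rightarrow> 'a \<Rightarrow> 'a \<Rightarrow> bool" where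
  "vulnerable G s t \<longleftrightarrow>
     (\<exists>r l H. 0 \<le> r \<and> latency_function G l \<and> subgraph H G \<and> (\<exists>p. pre_digraph.awalk H s p t) \<and>
        wardrop_latency G s t r l > wardrop_latency H s t r l)"


section \<open>Random access machines\<close>

text \<open>
  The unit-cost RAM with addition and truncated subtraction as its only arithmetic operations, hence
  polynomially equivalent to Turing machines. There are infinitely many registers, each
  holding a natural number and initially zero, and a separate read-only input list. In an
  instruction, \<open>i\<close>, \<open>j\<close>, \<open>k\<close> are register numbers, \<open>c\<close> is a constant and \<open>a\<close> a position in the
  program.
\<close>

datatype instr =
    Const nat nat      \<comment> \<open>\<open>Const i c\<close>: \<open>R\<^sub>i := c\<close>\<close>
  | Add nat nat nat    \<comment> \<open>\<open>Add i j k\<close>: \<open>R\<^sub>i := R\<^sub>j + R\<^sub>k\<close>\<close>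
  | Sub nat nat nat    \<comment> \<open>\<open>Sub i j k\<close>: \<open>R\<^sub>i := R\<^sub>j - R\<^sub>k\<close>, truncated at 0\<close>
  | Load nat nat       \<comment> \<open>\<open>Load i j\<close>: the register whose number is in \<open>R\<^sub>j\<close> is copied to \<open>R\<^sub>i\<close>\<close>
  | Store nat nat      \<comment> \<open>\<open>Store i j\<close>: \<open>R\<^sub>j\<close> is copied to the register whose number is in \<open>R\<^sub>i\<close>\<close>
  | Read nat nat       \<comment> \<open>\<open>Read i j\<close>: the input entry at index \<open>R\<^sub>j\<close> (0 past the end) is copied to \<open>R\<^sub>i\<close>\<close>
  | Jump nat           \<comment> \<open>\<open>Jump a\<close>: go to \<open>a\<close>\<close>
  | JumpZero nat nat   \<comment> \<open>\<open>JumpZero i a\<close>: go to \<open>a\<close> if \<open>R\<^sub>i = 0\<close>\<close>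

type_synonym config = "nat \<times> (nat \<Rightarrow> nat)"

fun exec_instr :: "nat list \<Rightarrow> instr \<Rightarrow> config \<Rightarrow> config" where
  "exec_instr xs (Const i c) (pc, R) = (Suc pc, R(i := c))"
| "exec_instr xs (Add i j k) (pc, R) = (Suc pc, R(i := R j + R k))"
| "exec_instr xs (Sub i j k) (pc, R) = (Suc pc, R(i := R j - R k))"
| "exec_instr xs (Load i j) (pc, R) = (Suc pc, R(i := R (R j)))"
| "exec_instr xs (Store i j) (pc, R) = (Suc pc, R(R i := R j))"
| "exec_instr xs (Read i j) (pc, R) =
     (Suc pc, R(i := (if R j < length xs then xs ! R j else 0)))"
| "exec_instr xs (Jump a) (pc, R) = (a, R)"
| "exec_instr xs (JumpZero i a) (pc, R) = ((if R i = 0 then a else Suc pc), R)"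

text \<open>
  The machine has halted when the program counter is outside the program; from then on the
  configuration does not change.
\<close>

definition step :: "instr list \<Rightarrow> nat list \<Rightarrow> config \<Rightarrow> config" where
  "step P xs cfg = (if fst cfg < length P then exec_instr xs (P ! fst cfg) cfg else cfg)"

text \<open>
  On input \<open>xs\<close>, program \<open>P\<close> halts after at most \<open>T\<close> steps, answering \<open>b\<close> in register 0.
\<close>

definition answers_within :: "instr list \<Rightarrow> nat list \<Rightarrow> nat \<Rightarrow> bool \<Rightarrow> bool" where
  "answers_within P xs T b \<longleftrightarrow>
     (case (step P xs ^^ T) (0, \<lambda>_. 0) of (pc, R) \<Rightarrow> length P \<le> pc \<and> R 0 = of_bool b)"


section \<open>Deciding vulnerability\<close>

text \<open>
  As machine input, a net is given with its nodes and arcs numbered consecutively from 0, in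
  an arbitrary order; every net is isomorphic to such a net. The input lists the number of nodes,
  the number of arcs, the source, the target, and then tail and head of each arc.
\<close>

locale numbered_net = net G s t for G :: "(nat, nat) pre_digraph" and s t +
  assumes verts_numbered: "verts G = {..<card (verts G)}"
    and arcs_numbered: "arcs G = {..<card (arcs G)}"

definition encode_net :: "(nat, nat) pre_digraph \<Rightarrow> nat \<Rightarrow> nat \<Rightarrow> nat list" where
  "encode_net G s t =
     [card (verts G), card (arcs G), s, t] @
     concat (map (\<lambda>e. [tail G e, head G e]) [0..<card (arcs G)])"

text \<open>
  Here \<open>T n m\<close> bounds the running time on nets with \<open>n\<close> nodes and \<open>m\<close> arcs, and the
  program \<open>P\<close> is the same for all nets. As \<open>n * m\<^sup>2\<close> vanishes on nets without arcs, where a machine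
  still needs some steps, \<open>O(n * m\<^sup>2)\<close> is to be read as \<open>c * (n * m\<^sup>2) + c\<close> for a constant \<open>c\<close>; on
  nets with arcs the additive constant can be absorbed, since \<open>n\<close> is never 0.
\<close>

definition vulnerability_decidable_in_time :: "(nat \<Rightarrow> nat \<Rightarrow> nat) \<Rightarrow> bool" where
  "vulnerability_decidable_in_time T \<longleftrightarrow>
     (\<exists>P. \<forall>G s t. numbered_net G s t \<longrightarrow>
        answers_within P (encode_net G s t) (T (card (verts G)) (card (arcs G)))
          (vulnerable G s t))"

end

theory Submission
  imports Defs "HOL-Analysis.Analysis"
begin

text \<open>
  Call an arc \<open>(u, v)\<close> redundant if some node \<open>z\<close> lies on all walks from \<open>s\<close> to \<open>u\<close> and on all walks
  from \<open>v\<close> to \<open>t\<close>; then no simple path from \<open>s\<close> to \<open>t\<close> uses the arc. Remove redundant arcs until none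
  is left, and decompose the remaining net: split it in series at a node that separates \<open>s\<close> from \<open>t\<close>,
  split it in parallel at an arc from \<open>s\<close> to \<open>t\<close> or when \<open>s\<close> and \<open>t\<close> disconnect it. Either this ends
  with single arcs and the net is series-parallel, or it gets stuck at a subdivided Wheatstone
  net, with paths \<open>a \<rightarrow> u \<rightarrow> b\<close> and \<open>a \<rightarrow> v \<rightarrow> b\<close> and a path from \<open>u\<close> to \<open>v\<close>.

  In a series-parallel net, two flows \<open>f\<close>, \<open>g\<close> of the same positive value admit a path with
  \<open>f \<le> g\<close> and \<open>0 < g\<close> on all its arcs. Applied to Wardrop flows \<open>f\<close> of \<open>G\<close> and \<open>g\<close> of \<open>H\<close> it bounds the
  latency of \<open>G\<close> by that of \<open>H\<close>. In a Wheatstone net, Braess's latencies show vulnerability.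

  After the removals, a Wheatstone net exists if and only if there are nodes \<open>u\<close> and \<open>v\<close> such that \<open>v\<close>
  is reachable from \<open>u\<close>, and no node \<open>z\<close> lies on all walks from \<open>s\<close> to \<open>v\<close> and on all walks from \<open>u\<close> to
  \<open>t\<close>. Here \<open>u\<close> and \<open>v\<close> can be taken to be the tail and the head of some arcs. Both phases
  need a constant number of graph searches for each pair of an arc (or round of removals) and a node \<open>z\<close>.
\<close>

section \<open>Reachability, simple paths and series-parallel arc sets\<close>

text \<open>Whether an arc lies on a simple path from \<open>s\<close> to \<open>t\<close> is
  NP-hard to decide in digraphs, as it asks for two disjoint paths; hence a net cannot be cleaned of
  all useless arcs. Redundancy asks about single separating nodes only, which reachability settles.
  Arcs that survive although no simple path uses them do no harm: whatever they look like, a set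
  without redundant arcs decomposes completely or contains a Wheatstone net.

  The same obstacle returns when a Wheatstone net is to be detected. \<open>cross\<close> asks for
  disjoint paths, \<open>test\<close> only for the absence of a common separating node. The way from
  \<open>test\<close> back to a Wheatstone net is not built by hand; it follows from the dichotomy,
  since series-parallel sets fail the test and all others contain a \<open>cross\<close>. This is
  why the decomposition delivers \<open>braess\<close>, which yields vulnerability, together with
  \<open>cross\<close>, which makes the test succeed.

  Everything is stated for sets of arcs with variable terminals, because the decomposition changes
  the terminals but never the end points of arcs.\<close>

locale arc_ends =
  fixes src tgt :: "'b \<Rightarrow> 'a"
begin

text \<open>Both end points must lie in \<open>S\<close>. A walk that starts or ends in
  \<open>z\<close> therefore does not count as avoiding \<open>z\<close>, and the ends of an arc and
  the terminals are themselves admissible separating nodes.\<close>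

inductive conn :: "'b set \<Rightarrow> 'a set \<Rightarrow> 'a \<Rightarrow> 'a \<Rightarrow> bool" for F S where
  conn_refl: "x \<in> S \<Longrightarrow> conn F S x x"
| conn_step: "conn F S x (src e) \<Longrightarrow> e \<in> F \<Longrightarrow> tgt e \<in> S \<Longrightarrow> conn F S x (tgt e)"

lemma conn_in: "conn F S x y \<Longrightarrow> x \<in> S \<and> y \<in> S"
  by (induction rule: conn.induct) auto

lemma conn_trans: "conn F S y z \<Longrightarrow> conn F S x y \<Longrightarrow> conn F S x z"
  by (induction rule: conn.induct) (auto intro: conn_step)

lemma conn_arc: "e \<in> F \<Longrightarrow> src e \<in> S \<Longrightarrow> tgt e \<in> S \<Longrightarrow> conn F S (src e) (tgt e)"
  by (auto intro: conn.intros)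

lemma conn_Cons: "e \<in> F \<Longrightarrow> src e \<in> S \<Longrightarrow> conn F S (tgt e) y \<Longrightarrow> conn F S (src e) y"
  using conn_trans[OF _ conn_arc] conn_in by blast

lemma conn_converse_induct [consumes 1, case_names refl step]:
  assumes "conn F S x y"
    and "y \<in> S \<Longrightarrow> P y"
    and "\<And>e. e \<in> F \<Longrightarrow> src e \<in> S \<Longrightarrow> conn F S (tgt e) y \<Longrightarrow> P (tgt e) \<Longrightarrow> P (src e)"
  shows "P x"
  using assms
proof (induction rule: conn.induct)
  case (conn_refl x) then show ?case by auto
next
  case (conn_step x e)
  have "src e \<in> S" using conn_step conn_in by blast
  moreover have "conn F S (tgt e) (tgt e)" "P (tgt e)"
    using conn_step by (auto intro: conn_refl)
  ultimately have *: "P (src e)" using conn_step.prems(2) conn_step.hyps by blast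
  show ?case
  proof (rule conn_step.IH)
    fix e' assume "e' \<in> F" "src e' \<in> S" "conn F S (tgt e') (src e)" "P (tgt e')"
    then show "P (src e')" using conn_step by (meson conn.conn_step)
  qed (use * in auto)
qed

lemma conn_mono: "conn F S x y \<Longrightarrow> F \<subseteq> F' \<Longrightarrow> S \<subseteq> S' \<Longrightarrow> conn F' S' x y"
  by (induction rule: conn.induct) (auto intro: conn.intros)

text \<open>The rest of a walk behind its last visit to \<open>Y\<close> is the raw material of an
  ear.\<close>

lemma last_exit:
  assumes "conn F S x t" "x \<in> Y" "t \<notin> Y"
  obtains e where "e \<in> F" "src e \<in> S \<inter> Y" "conn F (S - Y) (tgt e) t"
proof -
  have "conn F (S - Y) x t \<or> (\<exists>e\<in>F. src e \<in> S \<inter> Y \<and> conn F (S - Y) (tgt e) t)"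
    using assms(1,3)
  proof (induction rule: conn_converse_induct)
    case refl then show ?case by (auto intro: conn_refl)
  next
    case (step e)
    then show ?case by (cases "src e \<in> Y") (auto intro: conn_Cons)
  qed
  then show ?thesis using assms(2) conn_in that by blast
qed

lemma first_hit:
  assumes "conn F S x t" "x \<notin> Z" "t \<in> Z"
  obtains e where "e \<in> F" "tgt e \<in> S \<inter> Z" "conn F (S - Z) x (src e)"
proof -
  have "conn F (S - Z) x t \<or> (\<exists>e\<in>F. tgt e \<in> S \<inter> Z \<and> conn F (S - Z) x (src e))"
    using assms(1,2)
  proof (induction rule: conn.induct)
    case (conn_refl x) then show ?case by (auto intro: conn.intros)
  next
    case (conn_step x e)
    then show ?case by (cases "tgt e \<in> Z") (auto intro: conn.intros)
  qed
  then show ?thesis using assms(3) conn_in that by blast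
qed

fun walk :: "'a \<Rightarrow> 'b list \<Rightarrow> 'a \<Rightarrow> bool" where
  "walk x [] y \<longleftrightarrow> x = y"
| "walk x (e # p) y \<longleftrightarrow> src e = x \<and> walk (tgt e) p y"

lemma walk_append [simp]: "walk x (p @ q) y \<longleftrightarrow> (\<exists>z. walk x p z \<and> walk z q y)"
  by (induction p arbitrary: x) auto

lemma walk_end_in: "walk x p y \<Longrightarrow> p \<noteq> [] \<Longrightarrow> y \<in> tgt ` set p"
  by (induction p arbitrary: x) (auto, metis walk.elims(2) walk.simps(1) set_empty image_is_empty)

lemma walk_srcs: "walk x p y \<Longrightarrow> src ` set p \<subseteq> insert x (tgt ` set p)"
  by (induction p arbitrary: x) auto

definition spath :: "'b set \<Rightarrow> 'a \<Rightarrow> 'b list \<Rightarrow> 'a \<Rightarrow> bool" where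
  "spath F x p y \<longleftrightarrow> walk x p y \<and> set p \<subseteq> F \<and> distinct (x # map tgt p)"

lemma conn_spath:
  assumes "conn F S x y"
  shows "\<exists>p. spath F x p y \<and> insert x (tgt ` set p) \<subseteq> S"
  using assms
proof (induction rule: conn.induct)
  case (conn_refl x)
  then show ?case by (auto simp: spath_def intro: exI[of _ "[]"])
next
  case (conn_step x e)
  then obtain p where p: "spath F x p (src e)" "insert x (tgt ` set p) \<subseteq> S" by blast
  \<comment> \<open>Loop erasure: if the new node was visited before, the path is cut back to that
    visit; otherwise it is prolonged by \<open>e\<close>.\<close>
  consider "tgt e = x" | "tgt e \<in> tgt ` set p" | "tgt e \<notin> insert x (tgt ` set p)" by blast
  then show ?case
  proof cases
    case 1
    then show ?thesis using p by (auto simp: spath_def intro: exI[of _ "[]"])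
  next
    case 2
    then obtain e' p1 p2 where e': "p = p1 @ e' # p2" "tgt e' = tgt e"
      by (metis imageE split_list)
    show ?thesis
      using p e' by (intro exI[of _ "p1 @ [e']"]) (auto simp: spath_def)
  next
    case 3
    then show ?thesis
      using p conn_step by (intro exI[of _ "p @ [e]"]) (auto simp: spath_def)
  qed
qed

lemma walk_conn:
  "walk x p y \<Longrightarrow> set p \<subseteq> F \<Longrightarrow> insert x (tgt ` set p) \<subseteq> S \<Longrightarrow> conn F S x y"
  by (induction p arbitrary: x) (auto intro: conn_refl conn_Cons)

lemma conn_arcs_between:
  assumes "conn F S x y"
  shows "x = y \<or> ((\<exists>e\<in>F. src e = x \<and> tgt e \<in> S) \<and> (\<exists>e\<in>F. tgt e = y \<and> src e \<in> S))"
  using assms by (induction rule: conn.induct) (auto dest: conn_in)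

text \<open>No arc is redundant. The choices \<open>z = src e\<close> and \<open>z = tgt e\<close>
  already exclude loops, arcs into \<open>s\<close> and arcs out of \<open>t\<close>.\<close>

definition closed :: "'b set \<Rightarrow> 'a \<Rightarrow> 'a \<Rightarrow> bool" where
  "closed F s t \<longleftrightarrow>
     (\<forall>e\<in>F. \<forall>z. conn F (- {z}) s (src e) \<or> conn F (- {z}) (tgt e) t)"

definition ends :: "'b set \<Rightarrow> 'a set" where
  "ends F = src ` F \<union> tgt ` F"

lemma src_ends: "e \<in> F \<Longrightarrow> src e \<in> ends F" and tgt_ends: "e \<in> F \<Longrightarrow> tgt e \<in> ends F"
  by (auto simp: ends_def)

lemma ends_Un: "ends (F \<union> F') = ends F \<union> ends F'"
  by (auto simp: ends_def)

lemma ends_subset: "(\<And>e. e \<in> F \<Longrightarrow> src e \<in> S \<and> tgt e \<in> S) \<Longrightarrow> ends F \<subseteq> S"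
  by (auto simp: ends_def)

text \<open>Parts in series cannot share an arc, since both its ends would be \<open>z\<close>.
  Parallel parts could share an arc from \<open>s\<close> to \<open>t\<close>, hence the separate
  condition on arcs.\<close>

inductive sp :: "'b set \<Rightarrow> 'a \<Rightarrow> 'a \<Rightarrow> bool" where
  sp_arc: "src e \<noteq> tgt e \<Longrightarrow> sp {e} (src e) (tgt e)"
| sp_series: "sp F1 s z \<Longrightarrow> sp F2 z t \<Longrightarrow> ends F1 \<inter> ends F2 = {z} \<Longrightarrow> sp (F1 \<union> F2) s t"
| sp_parallel: "sp F1 s t \<Longrightarrow> sp F2 s t \<Longrightarrow> F1 \<inter> F2 = {} \<Longrightarrow> ends F1 \<inter> ends F2 = {s, t} \<Longrightarrow>
    sp (F1 \<union> F2) s t"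

text \<open>
  With latency \<open>x\<close> on \<open>e1\<close> and \<open>e2\<close>, latency 1 on \<open>e3\<close> and \<open>e4\<close>, latency 0 on the remaining arcs of the
  three paths and latency 2 elsewhere, the potential \<open>\<pi>\<close> certifies that no walk is cheaper than 2 when one unit
  uses \<open>p3\<close>, and \<open>\<rho>\<close> that none within \<open>p1\<close> and \<open>p2\<close> is cheaper than 3/2 when these carry 1/2 each.
\<close>

definition braess_data where
  "braess_data F s t p1 p2 p3 e1 e2 e3 e4 \<pi> \<rho> \<longleftrightarrow>
     spath F s p1 t \<and> spath F s p2 t \<and> spath F s p3 t \<and> distinct [e1, e2, e3, e4] \<and>
     set p1 \<inter> {e1, e2, e3, e4} = {e1, e4} \<and>
     set p2 \<inter> {e1, e2, e3, e4} = {e2, e3} \<and>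
     set p3 \<inter> {e1, e2, e3, e4} = {e1, e2} \<and>
     (\<forall>e \<in> set p1 \<union> set p2 \<union> set p3.
        \<pi> (tgt e) \<le> \<pi> (src e) + (if e \<in> {e1, e2, e3, e4} then 1 else 0)) \<and>
     \<pi> t = \<pi> s + 2 \<and> (\<forall>x y. \<pi> x - \<pi> y \<le> (2 :: real)) \<and>
     (\<forall>e \<in> set p1 \<union> set p2.
        \<rho> (tgt e) \<le> \<rho> (src e) + (if e \<in> {e1, e2} then 1 / 2 else if e \<in> {e3, e4} then 1 else 0)) \<and>
     \<rho> t = \<rho> s + (3 / 2 :: real)"

definition braess :: "'b set \<Rightarrow> 'a \<Rightarrow> 'a \<Rightarrow> bool" where
  "braess F s t \<longleftrightarrow> (\<exists>p1 p2 p3 e1 e2 e3 e4 \<pi> \<rho>. braess_data F s t p1 p2 p3 e1 e2 e3 e4 \<pi> \<rho>)"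

text \<open>The trace of a Wheatstone net: disjoint routes from \<open>s\<close> to \<open>v\<close>
  and from \<open>u\<close> to \<open>t\<close>, and a bridge from \<open>u\<close> to
  \<open>v\<close> that is not restricted at all. The two inequalities guarantee an arc into
  \<open>v\<close> and an arc out of \<open>u\<close>.\<close>

definition cross :: "'b set \<Rightarrow> 'a \<Rightarrow> 'a \<Rightarrow> bool" where
  "cross F s t \<longleftrightarrow> (\<exists>u v S1 S2. S1 \<inter> S2 = {} \<and> conn F S1 s v \<and> conn F S2 u t \<and>
     conn F UNIV u v \<and> s \<noteq> v \<and> u \<noteq> t)"

definition test :: "'b set \<Rightarrow> 'a \<Rightarrow> 'a \<Rightarrow> bool" where
  "test F s t \<longleftrightarrow> (\<exists>e1\<in>F. \<exists>e2\<in>F. conn F UNIV (src e1) (tgt e2) \<and>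
     (\<forall>z. conn F (- {z}) s (tgt e2) \<or> conn F (- {z}) (src e1) t))"

text \<open>A node \<open>z\<close> lies in at most one of the disjoint sets \<open>S1\<close> and
  \<open>S2\<close>, so the walk in the other one avoids it.\<close>

lemma cross_imp_test:
  assumes "cross F s t"
  shows "test F s t"
proof -
  from assms obtain u v S1 S2 where *: "S1 \<inter> S2 = {}" "conn F S1 s v" "conn F S2 u t"
    "conn F UNIV u v" "s \<noteq> v" "u \<noteq> t"
    unfolding cross_def by blast
  have "conn F (- {z}) s v \<or> conn F (- {z}) u t" for z
    using *(1) conn_mono[OF *(2), of F "- {z}"] conn_mono[OF *(3), of F "- {z}"] by blast
  moreover obtain e1 where "e1 \<in> F" "src e1 = u" using conn_arcs_between[OF *(3)] *(6) by blast
  moreover obtain e2 where "e2 \<in> F" "tgt e2 = v" using conn_arcs_between[OF *(2)] *(5) by blast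
  ultimately show ?thesis using *(4) unfolding test_def by blast
qed


section \<open>Braess certificates and crossings in series compositions\<close>

lemma spath_mono: "spath F x p y \<Longrightarrow> F \<subseteq> F' \<Longrightarrow> spath F' x p y"
  by (auto simp: spath_def)

lemma braess_mono:
  assumes "braess F s t" "F \<subseteq> F'"
  shows "braess F' s t"
proof -
  have "braess_data F' s t p1 p2 p3 e1 e2 e3 e4 \<pi> \<rho>"
    if "braess_data F s t p1 p2 p3 e1 e2 e3 e4 \<pi> \<rho>" for p1 p2 p3 e1 e2 e3 e4 \<pi> \<rho>
    using that unfolding braess_data_def
    by (elim conjE) (intro conjI spath_mono[OF _ assms(2)])
  then show ?thesis using assms(1) unfolding braess_def by blast
qed

lemma cross_mono: "cross F s t \<Longrightarrow> F \<subseteq> F' \<Longrightarrow> cross F' s t"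
  unfolding cross_def by (metis conn_mono order_refl)

text \<open>Node sets shrunk to the ends of one part remain disjoint when this part is glued to
  another one.\<close>

lemma conn_ends:
  assumes "conn F S x y" "x \<noteq> y"
  shows "conn F (S \<inter> ends F) x y"
proof -
  have "x = y \<or> conn F (S \<inter> ends F) x y" using assms(1)
  proof (induction rule: conn.induct)
    case (conn_step x e)
    have "src e \<in> S \<inter> ends F" using conn_step.hyps conn_in src_ends by blast
    then have "conn F (S \<inter> ends F) x (src e)" using conn_step.IH conn_refl by metis
    then show ?case using conn.conn_step[of F "S \<inter> ends F" x e] conn_step.hyps tgt_ends by blast
  qed auto
  then show ?thesis using assms(2) by blast
qed

lemma spath_ends:
  assumes "spath F x p y"
  shows "set p \<subseteq> F" "src ` set p \<subseteq> ends F" "tgt ` set p \<subseteq> ends F" "x \<notin> tgt ` set p"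
    "x = y \<or> x \<in> ends F \<and> y \<in> tgt ` set p" "walk x p y" "distinct (map tgt p)"
proof -
  show w: "walk x p y" and F: "set p \<subseteq> F" "x \<notin> tgt ` set p" "distinct (map tgt p)"
    using assms by (auto simp: spath_def)
  then show "src ` set p \<subseteq> ends F" "tgt ` set p \<subseteq> ends F" by (auto simp: ends_def)
  show "x = y \<or> x \<in> ends F \<and> y \<in> tgt ` set p"
    using w F(1) walk_end_in[OF w] by (cases p) (auto simp: src_ends)
qed

lemma spath_append:
  assumes "spath F x p y" "spath F y q z" "tgt ` set q \<inter> insert x (tgt ` set p) = {}"
  shows "spath F x (p @ q) z"
  using assms unfolding spath_def by auto

text \<open>All three paths are prolonged by the same path \<open>w\<close>, whose arcs will cost
  nothing. They stay simple because the two parts meet only in \<open>z\<close>.\<close>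

lemma braess_series_left:
  assumes "braess F1 s z" "spath F2 z w t" "ends F1 \<inter> ends F2 = {z}"
  shows "braess (F1 \<union> F2) s t"
proof -
  from assms(1) obtain p1 p2 p3 e1 e2 e3 e4 \<pi> \<rho> where
    sp: "spath F1 s p1 z" "spath F1 s p2 z" "spath F1 s p3 z" and d: "distinct [e1, e2, e3, e4]" and
    i: "set p1 \<inter> {e1, e2, e3, e4} = {e1, e4}"
      "set p2 \<inter> {e1, e2, e3, e4} = {e2, e3}"
      "set p3 \<inter> {e1, e2, e3, e4} = {e1, e2}" and
    \<pi>: "\<forall>e \<in> set p1 \<union> set p2 \<union> set p3.
        \<pi> (tgt e) \<le> \<pi> (src e) + (if e \<in> {e1, e2, e3, e4} then 1 else 0)"
       "\<pi> z = \<pi> s + 2" "\<forall>x y. \<pi> x - \<pi> y \<le> (2 :: real)" and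
    \<rho>: "\<forall>e \<in> set p1 \<union> set p2.
        \<rho> (tgt e) \<le> \<rho> (src e) + (if e \<in> {e1, e2} then 1 / 2 else if e \<in> {e3, e4} then 1 else 0)"
     "\<rho> z = \<rho> s + (3 / 2 :: real)"
    unfolding braess_def braess_data_def by (elim exE conjE) (rule that)
  have sz: "s \<noteq> z" using \<pi>(2) by auto
  have p1: "p1 \<noteq> []" using i by auto
  note e1 = spath_ends[OF sp(1)] and ew = spath_ends[OF assms(2)]
  have z2: "z \<in> ends F2" and meet: "\<And>x. x \<in> ends F1 \<Longrightarrow> x \<in> ends F2 \<Longrightarrow> x = z"
    using assms(3) by blast+
  have s1: "s \<in> ends F1" using e1 sz by blast
  have s2: "s \<notin> ends F2" using s1 sz meet by blast
  have t2: "t \<in> ends F2" using ew z2 by blast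
  have w: "set w \<inter> {e1, e2, e3, e4} = {}"
  proof -
    have "{e1, e2, e3, e4} \<subseteq> set p1 \<union> set p2" using i by blast
    then have "{e1, e2, e3, e4} \<subseteq> F1" using e1(1) spath_ends(1)[OF sp(2)] by blast
    moreover have "e \<notin> set w" if "e \<in> F1" for e
    proof
      assume "e \<in> set w"
      then have "tgt e \<in> ends F2" "tgt e \<noteq> z" using ew(3,4) by auto
      then show False using meet tgt_ends[OF that] by blast
    qed
    ultimately show ?thesis by blast
  qed
  have ext: "spath (F1 \<union> F2) s (p @ w) t" if "spath F1 s p z" for p
  proof (rule spath_append)
    show "spath (F1 \<union> F2) s p z" "spath (F1 \<union> F2) z w t"
      using that assms(2) by (auto intro: spath_mono)
    show "tgt ` set w \<inter> insert s (tgt ` set p) = {}" 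
    proof -
      have "x \<noteq> s \<and> x \<notin> tgt ` set p" if "x \<in> tgt ` set w" for x
      proof -
        have "x \<in> ends F2" "x \<noteq> z" using that ew(3,4) by auto
        then show ?thesis using s2 meet spath_ends(3)[OF \<open>spath F1 s p z\<close>] by blast
      qed
      then show ?thesis by blast
    qed
  qed
  \<comment> \<open>On the second part both potentials are frozen at their value in
    \<open>z\<close>, so they do not rise along \<open>w\<close>.\<close>
  let ?f = "\<lambda>(g::'a \<Rightarrow> real) x. if x \<in> ends F2 then g z else g x"
  have f1: "?f g x = g x" if "x \<in> ends F1" for g x using meet that by metis
  have pF: "set p1 \<union> set p2 \<union> set p3 \<subseteq> F1" using sp by (auto simp: spath_def)
  have wF: "set w \<subseteq> F2" using assms(2) by (auto simp: spath_def)
  have a1: "?f \<pi> (tgt e) \<le> ?f \<pi> (src e) + (if e \<in> {e1, e2, e3, e4} then 1 else 0)"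
    if "e \<in> set (p1 @ w) \<union> set (p2 @ w) \<union> set (p3 @ w)" for e
  proof (cases "e \<in> set w")
    case True then have "src e \<in> ends F2" "tgt e \<in> ends F2" using wF src_ends tgt_ends by blast+
    then show ?thesis by simp
  next
    case False
    then have e: "e \<in> set p1 \<union> set p2 \<union> set p3" using that by auto
    then have "src e \<in> ends F1" "tgt e \<in> ends F1" using pF src_ends tgt_ends by blast+
    then show ?thesis using bspec[OF \<pi>(1) e] by (simp only: f1)
  qed
  have a2: "?f \<rho> (tgt e) \<le> ?f \<rho> (src e) + (if e \<in> {e1, e2} then 1 / 2 else if e \<in> {e3, e4} then 1 else 0)"
    if "e \<in> set (p1 @ w) \<union> set (p2 @ w)" for e
  proof (cases "e \<in> set w")
    case True then have "src e \<in> ends F2" "tgt e \<in> ends F2" using wF src_ends tgt_ends by blast+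
    then show ?thesis by simp
  next
    case False
    then have e: "e \<in> set p1 \<union> set p2" using that by auto
    then have "src e \<in> ends F1" "tgt e \<in> ends F1" using pF src_ends tgt_ends by blast+
    then show ?thesis using bspec[OF \<rho>(1) e] by (simp only: f1)
  qed
  have b: "?f \<pi> t = ?f \<pi> s + 2" "?f \<rho> t = ?f \<rho> s + 3 / 2" using s2 t2 \<pi>(2) \<rho>(2) by auto
  have c: "\<forall>x y. ?f \<pi> x - ?f \<pi> y \<le> 2" using \<pi>(3) by auto
  have j: "set (p1 @ w) \<inter> {e1, e2, e3, e4} = {e1, e4}"
      "set (p2 @ w) \<inter> {e1, e2, e3, e4} = {e2, e3}"
      "set (p3 @ w) \<inter> {e1, e2, e3, e4} = {e1, e2}" using i w by (simp_all only: set_append Int_Un_distrib2 Un_empty_right Un_empty_left)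
  show ?thesis unfolding braess_def braess_data_def
    by (rule exI[of _ "p1 @ w"], rule exI[of _ "p2 @ w"], rule exI[of _ "p3 @ w"], rule exI[of _ e1],
        rule exI[of _ e2], rule exI[of _ e3], rule exI[of _ e4], rule exI[of _ "?f \<pi>"],
        rule exI[of _ "?f \<rho>"])
      (intro conjI ballI ext sp d j a1 a2 b c)
qed

lemma braess_series_right:
  assumes "braess F2 z t" "spath F1 s w z" "ends F1 \<inter> ends F2 = {z}"
  shows "braess (F1 \<union> F2) s t"
proof -
  from assms(1) obtain p1 p2 p3 e1 e2 e3 e4 \<pi> \<rho> where
    sp: "spath F2 z p1 t" "spath F2 z p2 t" "spath F2 z p3 t" and d: "distinct [e1, e2, e3, e4]" and
    i: "set p1 \<inter> {e1, e2, e3, e4} = {e1, e4}"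
      "set p2 \<inter> {e1, e2, e3, e4} = {e2, e3}"
      "set p3 \<inter> {e1, e2, e3, e4} = {e1, e2}" and
    \<pi>: "\<forall>e \<in> set p1 \<union> set p2 \<union> set p3.
        \<pi> (tgt e) \<le> \<pi> (src e) + (if e \<in> {e1, e2, e3, e4} then 1 else 0)"
       "\<pi> t = \<pi> z + 2" "\<forall>x y. \<pi> x - \<pi> y \<le> (2 :: real)" and
    \<rho>: "\<forall>e \<in> set p1 \<union> set p2.
        \<rho> (tgt e) \<le> \<rho> (src e) + (if e \<in> {e1, e2} then 1 / 2 else if e \<in> {e3, e4} then 1 else 0)"
     "\<rho> t = \<rho> z + (3 / 2 :: real)"
    unfolding braess_def braess_data_def by (elim exE conjE) (rule that)
  have tz: "t \<noteq> z" using \<pi>(2) by auto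
  have p1: "p1 \<noteq> []" using i by auto
  note e1 = spath_ends[OF sp(1)] and ew = spath_ends[OF assms(2)]
  have z1: "z \<in> ends F1" and meet: "\<And>x. x \<in> ends F1 \<Longrightarrow> x \<in> ends F2 \<Longrightarrow> x = z"
    using assms(3) by blast+
  have t2: "t \<in> ends F2" using e1 tz by blast
  have t1: "t \<notin> ends F1" using t2 tz meet by blast
  have s1: "s \<in> ends F1" using ew z1 by blast
  have w: "set w \<inter> {e1, e2, e3, e4} = {}"
  proof -
    have *: "{e1, e2, e3, e4} \<subseteq> set p1 \<union> set p2" using i by blast
    then have "tgt e \<in> ends F2 \<and> tgt e \<noteq> z" if "e \<in> {e1, e2, e3, e4}" for e
      using that spath_ends(3,4)[OF sp(1)] spath_ends(3,4)[OF sp(2)] by blast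
    moreover have "tgt e \<in> ends F1" if "e \<in> set w" for e using that ew(3) by auto
    ultimately have "e \<notin> set w" if "e \<in> {e1, e2, e3, e4}" for e using that meet by blast
    then show ?thesis by blast
  qed
  have ext: "spath (F1 \<union> F2) s (w @ p) t" if "spath F2 z p t" for p
  proof (rule spath_append)
    show "spath (F1 \<union> F2) z p t" "spath (F1 \<union> F2) s w z"
      using that assms(2) by (auto intro: spath_mono)
    show "tgt ` set p \<inter> insert s (tgt ` set w) = {}" 
    proof -
      have "x \<noteq> s \<and> x \<notin> tgt ` set w" if "x \<in> tgt ` set p" for x
      proof -
        have "x \<in> ends F2" "x \<noteq> z" using that spath_ends(3,4)[OF \<open>spath F2 z p t\<close>] by auto
        then show ?thesis using s1 meet ew(3) by blast
      qed
      then show ?thesis by blast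
    qed
  qed
  let ?f = "\<lambda>(g::'a \<Rightarrow> real) x. if x \<in> ends F1 then g z else g x"
  have f1: "?f g x = g x" if "x \<in> ends F2" for g x using meet that by metis
  have pF: "set p1 \<union> set p2 \<union> set p3 \<subseteq> F2" using sp by (auto simp: spath_def)
  have wF: "set w \<subseteq> F1" using assms(2) by (auto simp: spath_def)
  have a1: "?f \<pi> (tgt e) \<le> ?f \<pi> (src e) + (if e \<in> {e1, e2, e3, e4} then 1 else 0)"
    if "e \<in> set (w @ p1) \<union> set (w @ p2) \<union> set (w @ p3)" for e
  proof (cases "e \<in> set w")
    case True then have "src e \<in> ends F1" "tgt e \<in> ends F1" using wF src_ends tgt_ends by blast+
    then show ?thesis by simp
  next
    case False
    then have e: "e \<in> set p1 \<union> set p2 \<union> set p3" using that by auto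
    then have "src e \<in> ends F2" "tgt e \<in> ends F2" using pF src_ends tgt_ends by blast+
    then show ?thesis using bspec[OF \<pi>(1) e] by (simp only: f1)
  qed
  have a2: "?f \<rho> (tgt e) \<le> ?f \<rho> (src e) + (if e \<in> {e1, e2} then 1 / 2 else if e \<in> {e3, e4} then 1 else 0)"
    if "e \<in> set (w @ p1) \<union> set (w @ p2)" for e
  proof (cases "e \<in> set w")
    case True then have "src e \<in> ends F1" "tgt e \<in> ends F1" using wF src_ends tgt_ends by blast+
    then show ?thesis by simp
  next
    case False
    then have e: "e \<in> set p1 \<union> set p2" using that by auto
    then have "src e \<in> ends F2" "tgt e \<in> ends F2" using pF src_ends tgt_ends by blast+
    then show ?thesis using bspec[OF \<rho>(1) e] by (simp only: f1)
  qed
  have b: "?f \<pi> t = ?f \<pi> s + 2" "?f \<rho> t = ?f \<rho> s + 3 / 2" using s1 t1 \<pi>(2) \<rho>(2) by auto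
  have c: "\<forall>x y. ?f \<pi> x - ?f \<pi> y \<le> 2" using \<pi>(3) by auto
  have j: "set (w @ p1) \<inter> {e1, e2, e3, e4} = {e1, e4}"
      "set (w @ p2) \<inter> {e1, e2, e3, e4} = {e2, e3}"
      "set (w @ p3) \<inter> {e1, e2, e3, e4} = {e1, e2}" using i w by (simp_all only: set_append Int_Un_distrib2 Un_empty_right Un_empty_left)
  show ?thesis unfolding braess_def braess_data_def
    by (rule exI[of _ "w @ p1"], rule exI[of _ "w @ p2"], rule exI[of _ "w @ p3"], rule exI[of _ e1],
        rule exI[of _ e2], rule exI[of _ e3], rule exI[of _ e4], rule exI[of _ "?f \<pi>"],
        rule exI[of _ "?f \<rho>"])
      (intro conjI ballI ext sp d j a1 a2 b c)
qed

lemma cross_series_left: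
  assumes "cross F1 s z" "conn F2 UNIV z t" "ends F1 \<inter> ends F2 = {z}"
  shows "cross (F1 \<union> F2) s t"
proof -
  from assms(1) obtain u v S1 S2 where *: "S1 \<inter> S2 = {}" "conn F1 S1 s v" "conn F1 S2 u z"
    "conn F1 UNIV u v" "s \<noteq> v" "u \<noteq> z"
    unfolding cross_def by blast
  \<comment> \<open>\<open>S2\<close> already contains \<open>z\<close>, the only node common to
    both parts. Adding the second part to \<open>S2\<close> thus cannot produce a node of
    \<open>S1\<close>.\<close>
  let ?S1 = "S1 \<inter> ends F1" and ?S2 = "S2 \<inter> ends F1 \<union> ends F2"
  have z: "z \<in> S2" using * conn_in by blast
  have c1: "conn F1 ?S1 s v" by (rule conn_ends[OF *(2,5)])
  have c2: "conn F1 (S2 \<inter> ends F1) u z" by (rule conn_ends[OF *(3,6)])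
  have zF: "z \<in> ends F1" "z \<in> ends F2" and meet: "ends F1 \<inter> ends F2 \<subseteq> {z}"
    using assms(3) by blast+
  have c3: "conn F2 (ends F2) z t"
    using conn_ends[OF assms(2)] conn_refl[OF zF(2)] by (cases "z = t") simp_all
  have t: "t \<in> ends F2" and u: "u \<in> ends F1" using conn_in[OF c3] conn_in[OF c2] by auto
  have "conn (F1 \<union> F2) ?S2 u z" "conn (F1 \<union> F2) ?S2 z t"
    using conn_mono[OF c2, of "F1 \<union> F2" ?S2] conn_mono[OF c3, of "F1 \<union> F2" ?S2] by blast+
  then have "conn (F1 \<union> F2) ?S2 u t" by (rule conn_trans[rotated])
  moreover have "conn (F1 \<union> F2) ?S1 s v" "conn (F1 \<union> F2) UNIV u v"
    by (rule conn_mono[OF c1 Un_upper1 order_refl], rule conn_mono[OF *(4) Un_upper1 order_refl])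
  moreover have "?S1 \<inter> ?S2 = {}" using *(1) z meet by blast
  moreover have "u \<noteq> t" using t u meet zF *(6) by blast
  ultimately show ?thesis using *(5) unfolding cross_def by blast
qed

lemma cross_series_right:
  assumes "cross F2 z t" "conn F1 UNIV s z" "ends F1 \<inter> ends F2 = {z}"
  shows "cross (F1 \<union> F2) s t"
proof -
  from assms(1) obtain u v S1 S2 where *: "S1 \<inter> S2 = {}" "conn F2 S1 z v" "conn F2 S2 u t"
    "conn F2 UNIV u v" "z \<noteq> v" "u \<noteq> t"
    unfolding cross_def by blast
  let ?S1 = "S1 \<inter> ends F2 \<union> ends F1" and ?S2 = "S2 \<inter> ends F2"
  have z: "z \<in> S1" using * conn_in by blast
  have c1: "conn F2 (S1 \<inter> ends F2) z v" by (rule conn_ends[OF *(2,5)])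
  have c2: "conn F2 ?S2 u t" by (rule conn_ends[OF *(3,6)])
  have zF: "z \<in> ends F1" "z \<in> ends F2" and meet: "ends F1 \<inter> ends F2 \<subseteq> {z}"
    using assms(3) by blast+
  have c3: "conn F1 (ends F1) s z"
    using conn_ends[OF assms(2)] conn_refl[OF zF(1)] by (cases "s = z") simp_all
  have s: "s \<in> ends F1" and v: "v \<in> ends F2" using conn_in[OF c3] conn_in[OF c1] by auto
  have "conn (F1 \<union> F2) ?S1 z v" "conn (F1 \<union> F2) ?S1 s z"
    using conn_mono[OF c1, of "F1 \<union> F2" ?S1] conn_mono[OF c3, of "F1 \<union> F2" ?S1] by blast+
  then have "conn (F1 \<union> F2) ?S1 s v" by (rule conn_trans)
  moreover have "conn (F1 \<union> F2) ?S2 u t" "conn (F1 \<union> F2) UNIV u v"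
    by (rule conn_mono[OF c2 Un_upper2 order_refl], rule conn_mono[OF *(4) Un_upper2 order_refl])
  moreover have "?S1 \<inter> ?S2 = {}" using *(1) z meet by blast
  moreover have "s \<noteq> v" using s v meet zF *(5) by blast
  ultimately show ?thesis using *(6) unfolding cross_def by blast
qed

text \<open>The main path visits \<open>u\<close>, \<open>v\<close> and \<open>b\<close> in this
  order, and the ears \<open>E1\<close> from \<open>s\<close> to \<open>v\<close> and
  \<open>E2\<close> from \<open>u\<close> to \<open>b\<close> overlap. This is a Wheatstone net with
  corners \<open>s\<close>, \<open>u\<close>, \<open>v\<close>, \<open>b\<close>: load-dependent
  arcs sit on \<open>A\<close> and \<open>C\<close>, constant ones on \<open>E1\<close> and
  \<open>E2\<close>, and \<open>X\<close> is the bridge that tempts the flow.\<close>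

lemma braess_crossI:
  assumes P: "spath F s (A @ X @ C @ D) t"
    and w: "walk s A u" "walk u X v" "walk v C b" "walk b D t"
    and ne: "A \<noteq> []" "X \<noteq> []" "C \<noteq> []"
    and E1: "spath F s E1 v" and E2: "spath F u E2 b"
    and d1: "tgt ` set E1 \<inter> tgt ` set (A @ X @ C @ D) \<subseteq> {v}"
    and d2: "tgt ` set E2 \<inter> insert s (tgt ` set (A @ X @ C @ D)) \<subseteq> {b}"
    and d12: "tgt ` set E1 \<inter> tgt ` set E2 = {}"
  shows "braess F s t \<and> cross F s t"
proof -
  define a where "a = tgt ` set A"
  define x where "x = tgt ` set X"
  define c where "c = tgt ` set C"
  define d where "d = tgt ` set D"
  define f where "f = tgt ` set E1"
  define g where "g = tgt ` set E2"
  note defs = a_def x_def c_def d_def f_def g_def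
  have dist: "s \<notin> a \<union> x \<union> c \<union> d" "a \<inter> x = {}" "a \<inter> c = {}" "a \<inter> d = {}" "x \<inter> c = {}" "x \<inter> d = {}"
    "c \<inter> d = {}" using P by (auto simp: spath_def defs)
  have u: "u \<in> a" and v: "v \<in> x" and b: "b \<in> c" using w ne walk_end_in by (auto simp: defs)
  have fd: "f \<inter> a = {}" "f \<inter> c = {}" "f \<inter> d = {}" "f \<inter> x \<subseteq> {v}" "s \<notin> f"
  proof -
    have "f \<inter> (a \<union> x \<union> c \<union> d) \<subseteq> {v}" using d1 by (simp add: defs image_Un Un_assoc)
    moreover have "v \<notin> a \<union> c \<union> d" using v dist by blast
    ultimately show "f \<inter> a = {}" "f \<inter> c = {}" "f \<inter> d = {}" "f \<inter> x \<subseteq> {v}" by blast+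
    show "s \<notin> f" using spath_ends(4)[OF E1] by (simp add: defs)
  qed
  have gd: "g \<inter> a = {}" "g \<inter> x = {}" "g \<inter> d = {}" "g \<inter> c \<subseteq> {b}" "s \<notin> g"
  proof -
    have "g \<inter> insert s (a \<union> x \<union> c \<union> d) \<subseteq> {b}" using d2 by (simp add: defs image_Un Un_assoc)
    moreover have "b \<notin> insert s (a \<union> x \<union> d)" using b dist by blast
    ultimately show "g \<inter> a = {}" "g \<inter> x = {}" "g \<inter> d = {}" "g \<inter> c \<subseteq> {b}" "s \<notin> g" by blast+
  qed
  have fg: "f \<inter> g = {}" using d12 by (simp add: defs)
  have "s \<noteq> v" "u \<noteq> b" using dist u v b by auto
  then have "E1 \<noteq> []" "E2 \<noteq> []" using E1 E2 by (auto simp: spath_def)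
  \<comment> \<open>The first arc of each of the four sides bears its whole latency; all further
    arcs are free.\<close>
  with ne obtain e1 A' e2 C' e3 E1' e4 E2' where L: "A = e1 # A'" "C = e2 # C'" "E1 = e3 # E1'" "E2 = e4 # E2'"
    by (metis neq_Nil_conv)
  have src: "src e1 = s" "src e2 = v" "src e3 = s" "src e4 = u"
    using w E1 E2 by (auto simp: L spath_def)
  have tgt: "tgt e1 \<in> a" "tgt e2 \<in> c" "tgt e3 \<in> f" "tgt e4 \<in> g" by (auto simp: L defs)
  have srcs: "src ` set A' \<subseteq> a" "src ` set C' \<subseteq> c" "src ` set E1' \<subseteq> f" "src ` set E2' \<subseteq> g"
    "src ` set X \<subseteq> insert u x" "src ` set D \<subseteq> insert b d"
    using w E1 E2 walk_srcs[of "tgt e1" A' u] walk_srcs[of "tgt e2" C' b] walk_srcs[of "tgt e3" E1' v]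
      walk_srcs[of "tgt e4" E2' b] walk_srcs[of u X v] walk_srcs[of b D t]
    by (simp_all add: L spath_def defs)
  have srcs': "src ` set A \<subseteq> insert s a" "src ` set C \<subseteq> insert v c" "src ` set E1 \<subseteq> insert s f" "src ` set E2 \<subseteq> insert u g"
    using srcs src by (auto simp: L)
  have tgts: "tgt ` set A' \<subseteq> a" "tgt ` set C' \<subseteq> c" "tgt ` set E1' \<subseteq> f" "tgt ` set E2' \<subseteq> g"
    "tgt ` set X \<subseteq> x" "tgt ` set D \<subseteq> d"
    by (auto simp: L defs)
  have tgts': "tgt ` set A \<subseteq> a" "tgt ` set C \<subseteq> c" "tgt ` set E1 \<subseteq> f" "tgt ` set E2 \<subseteq> g"
    by (auto simp: defs)
  have dd: "distinct [e1, e2, e3, e4]" using tgt src dist fd gd fg u v by auto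
  let ?p1 = "A @ E2 @ D" and ?p2 = "E1 @ C @ D" and ?p3 = "A @ X @ C @ D"
  have ba: "b \<notin> a \<union> x \<union> d \<union> f" "u \<notin> x \<union> c \<union> d \<union> f \<union> g" "v \<notin> a \<union> c \<union> d \<union> g" using b u v dist fd gd by auto
  have notin: "e \<notin> set L" if "tgt e \<in> P" "tgt ` set L \<subseteq> Q" "P \<inter> Q = {}" for e L P Q
    using that by blast
  have dj: "a \<inter> f = {}" "a \<inter> c = {}" "a \<inter> d = {}" "a \<inter> g = {}" "a \<inter> x = {}" "c \<inter> a = {}" "c \<inter> d = {}" "c \<inter> f = {}" "c \<inter> x = {}" "f \<inter> a = {}" "f \<inter> c = {}" "f \<inter> d = {}" "f \<inter> g = {}" "g \<inter> a = {}" "g \<inter> d = {}" "g \<inter> f = {}" "g \<inter> x = {}"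
    using dist fd gd fg by (simp_all add: Int_commute)
  have n1: "e1 \<notin> set E1" "e1 \<notin> set C" "e1 \<notin> set D" "e1 \<notin> set E2" "e1 \<notin> set X"
    by (fact notin[OF tgt(1) tgts'(3) dj(1)] notin[OF tgt(1) tgts'(2) dj(2)] notin[OF tgt(1) tgts(6) dj(3)] notin[OF tgt(1) tgts'(4) dj(4)] notin[OF tgt(1) tgts(5) dj(5)])+
  have n2: "e2 \<notin> set A" "e2 \<notin> set D" "e2 \<notin> set E1" "e2 \<notin> set X"
    by (fact notin[OF tgt(2) tgts'(1) dj(6)] notin[OF tgt(2) tgts(6) dj(7)] notin[OF tgt(2) tgts'(3) dj(8)] notin[OF tgt(2) tgts(5) dj(9)])+
  have n3: "e3 \<notin> set A" "e3 \<notin> set C" "e3 \<notin> set D" "e3 \<notin> set E2"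
    by (fact notin[OF tgt(3) tgts'(1) dj(10)] notin[OF tgt(3) tgts'(2) dj(11)] notin[OF tgt(3) tgts(6) dj(12)] notin[OF tgt(3) tgts'(4) dj(13)])+
  have n4: "e4 \<notin> set A" "e4 \<notin> set D" "e4 \<notin> set E1" "e4 \<notin> set X"
    by (fact notin[OF tgt(4) tgts'(1) dj(14)] notin[OF tgt(4) tgts(6) dj(15)] notin[OF tgt(4) tgts'(3) dj(16)] notin[OF tgt(4) tgts(5) dj(17)])+
  \<comment> \<open>Heads do not distinguish \<open>e2\<close> from the arcs of \<open>E2\<close>,
    as \<open>C\<close> and \<open>E2\<close> both end in \<open>b\<close>; tails do. The same holds
    for \<open>E1\<close> and \<open>X\<close>, which both end in \<open>v\<close>.\<close>
  have n2': "e2 \<notin> set E2"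
  proof
    assume "e2 \<in> set E2" then have "v \<in> insert u g" using srcs'(4) src(2) by blast
    then show False using ba dist u v by blast
  qed
  have n3': "e3 \<notin> set X"
  proof
    assume "e3 \<in> set X" then have "s \<in> insert u x" using srcs(5) src(3) by blast
    then show False using dist u by blast
  qed
  have n4': "e4 \<notin> set C"
  proof
    assume "e4 \<in> set C" then have "u \<in> insert v c" using srcs'(2) src(4) by blast
    then show False using ba dist u v by blast
  qed
  have j: "set ?p1 \<inter> {e1, e2, e3, e4} = {e1, e4}"
      "set ?p2 \<inter> {e1, e2, e3, e4} = {e2, e3}"
      "set ?p3 \<inter> {e1, e2, e3, e4} = {e1, e2}"
    using n1 n2 n2' n3 n3' n4 n4' by (auto simp: L)
  have sp1: "spath F s ?p1 t"
    using P E2 w dist gd unfolding spath_def by (auto simp flip: defs)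
  have sp2: "spath F s ?p2 t"
    using P E1 w dist fd unfolding spath_def by (auto simp flip: defs)
  \<comment> \<open>The potentials are distances from \<open>s\<close>. With the bridge in use every
    side costs 1, so \<open>A\<close>, \<open>E1\<close> and \<open>X\<close> end at distance 1 and
    the rest at 2. Without the bridge, \<open>A\<close> ends at 1/2, \<open>E1\<close> at 1, and
    both routes reach \<open>b\<close> at 3/2; that \<open>\<rho>\<close> rises along
    \<open>X\<close> is no problem, because its condition concerns \<open>p1\<close> and
    \<open>p2\<close> only.\<close>
  define \<pi> :: "'a \<Rightarrow> real" where "\<pi> y = (if y = s then 0 else if y \<in> c \<union> d \<union> g then 2 else 1)" for y
  define \<rho> :: "'a \<Rightarrow> real" where "\<rho> y = (if y = s then 0 else if y \<in> c \<union> d \<union> g then 3 / 2 else if y \<in> a then 1 / 2 else 1)" for y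
  have \<pi>a: "\<pi> y = 1" if "y \<in> a \<union> x \<union> f" for y using that dist fd gd fg by (auto simp: \<pi>_def)
  have \<pi>c: "\<pi> y = 2" if "y \<in> c \<union> d \<union> g" for y using that dist fd gd fg by (auto simp: \<pi>_def)
  have \<rho>a: "\<rho> y = 1 / 2" if "y \<in> a" for y using that dist fd gd fg by (auto simp: \<rho>_def)
  have \<rho>x: "\<rho> y = 1" if "y \<in> x \<union> f" for y using that dist fd gd fg by (auto simp: \<rho>_def)
  have \<rho>c: "\<rho> y = 3 / 2" if "y \<in> c \<union> d \<union> g" for y using that dist fd gd fg by (auto simp: \<rho>_def)
  have s0: "\<pi> s = 0" "\<rho> s = 0" by (auto simp: \<pi>_def \<rho>_def)
  have td: "t \<in> c \<union> d" using w(4) b walk_end_in[of b D t] by (cases D) (auto simp: defs)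
  have a1: "\<pi> (tgt e) \<le> \<pi> (src e) + (if e \<in> {e1, e2, e3, e4} then 1 else 0)"
    if e: "e \<in> set ?p1 \<union> set ?p2 \<union> set ?p3" for e
  proof -
    consider "e \<in> {e1, e3}" | "e \<in> {e2, e4}" | "e \<in> set A' \<union> set E1' \<union> set X" |
      "e \<in> set C' \<union> set E2' \<union> set D" using e by (auto simp: L)
    then show ?thesis
    proof cases
      case 1
      then have "\<pi> (tgt e) = 1" "\<pi> (src e) = 0" using tgt src s0 \<pi>a by auto
      then show ?thesis using 1 by auto
    next
      case 2
      then have "\<pi> (tgt e) = 2" "\<pi> (src e) = 1" using tgt src u v \<pi>a \<pi>c by auto
      then show ?thesis using 2 by auto
    next
      case 3
      then have "src e \<in> a \<union> x \<union> f" "tgt e \<in> a \<union> x \<union> f" using srcs tgts u by auto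
      then have "\<pi> (tgt e) = 1" "\<pi> (src e) = 1" using \<pi>a by blast+
      then show ?thesis by simp
    next
      case 4
      then have "src e \<in> c \<union> d \<union> g" "tgt e \<in> c \<union> d \<union> g" using srcs tgts b by auto
      then have "\<pi> (tgt e) = 2" "\<pi> (src e) = 2" using \<pi>c by blast+
      then show ?thesis by simp
    qed
  qed
  have a2: "\<rho> (tgt e) \<le> \<rho> (src e) + (if e \<in> {e1, e2} then 1 / 2 else if e \<in> {e3, e4} then 1 else 0)"
    if e: "e \<in> set ?p1 \<union> set ?p2" for e
  proof -
    consider "e = e1" | "e = e2" | "e = e3" | "e = e4" | "e \<in> set A'" | "e \<in> set E1'" |
      "e \<in> set C' \<union> set E2' \<union> set D" using e by (auto simp: L)
    then show ?thesis
    proof cases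
      case 1 then show ?thesis using tgt src s0 \<rho>a by auto
    next
      case 2 then show ?thesis using tgt src v \<rho>x \<rho>c by auto
    next
      case 3 then show ?thesis using tgt src s0 \<rho>x dd by auto
    next
      case 4
      have "\<rho> (tgt e4) = 3 / 2" "\<rho> (src e4) = 1 / 2" using tgt src u \<rho>a \<rho>c by simp_all
      then show ?thesis using 4 dd by auto
    next
      case 5
      then have "src e \<in> a" "tgt e \<in> a" using srcs tgts by auto
      then have "\<rho> (tgt e) = 1 / 2" "\<rho> (src e) = 1 / 2" using \<rho>a by blast+
      then show ?thesis by simp
    next
      case 6
      then have "src e \<in> f" "tgt e \<in> f" using srcs tgts u by auto
      then have "\<rho> (tgt e) = 1" "\<rho> (src e) = 1" using \<rho>x by blast+
      then show ?thesis by simp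
    next
      case 7
      then have "src e \<in> c \<union> d \<union> g" "tgt e \<in> c \<union> d \<union> g" using srcs tgts b by auto
      then have "\<rho> (tgt e) = 3 / 2" "\<rho> (src e) = 3 / 2" using \<rho>c by blast+
      then show ?thesis by simp
    qed
  qed
  have bb: "\<pi> t = \<pi> s + 2" "\<rho> t = \<rho> s + 3 / 2" using td s0 \<pi>c \<rho>c by auto
  have cc: "\<forall>x y. \<pi> x - \<pi> y \<le> 2" by (auto simp: \<pi>_def)
  have "braess F s t" unfolding braess_def braess_data_def
    by (rule exI[of _ ?p1], rule exI[of _ ?p2], rule exI[of _ ?p3], rule exI[of _ e1],
        rule exI[of _ e2], rule exI[of _ e3], rule exI[of _ e4], rule exI[of _ \<pi>],
        rule exI[of _ \<rho>])
      (intro conjI ballI P sp1 sp2 dd j a1 a2 bb cc)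
  moreover have "cross F s t"
  proof -
    have "conn F (insert s f) s v" using E1 by (intro walk_conn[of s E1]) (auto simp: spath_def f_def)
    moreover have "conn F (insert u (g \<union> d)) u t"
      using P E2 w by (intro walk_conn[of u "E2 @ D"]) (auto simp: spath_def g_def d_def)
    moreover have "conn F UNIV u v" using P w by (intro walk_conn[of u X]) (auto simp: spath_def)
    moreover have "insert s f \<inter> insert u (g \<union> d) = {}" using dist fd gd fg u ba by auto
    moreover have "u \<noteq> t" using td ba by auto
    ultimately show ?thesis using \<open>s \<noteq> v\<close> unfolding cross_def by blast
  qed
  ultimately show ?thesis by blast
qed


text \<open>Traced backwards, the walk never leaves \<open>Y\<close>. In this way walks of a
  composition are confined to one part.\<close>

lemma stay_tgt:
  assumes "conn F S x y" "y \<in> Y" "\<And>e. e \<in> F \<Longrightarrow> tgt e \<in> Y \<Longrightarrow> e \<in> F' \<and> src e \<in> Y"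
  shows "conn F' S x y \<and> x \<in> Y"
  using assms(1,2)
proof (induction rule: conn.induct)
  case (conn_refl x) then show ?case using conn.conn_refl by blast
next
  case (conn_step x e)
  then show ?case using assms(3)[of e] conn.conn_step[of F' S x e] by blast
qed

lemma stay_src:
  assumes "conn F S x y" "x \<in> Y" "\<And>e. e \<in> F \<Longrightarrow> src e \<in> Y \<Longrightarrow> e \<in> F' \<and> tgt e \<in> Y"
  shows "conn F' S x y \<and> y \<in> Y"
  using assms(1,2)
proof (induction rule: conn_converse_induct)
  case refl then show ?case using conn.conn_refl by blast
next
  case (step e)
  then show ?case using assms(3)[of e] conn_Cons[of e F' S y] by blast
qed

section \<open>Walks, tests and flows in series-parallel arc sets\<close>

lemma sp_facts:
  assumes "sp F s t"
  shows "s \<noteq> t" "finite F" "s \<in> ends F" "t \<in> ends F" "\<And>e. e \<in> F \<Longrightarrow> tgt e \<noteq> s" "\<And>e. e \<in> F \<Longrightarrow> src e \<noteq> t"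
proof -
  have "s \<noteq> t \<and> finite F \<and> s \<in> ends F \<and> t \<in> ends F \<and> (\<forall>e\<in>F. tgt e \<noteq> s \<and> src e \<noteq> t)"
    using assms
  proof (induction rule: sp.induct)
    case (sp_arc e) then show ?case by (auto simp: ends_def)
  next
    case (sp_series F1 s z F2 t)
    have m: "x \<in> ends F1 \<Longrightarrow> x \<in> ends F2 \<Longrightarrow> x = z" for x using sp_series(3) by blast
    have "s \<noteq> t" using m[of s] sp_series by auto
    moreover have "tgt e \<noteq> s" if "e \<in> F2" for e using m[of s] sp_series tgt_ends[OF that] by auto
    moreover have "src e \<noteq> t" if "e \<in> F1" for e using m[of t] sp_series src_ends[OF that] by auto
    ultimately show ?case using sp_series by (auto simp: ends_Un)
  next
    case (sp_parallel F1 s t F2)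
    then show ?case by (auto simp: ends_Un)
  qed
  then show "s \<noteq> t" "finite F" "s \<in> ends F" "t \<in> ends F" "\<And>e. e \<in> F \<Longrightarrow> tgt e \<noteq> s" "\<And>e. e \<in> F \<Longrightarrow> src e \<noteq> t"
    by auto
qed

text \<open>The first arc of a walk outside \<open>F1\<close> starts in a node common to both parts,
  which can only be \<open>z\<close>; dually, the last arc outside \<open>F2\<close> ends in
  \<open>z\<close>.\<close>

lemma series_pass:
  assumes "sp F1 s z" "sp F2 z t" and meet: "ends F1 \<inter> ends F2 \<subseteq> {z}"
  shows "conn (F1 \<union> F2) S x t \<Longrightarrow> x \<in> ends F1 \<Longrightarrow> conn F1 S x z"
    and "conn (F1 \<union> F2) S s y \<Longrightarrow> y \<in> ends F2 \<Longrightarrow> conn F2 S z y"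
proof -
  have m: "x \<in> ends F1 \<Longrightarrow> x \<in> ends F2 \<Longrightarrow> x = z" for x using meet by blast
  note 1 = sp_facts[OF assms(1)] and 2 = sp_facts[OF assms(2)]
  show "conn (F1 \<union> F2) S x t \<Longrightarrow> x \<in> ends F1 \<Longrightarrow> conn F1 S x z"
  proof (induction rule: conn_converse_induct)
    case refl then show ?case using m 2 by blast
  next
    case (step e)
    show ?case
    proof (cases "e \<in> F1")
      case True
      then show ?thesis using step conn_Cons tgt_ends by blast
    next
      case False
      then have "src e = z" using step m src_ends by blast
      then show ?thesis using conn_refl step by blast
    qed
  qed
  show "conn (F1 \<union> F2) S s y \<Longrightarrow> y \<in> ends F2 \<Longrightarrow> conn F2 S z y"
  proof (induction x\<equiv>s y rule: conn.induct)
    case conn_refl then show ?case using m 1 by blast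
  next
    case (conn_step e)
    show ?case
    proof (cases "e \<in> F2")
      case True
      then show ?thesis using conn_step conn.conn_step[of F2 S z e] src_ends by blast
    next
      case False
      then have "tgt e = z" using conn_step m tgt_ends by blast
      then show ?thesis using conn_refl conn_step by blast
    qed
  qed
qed

text \<open>No arc of \<open>F2\<close> enters \<open>z\<close> and no arc of \<open>F1\<close>
  leaves it, so a walk never returns from the second part to the first.\<close>

lemma series_stay:
  assumes "sp F1 s z" "sp F2 z t" and meet: "ends F1 \<inter> ends F2 \<subseteq> {z}"
  shows "conn (F1 \<union> F2) S x y \<Longrightarrow> y \<in> ends F1 \<Longrightarrow> conn F1 S x y \<and> x \<in> ends F1"
    and "conn (F1 \<union> F2) S x y \<Longrightarrow> x \<in> ends F2 \<Longrightarrow> conn F2 S x y \<and> y \<in> ends F2"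
proof -
  have m: "x \<in> ends F1 \<Longrightarrow> x \<in> ends F2 \<Longrightarrow> x = z" for x using meet by blast
  note 1 = sp_facts[OF assms(1)] and 2 = sp_facts[OF assms(2)]
  have *: "e \<in> F1 \<and> src e \<in> ends F1" if "e \<in> F1 \<union> F2" "tgt e \<in> ends F1" for e
    using that m[of "tgt e"] 2(5)[of e] tgt_ends[of e F2] src_ends[of e F1] by blast
  show "conn (F1 \<union> F2) S x y \<Longrightarrow> y \<in> ends F1 \<Longrightarrow> conn F1 S x y \<and> x \<in> ends F1"
    by (rule stay_tgt[OF _ _ *])
  have **: "e \<in> F2 \<and> tgt e \<in> ends F2" if "e \<in> F1 \<union> F2" "src e \<in> ends F2" for e
    using that m[of "src e"] 1(6)[of e] tgt_ends[of e F2] src_ends[of e F1] by blast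
  show "conn (F1 \<union> F2) S x y \<Longrightarrow> x \<in> ends F2 \<Longrightarrow> conn F2 S x y \<and> y \<in> ends F2"
    by (rule stay_src[OF _ _ **])
qed

text \<open>The choices \<open>z = s\<close> and \<open>z = t\<close> show that the tail of
  \<open>e1\<close> is not \<open>s\<close> and the head of \<open>e2\<close> is not
  \<open>t\<close>. The walks in question then start or end at inner nodes of the branch
  \<open>F1\<close> and cannot switch to the other branch, so \<open>F1\<close> alone would pass the
  test.\<close>

lemma not_test_parallel:
  assumes "sp F1 s t" "sp F2 s t" and meet: "ends F1 \<inter> ends F2 \<subseteq> {s, t}"
    and nt: "\<not> test F1 s t" and e: "e1 \<in> F1" "e2 \<in> F1 \<union> F2"
    and c: "conn (F1 \<union> F2) UNIV (src e1) (tgt e2)"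
    and z: "\<And>z. conn (F1 \<union> F2) (- {z}) s (tgt e2) \<or> conn (F1 \<union> F2) (- {z}) (src e1) t"
  shows False
proof -
  note 1 = sp_facts[OF assms(1)] and 2 = sp_facts[OF assms(2)]
  have m: "x \<in> ends F1 \<Longrightarrow> x \<in> ends F2 \<Longrightarrow> x = s \<or> x = t" for x using meet by blast
  have us: "src e1 \<noteq> s" using z[of s] conn_in by blast
  have vt: "tgt e2 \<noteq> t" using z[of t] conn_in by blast
  let ?Y = "ends F1 - {s}" and ?Z = "ends F1 - {t}"
  have Y: "e \<in> F1 \<and> tgt e \<in> ?Y" if "e \<in> F1 \<union> F2" "src e \<in> ?Y" for e
    using that m[of "src e"] 1(5,6)[of e] 2(6)[of e] src_ends[of e F2] tgt_ends[of e F1] by blast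
  have Z: "e \<in> F1 \<and> src e \<in> ?Z" if "e \<in> F1 \<union> F2" "tgt e \<in> ?Z" for e
    using that m[of "tgt e"] 1(5,6)[of e] 2(5)[of e] src_ends[of e F1] tgt_ends[of e F2] by blast
  have u: "src e1 \<in> ?Y" using us e src_ends by blast
  have v: "tgt e2 \<in> ?Y" and c': "conn F1 UNIV (src e1) (tgt e2)" using stay_src[OF c u Y] by auto
  have v': "tgt e2 \<in> ?Z" using v vt by blast
  have e2: "e2 \<in> F1" using Z[OF e(2) v'] by blast
  have "conn F1 (- {z}) s (tgt e2) \<or> conn F1 (- {z}) (src e1) t" for z
    using z[of z] stay_src[OF _ u Y] stay_tgt[OF _ v' Z] by blast
  then show False using nt e(1) e2 c' unfolding test_def by blast
qed

lemma sp_not_test: "sp F s t \<Longrightarrow> \<not> test F s t"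
proof (induction rule: sp.induct)
  case (sp_arc e)
  show ?case
  proof
    assume "test {e} (src e) (tgt e)"
    then have "conn {e} (- {src e}) (src e) (tgt e) \<or> conn {e} (- {src e}) (src e) (tgt e)"
      unfolding test_def by blast
    then show False using conn_in by blast
  qed
next
  case (sp_series F1 s z F2 t)
  have m: "x \<in> ends F1 \<Longrightarrow> x \<in> ends F2 \<Longrightarrow> x = z" for x using sp_series(3) by blast
  note pass = series_pass[OF sp_series(1,2) equalityD1[OF sp_series(3)]]
    and stay = series_stay[OF sp_series(1,2) equalityD1[OF sp_series(3)]]
  show ?case
  proof
    assume "test (F1 \<union> F2) s t"
    then obtain e1 e2 where e: "e1 \<in> F1 \<union> F2" "e2 \<in> F1 \<union> F2" and
      c: "conn (F1 \<union> F2) UNIV (src e1) (tgt e2)" and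
      z: "\<And>z. conn (F1 \<union> F2) (- {z}) s (tgt e2) \<or> conn (F1 \<union> F2) (- {z}) (src e1) t"
      unfolding test_def by blast
    consider "e1 \<in> F1" "e2 \<in> F1" | "e1 \<in> F2" "e2 \<in> F2" | "e1 \<in> F1" "e2 \<in> F2" | "e1 \<in> F2" "e2 \<in> F1"
      using e by blast
    then show False
    proof cases
      case 1
      have "conn F1 UNIV (src e1) (tgt e2)" using stay(1)[OF c] tgt_ends 1 by blast
      moreover have "conn F1 (- {z'}) s (tgt e2) \<or> conn F1 (- {z'}) (src e1) z" for z'
        using z[of z'] stay(1) pass(1) tgt_ends[OF 1(2)] src_ends[OF 1(1)] by blast
      ultimately show False using 1 sp_series.IH(1) unfolding test_def by blast
    next
      case 2
      have "conn F2 UNIV (src e1) (tgt e2)" using stay(2)[OF c] src_ends 2 by blast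
      moreover have "conn F2 (- {z'}) z (tgt e2) \<or> conn F2 (- {z'}) (src e1) t" for z'
        using z[of z'] stay(2) pass(2) tgt_ends[OF 2(2)] src_ends[OF 2(1)] by blast
      ultimately show False using 2 sp_series.IH(2) unfolding test_def by blast
    next
      \<comment> \<open>The glueing node defeats this pair: \<open>s\<close> reaches the second part
        only through \<open>z\<close>, and the first part reaches \<open>t\<close> only through
        \<open>z\<close>.\<close>
      case 3
      then show False
        using z[of z] pass(1)[of "- {z}" "src e1"] pass(2)[of "- {z}" "tgt e2"] tgt_ends src_ends conn_in
        by blast
    next
      \<comment> \<open>A walk from the second part to the first must be trivial, so both nodes
        coincide with \<open>z\<close>, and \<open>z\<close> cannot avoid itself.\<close>
      case 4
      have "src e1 = z" using stay(1)[OF c] tgt_ends src_ends 4 m by blast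
      moreover have "tgt e2 = z" using stay(2)[OF c] tgt_ends src_ends 4 m by blast
      ultimately show False using z[of z] conn_in by blast
    qed
  qed
next
  case (sp_parallel F1 s t F2)
  have m: "ends F1 \<inter> ends F2 \<subseteq> {s, t}" and m': "ends F2 \<inter> ends F1 \<subseteq> {s, t}"
    using sp_parallel(4) by blast+
  show ?case
  proof
    assume "test (F1 \<union> F2) s t"
    then obtain e1 e2 where e: "e1 \<in> F1 \<union> F2" "e2 \<in> F1 \<union> F2" and
      c: "conn (F1 \<union> F2) UNIV (src e1) (tgt e2)" and
      z: "\<And>z. conn (F1 \<union> F2) (- {z}) s (tgt e2) \<or> conn (F1 \<union> F2) (- {z}) (src e1) t"
      unfolding test_def by blast
    show False
    proof (cases "e1 \<in> F1")
      case True
      show False by (rule not_test_parallel[OF sp_parallel(1,2) m sp_parallel.IH(1) True e(2) c z])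
    next
      case False
      then have "e1 \<in> F2" using e by blast
      from not_test_parallel[OF sp_parallel(2,1) m' sp_parallel.IH(2) this, of e2] e(2) c z
      show False by (simp add: Un_commute)
    qed
  qed
qed

text \<open>Flow on arcs instead of paths. A flow on arcs can be restricted to the parts of a
  composition, whereas paths of the composition are not paths of its parts.\<close>

definition eflow :: "'b set \<Rightarrow> 'a \<Rightarrow> 'a \<Rightarrow> ('b \<Rightarrow> real) \<Rightarrow> real \<Rightarrow> bool" where
  "eflow F s t f r \<longleftrightarrow> (\<forall>e\<in>F. 0 \<le> f e) \<and>
     (\<forall>x. x \<noteq> s \<longrightarrow> x \<noteq> t \<longrightarrow> sum f {e\<in>F. tgt e = x} = sum f {e\<in>F. src e = x}) \<and>
     sum f {e\<in>F. src e = s} = r"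

text \<open>Summed over all nodes, outflow and inflow cancel arc by arc, and by conservation only
  \<open>s\<close> and \<open>t\<close> contribute to the difference.\<close>

lemma eflow_into_target:
  assumes "eflow F s t f r" "sp F s t"
  shows "sum f {e\<in>F. tgt e = t} = r"
proof -
  note 1 = sp_facts[OF assms(2)]
  have fin: "finite (ends F)" using 1 by (simp add: ends_def)
  have "(\<Sum>x\<in>ends F. sum f {e\<in>F. src e = x}) = sum f F"
    by (rule sum.group[OF 1(2) fin]) (auto simp: ends_def)
  moreover have "(\<Sum>x\<in>ends F. sum f {e\<in>F. tgt e = x}) = sum f F"
    by (rule sum.group[OF 1(2) fin]) (auto simp: ends_def)
  ultimately have "(\<Sum>x\<in>ends F. sum f {e\<in>F. src e = x} - sum f {e\<in>F. tgt e = x}) = 0"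
    by (simp add: sum_subtractf)
  moreover have "(\<Sum>x\<in>ends F. sum f {e\<in>F. src e = x} - sum f {e\<in>F. tgt e = x}) =
      (\<Sum>x\<in>{s, t}. sum f {e\<in>F. src e = x} - sum f {e\<in>F. tgt e = x})"
    by (rule sum.mono_neutral_right[OF fin]) (use assms(1) 1 in \<open>auto simp: eflow_def\<close>)
  moreover have "{e\<in>F. tgt e = s} = {}" "{e\<in>F. src e = t} = {}" using 1 by auto
  moreover have "sum f {e\<in>F. src e = s} = r" using assms(1) by (simp add: eflow_def)
  ultimately show ?thesis using 1(1) by simp
qed

text \<open>The values \<open>r\<close> and \<open>r'\<close> may differ because the two flows can
  split differently between parallel branches. Some branch receives a positive amount of
  \<open>g\<close> that is at least its amount of \<open>f\<close>; otherwise \<open>g\<close> would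
  be smaller than \<open>f\<close> in total, or zero. In a series composition both parts carry the
  full value, and the paths are concatenated.\<close>

lemma sp_flow_path:
  assumes "sp F s t" "eflow F s t f r" "eflow F s t g r'" "r \<le> r'" "0 < r'"
  shows "\<exists>p. walk s p t \<and> set p \<subseteq> F \<and> (\<forall>e\<in>set p. f e \<le> g e \<and> 0 < g e)"
  using assms
proof (induction arbitrary: r r' rule: sp.induct)
  case (sp_arc e)
  have *: "{e' \<in> {e}. src e' = src e} = {e}" by auto
  have "f e \<le> g e" "0 < g e" using sp_arc unfolding eflow_def * by auto
  then show ?case by (intro exI[of _ "[e]"]) auto
next
  case (sp_series F1 s z F2 t)
  have m: "x \<in> ends F1 \<Longrightarrow> x \<in> ends F2 \<Longrightarrow> x = z" for x using sp_series(3) by blast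
  note 1 = sp_facts[OF sp_series(1)] and 2 = sp_facts[OF sp_series(2)]
  have tgt1: "{e\<in>F1 \<union> F2. tgt e = x} = {e\<in>F1. tgt e = x}"
    and src1: "x \<noteq> z \<Longrightarrow> {e\<in>F1 \<union> F2. src e = x} = {e\<in>F1. src e = x}" if "x \<in> ends F1" for x
    using m[of x] that tgt_ends[of _ F2] src_ends[of _ F2] 2(5) by auto
  have tgt2: "x \<noteq> z \<Longrightarrow> {e\<in>F1 \<union> F2. tgt e = x} = {e\<in>F2. tgt e = x}"
    and src2: "{e\<in>F1 \<union> F2. src e = x} = {e\<in>F2. src e = x}" if "x \<in> ends F2" for x
    using m[of x] that tgt_ends[of _ F1] src_ends[of _ F1] 1(6) by auto
  have e1: "eflow F1 s z h q" and e2: "eflow F2 z t h q" if h: "eflow (F1 \<union> F2) s t h q" for h q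
  proof -
    have cons: "sum h {e\<in>F1 \<union> F2. tgt e = x} = sum h {e\<in>F1 \<union> F2. src e = x}" if "x \<noteq> s" "x \<noteq> t" for x
      using h that by (simp add: eflow_def)
    have nn: "\<forall>e\<in>F1. 0 \<le> h e" "\<forall>e\<in>F2. 0 \<le> h e" using h by (auto simp: eflow_def)
    have out: "{e\<in>F. tgt e = x} = {}" "{e\<in>F. src e = x} = {}" if "x \<notin> ends F" for F x
      using that tgt_ends src_ends by blast+
    show e1: "eflow F1 s z h q"
      unfolding eflow_def
    proof (intro conjI nn allI impI)
      fix x assume x: "x \<noteq> s" "x \<noteq> z"
      show "sum h {e\<in>F1. tgt e = x} = sum h {e\<in>F1. src e = x}"
      proof (cases "x \<in> ends F1")
        case True
        then have "x \<noteq> t" using m 2 x by blast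
        then show ?thesis using cons[OF x(1)] tgt1[OF True] src1[OF True x(2)] by simp
      qed (simp add: out)
    next
      show "sum h {e\<in>F1. src e = s} = q"
        using h src1[OF 1(3,1)] by (simp add: eflow_def)
    qed
    have "sum h {e\<in>F2. src e = z} = sum h {e\<in>F1. tgt e = z}"
      using cons[of z] tgt1[OF 1(4)] src2[OF 2(3)] 1 2 by simp
    also have "\<dots> = q" by (rule eflow_into_target[OF e1 sp_series(1)])
    finally have v: "sum h {e\<in>F2. src e = z} = q" .
    show "eflow F2 z t h q"
      unfolding eflow_def
    proof (intro conjI nn allI impI v)
      fix x assume x: "x \<noteq> z" "x \<noteq> t"
      show "sum h {e\<in>F2. tgt e = x} = sum h {e\<in>F2. src e = x}"
      proof (cases "x \<in> ends F2")
        case True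
        then have "x \<noteq> s" using m 1 x by blast
        then show ?thesis using cons[OF _ x(2)] tgt2[OF True x(1)] src2[OF True] by simp
      qed (simp add: out)
    qed
  qed
  obtain p where p: "walk s p z" "set p \<subseteq> F1" "\<forall>e\<in>set p. f e \<le> g e \<and> 0 < g e"
    using sp_series.IH(1)[OF e1[OF sp_series.prems(1)] e1[OF sp_series.prems(2)] sp_series.prems(3,4)] by blast
  obtain q where q: "walk z q t" "set q \<subseteq> F2" "\<forall>e\<in>set q. f e \<le> g e \<and> 0 < g e"
    using sp_series.IH(2)[OF e2[OF sp_series.prems(1)] e2[OF sp_series.prems(2)] sp_series.prems(3,4)] by blast
  show ?case using p q by (intro exI[of _ "p @ q"]) auto
next
  case (sp_parallel F1 s t F2)
  have m: "x \<in> ends F1 \<Longrightarrow> x \<in> ends F2 \<Longrightarrow> x = s \<or> x = t" for x using sp_parallel(4) by blast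
  note 1 = sp_facts[OF sp_parallel(1)] and 2 = sp_facts[OF sp_parallel(2)]
  define v1 where "v1 h = sum h {e\<in>F1. src e = s}" for h :: "'b \<Rightarrow> real"
  define v2 where "v2 h = sum h {e\<in>F2. src e = s}" for h :: "'b \<Rightarrow> real"
  have out: "{e\<in>F. tgt e = x} = {}" "{e\<in>F. src e = x} = {}" if "x \<notin> ends F" for F x
    using that tgt_ends src_ends by blast+
  have un: "{e\<in>F1 \<union> F2. P e} = {e\<in>F1. P e} \<union> {e\<in>F2. P e}" for P by blast
  have *: "eflow F1 s t h (v1 h) \<and> eflow F2 s t h (v2 h) \<and> v1 h \<ge> 0 \<and> v2 h \<ge> 0 \<and> q = v1 h + v2 h"
    if h: "eflow (F1 \<union> F2) s t h q" for h q
  proof -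
    have nn: "\<forall>e\<in>F1. 0 \<le> h e" "\<forall>e\<in>F2. 0 \<le> h e" using h by (auto simp: eflow_def)
    have cons: "sum h {e\<in>F1. tgt e = x} = sum h {e\<in>F1. src e = x} \<and>
        sum h {e\<in>F2. tgt e = x} = sum h {e\<in>F2. src e = x}" if x: "x \<noteq> s" "x \<noteq> t" for x
    proof -
      have "sum h {e\<in>F1 \<union> F2. tgt e = x} = sum h {e\<in>F1 \<union> F2. src e = x}"
        using h that by (simp add: eflow_def)
      moreover have "x \<notin> ends F1 \<or> x \<notin> ends F2" using m x by blast
      ultimately show ?thesis
        by (elim disjE) (simp_all only: un out Un_empty_left Un_empty_right sum.empty simp_thms)
    qed
    have "sum h {e\<in>F1 \<union> F2. src e = s} = v1 h + v2 h"
      unfolding un v1_def v2_def using 1(2) 2(2) sp_parallel(3) by (intro sum.union_disjoint) auto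
    then show ?thesis
      using nn cons h unfolding eflow_def v1_def v2_def by (auto intro!: sum_nonneg)
  qed
  note f = *[OF sp_parallel.prems(1)] and g = *[OF sp_parallel.prems(2)]
  consider "v1 f \<le> v1 g" "0 < v1 g" | "v2 f \<le> v2 g" "0 < v2 g"
    using f g sp_parallel.prems(3,4) by linarith
  then show ?case
  proof cases
    case 1
    then show ?thesis using sp_parallel.IH(1)[of "v1 f" "v1 g"] f g by blast
  next
    case 2
    then show ?thesis using sp_parallel.IH(2)[of "v2 f" "v2 g"] f g by blast
  qed
qed

end

section \<open>Decomposing a closed arc set\<close>

context arc_ends begin

lemma closedD:
  assumes "closed F s t" "e \<in> F"
  shows "tgt e \<noteq> s" "src e \<noteq> t" "tgt e \<noteq> src e" "conn F UNIV s (src e)" "conn F UNIV (tgt e) t"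
proof -
  have "conn F (- {src e}) (tgt e) t" "conn F (- {tgt e}) s (src e)"
    using assms conn_in[of F "- {src e}" s "src e"] conn_in[of F "- {tgt e}" "tgt e" t]
    unfolding closed_def by blast+
  then show "tgt e \<noteq> s" "src e \<noteq> t" "tgt e \<noteq> src e" "conn F UNIV s (src e)" "conn F UNIV (tgt e) t"
    using conn_in by (auto elim!: conn_mono)
qed

lemma closed_conn:
  assumes "closed F s t" "F \<noteq> {}"
  shows "conn F UNIV s t"
proof -
  obtain e where e: "e \<in> F" using assms(2) by blast
  then show ?thesis
    using closedD[OF assms(1) e] conn_Cons[of e F UNIV t] conn_trans by blast
qed

lemma closed_terminals:
  assumes "closed F s t" "F \<noteq> {}" "s \<noteq> t"
  shows "s \<in> ends F" "t \<in> ends F"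
  using conn_arcs_between[OF closed_conn[OF assms(1,2)]] assms(3) src_ends tgt_ends by blast+

text \<open>Nothing leaves \<open>t\<close> and nothing enters \<open>s\<close>. A walk to a tail
  therefore cannot use \<open>e\<close>, being unable to leave \<open>t\<close> afterwards, and a
  walk from a head cannot come back to \<open>s\<close> in order to use it.\<close>

lemma closed_remove_arc:
  assumes "closed F s t" "e \<in> F" "src e = s" "tgt e = t"
  shows "closed (F - {e}) s t"
  unfolding closed_def
proof (intro ballI allI)
  fix a z assume a: "a \<in> F - {e}"
  note D = closedD[OF assms(1)]
  have 1: "b \<in> F - {e} \<and> src b \<in> - {t}" if "b \<in> F" "tgt b \<in> - {t}" for b
    using that D(2) assms(4) by auto
  have 2: "b \<in> F - {e} \<and> tgt b \<in> - {s}" if "b \<in> F" "src b \<in> - {s}" for b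
    using that D(1) assms(3) by auto
  have ends: "src a \<in> - {t}" "tgt a \<in> - {s}" using D a by auto
  have "conn F (- {z}) s (src a) \<or> conn F (- {z}) (tgt a) t"
    using assms(1) a unfolding closed_def by blast
  then show "conn (F - {e}) (- {z}) s (src a) \<or> conn (F - {e}) (- {z}) (tgt a) t"
  proof
    assume "conn F (- {z}) s (src a)"
    from stay_tgt[OF this ends(1) 1] show ?thesis by blast
  next
    assume "conn F (- {z}) (tgt a) t"
    from stay_src[OF this ends(2) 2] show ?thesis by blast
  qed
qed

text \<open>Closedness at this very \<open>z\<close> says that each arc starts on the side of
  \<open>s\<close> or ends on the side of \<open>t\<close>. No arc does both, since \<open>z\<close>
  separates the terminals; this defines the two parts.\<close>

lemma closed_series:
  assumes cl: "closed F s t" and F: "F \<noteq> {}" and st: "s \<noteq> t"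
    and z: "z \<noteq> s" "z \<noteq> t" "\<not> conn F (- {z}) s t"
  obtains F1 F2 where "F = F1 \<union> F2" "F1 \<inter> F2 = {}" "F1 \<noteq> {}" "F2 \<noteq> {}" "closed F1 s z" "closed F2 z t"
    "ends F1 \<inter> ends F2 = {z}"
proof -
  define B where "B = {x. conn F (- {z}) s x}"
  define A where "A = {x. conn F (- {z}) x t}"
  have AB: "x \<notin> A" if "x \<in> B" for x using that z(3) conn_trans unfolding A_def B_def by blast
  have zAB: "z \<notin> A" "z \<notin> B" unfolding A_def B_def using conn_in by blast+
  have sB: "s \<in> B" and tA: "t \<in> A" using z by (auto simp: A_def B_def intro: conn_refl)
  define F1 where "F1 = {e\<in>F. src e \<in> B}"
  define F2 where "F2 = {e\<in>F. tgt e \<in> A}"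
  have F12: "e \<in> F1 \<or> e \<in> F2" if "e \<in> F" for e
    using cl that unfolding closed_def F1_def F2_def A_def B_def by blast
  have nBA: "tgt e \<notin> A" if "e \<in> F1" for e
  proof
    assume "tgt e \<in> A"
    moreover have "e \<in> F" "src e \<in> B" using that by (auto simp: F1_def)
    ultimately have "src e \<in> A" using conn_Cons[of e F "- {z}" t] zAB unfolding A_def by blast
    then show False using AB \<open>src e \<in> B\<close> by blast
  qed
  have F1: "src e \<in> B" "tgt e \<in> insert z B" if "e \<in> F1" for e
  proof -
    show s: "src e \<in> B" using that by (simp add: F1_def)
    have "e \<in> F" using that by (simp add: F1_def)
    then show "tgt e \<in> insert z B" using s conn_step[of F "- {z}" s e] unfolding B_def by blast
  qed
  have F2: "tgt e \<in> A" "src e \<in> insert z A" if "e \<in> F2" for e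
  proof -
    show s: "tgt e \<in> A" using that by (simp add: F2_def)
    have "e \<in> F" using that by (simp add: F2_def)
    then show "src e \<in> insert z A" using s conn_Cons[of e F "- {z}" t] unfolding A_def by blast
  qed
  have F: "F = F1 \<union> F2" using F12 by (auto simp: F1_def F2_def)
  have disj: "F1 \<inter> F2 = {}" using nBA F2 by blast
  have e1: "ends F1 \<subseteq> insert z B" and e2: "ends F2 \<subseteq> insert z A"
    using F1 F2 by (auto intro!: ends_subset)
  have "\<exists>e\<in>F. src e = s" "\<exists>e\<in>F. tgt e = t"
    using conn_arcs_between[OF closed_conn[OF cl \<open>F \<noteq> {}\<close>]] st by blast+
  then have ne: "F1 \<noteq> {}" "F2 \<noteq> {}" using sB tA by (auto simp: F1_def F2_def)
  have cl1: "closed F1 s z"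
    unfolding closed_def
  proof (intro ballI allI)
    fix e w assume e: "e \<in> F1"
    have "conn F (- {w}) s (src e) \<or> conn F (- {w}) (tgt e) t"
      using cl e unfolding closed_def F by blast
    then show "conn F1 (- {w}) s (src e) \<or> conn F1 (- {w}) (tgt e) z"
    proof
      assume c: "conn F (- {w}) s (src e)"
      have "a \<in> F1 \<and> src a \<in> B" if "a \<in> F" "tgt a \<in> B" for a
      proof -
        have "a \<notin> F2" using F2(1) AB that(2) by blast
        then show ?thesis using F12[OF that(1)] F1(1) by blast
      qed
      from stay_tgt[OF c F1(1)[OF e] this] show ?thesis by blast
    next
      assume c: "conn F (- {w}) (tgt e) t"
      have wz: "w \<noteq> z" using c nBA[OF e] by (auto simp: A_def)
      \<comment> \<open>The walk has to pass \<open>z\<close> on its way to \<open>t\<close>, and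
        its part up to the first visit of \<open>z\<close> stays within \<open>F1\<close>.\<close>
      have "x \<in> insert z B \<longrightarrow> conn F1 (- {w}) x z" if "conn F (- {w}) x t" for x
        using that
      proof (induction rule: conn_converse_induct)
        case refl then show ?case using tA AB zAB by blast
      next
        case (step a)
        show ?case
        proof (cases "src a = z")
          case True then show ?thesis using wz by (auto intro: conn_refl)
        next
          case False
          show ?thesis
          proof
            assume "src a \<in> insert z B"
            then have a: "a \<in> F1" using False step by (auto simp: F1_def)
            then show "conn F1 (- {w}) (src a) z"
              using conn_Cons[OF a step(2)] step(4) F1(2)[OF a] by auto
          qed
        qed
      qed
      then show ?thesis using c F1(2)[OF e] by blast
    qed
  qed
  have cl2: "closed F2 z t"
    unfolding closed_def
  proof (intro ballI allI)
    fix e w assume e: "e \<in> F2"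
    have "conn F (- {w}) s (src e) \<or> conn F (- {w}) (tgt e) t"
      using cl e unfolding closed_def F by blast
    then show "conn F2 (- {w}) z (src e) \<or> conn F2 (- {w}) (tgt e) t"
    proof
      assume c: "conn F (- {w}) (tgt e) t"
      have "a \<in> F2 \<and> tgt a \<in> A" if "a \<in> F" "src a \<in> A" for a
      proof -
        have "a \<notin> F1" using F1(1) AB that(2) by blast
        then show ?thesis using F12[OF that(1)] F2(1) by blast
      qed
      from stay_src[OF c F2(1)[OF e] this] show ?thesis by blast
    next
      assume c: "conn F (- {w}) s (src e)"
      have "src e \<notin> B" using F2(2)[OF e] AB zAB by blast
      then have wz: "w \<noteq> z" using c by (auto simp: B_def)
      have "x \<in> insert z A \<longrightarrow> conn F2 (- {w}) z x" if "conn F (- {w}) s x" for x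
        using that
      proof (induction y\<equiv>s x rule: conn.induct)
        case conn_refl then show ?case using sB AB zAB by blast
      next
        case (conn_step a)
        show ?case
        proof (cases "tgt a = z")
          case True then show ?thesis using wz by (auto intro: conn_refl)
        next
          case False
          show ?thesis
          proof
            assume "tgt a \<in> insert z A"
            then have a: "a \<in> F2" using False conn_step by (auto simp: F2_def)
            have "conn F2 (- {w}) z (src a)" using conn_step F2(2)[OF a] by auto
            then show "conn F2 (- {w}) z (tgt a)" using conn.conn_step[OF _ a] conn_step by simp
          qed
        qed
      qed
      then show ?thesis using c F2(2)[OF e] by blast
    qed
  qed
  have "z \<in> ends F1" "z \<in> ends F2"
    using closed_terminals[OF cl1 ne(1)] closed_terminals[OF cl2 ne(2)] z by auto
  then have "ends F1 \<inter> ends F2 = {z}" using e1 e2 AB zAB by blast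
  then show ?thesis using that[OF F disj ne cl1 cl2] by blast
qed

text \<open>No arc joins an inner node in \<open>U\<close> to an inner node outside. As nothing
  enters \<open>s\<close> or leaves \<open>t\<close>, a walk that witnesses closedness cannot change
  sides through a terminal either.\<close>

lemma closed_parallel:
  assumes cl: "closed F s t" and st: "s \<noteq> t" and U: "s \<notin> U" "t \<notin> U"
    and US: "\<And>e. e \<in> F \<Longrightarrow> src e \<in> U \<Longrightarrow> tgt e \<noteq> t \<Longrightarrow> tgt e \<in> U"
    and UT: "\<And>e. e \<in> F \<Longrightarrow> tgt e \<in> U \<Longrightarrow> src e \<noteq> s \<Longrightarrow> src e \<in> U"
    and F1: "F1 = {e\<in>F. src e \<in> U \<or> tgt e \<in> U}" and F2: "F2 = F - F1"
    and ne: "F1 \<noteq> {}" "F2 \<noteq> {}"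
  shows "closed F1 s t" "closed F2 s t" "ends F1 \<inter> ends F2 = {s, t}"
proof -
  note D = closedD[OF cl]
  have cl0: "conn F (- {z}) s (src e) \<or> conn F (- {z}) (tgt e) t" if "e \<in> F" for e z
    using cl that unfolding closed_def by blast
  have A1: "a \<in> F1 \<and> src a \<in> insert s U" if "a \<in> F" "tgt a \<in> insert s U" for a
    using that D(1)[of a] UT F1 by blast
  have A2: "a \<in> F1 \<and> tgt a \<in> insert t U" if "a \<in> F" "src a \<in> insert t U" for a
    using that D(2)[of a] US F1 by blast
  have B1: "a \<in> F2 \<and> src a \<in> - U - {t}" if "a \<in> F" "tgt a \<in> - U - {t}" for a
    using that D(2)[of a] US F1 F2 by blast
  have B2: "a \<in> F2 \<and> tgt a \<in> - U - {s}" if "a \<in> F" "src a \<in> - U - {s}" for a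
    using that D(1)[of a] UT F1 F2 by blast
  have F1e: "src e \<in> insert s U" "tgt e \<in> insert t U" "e \<in> F" if "e \<in> F1" for e
    using that US UT F1 by blast+
  have F2e: "src e \<in> - U - {t}" "tgt e \<in> - U - {s}" "e \<in> F" if "e \<in> F2" for e
    using that F1 F2 D(1,2)[of e] by blast+
  show c1: "closed F1 s t"
    unfolding closed_def
  proof (intro ballI allI)
    fix e z assume e: "e \<in> F1"
    show "conn F1 (- {z}) s (src e) \<or> conn F1 (- {z}) (tgt e) t"
      using cl0[OF F1e(3)[OF e], of z] stay_tgt[OF _ F1e(1)[OF e] A1] stay_src[OF _ F1e(2)[OF e] A2] by blast
  qed
  show c2: "closed F2 s t"
    unfolding closed_def
  proof (intro ballI allI)
    fix e z assume e: "e \<in> F2"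
    show "conn F2 (- {z}) s (src e) \<or> conn F2 (- {z}) (tgt e) t"
      using cl0[OF F2e(3)[OF e], of z] stay_tgt[OF _ F2e(1)[OF e] B1] stay_src[OF _ F2e(2)[OF e] B2] by blast
  qed
  have "ends F1 \<subseteq> U \<union> {s, t}" "ends F2 \<subseteq> - U" using F1e F2e by (auto intro!: ends_subset)
  then show "ends F1 \<inter> ends F2 = {s, t}"
    using closed_terminals[OF c1 ne(1) st] closed_terminals[OF c2 ne(2) st] by blast
qed

text \<open>The walk behind \<open>e\<close> is followed up to its first visit of \<open>Z\<close>.
  The last clause records that the ear ends with \<open>e\<close> itself if the head of
  \<open>e\<close> already lies in \<open>Z\<close>.\<close>

lemma ear:
  assumes "e \<in> F" "conn F S (tgt e) t" "t \<in> Z" "src e \<notin> S"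
  obtains E b where "spath F (src e) E b" "b \<in> Z \<inter> S" "tgt ` set E \<subseteq> insert b (S - Z)" "E \<noteq> []"
    "b \<noteq> tgt e \<Longrightarrow> tgt e \<notin> Z"
proof (cases "tgt e \<in> Z")
  case True
  have "tgt e \<in> S" using conn_in[OF assms(2)] by blast
  moreover from this have "spath F (src e) [e] (tgt e)" using assms(1,4) by (auto simp: spath_def)
  ultimately show ?thesis using that[of "[e]" "tgt e"] True by auto
next
  case False
  then obtain e' where e': "e' \<in> F" "tgt e' \<in> S \<inter> Z" "conn F (S - Z) (tgt e) (src e')"
    using first_hit[OF assms(2) False assms(3)] by blast
  obtain p where p: "spath F (tgt e) p (src e')" "insert (tgt e) (tgt ` set p) \<subseteq> S - Z"
    using conn_spath[OF e'(3)] by blast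
  have "spath F (src e) (e # p @ [e']) (tgt e')"
    using p e' assms(1,4) by (auto simp: spath_def)
  moreover have "tgt ` set (e # p @ [e']) \<subseteq> insert (tgt e') (S - Z)" using p(2) by auto
  ultimately show ?thesis using e'(2) False that by blast
qed

lemma split_at_tgt:
  assumes "v \<in> tgt ` set p"
  obtains e p1 p2 where "p = p1 @ e # p2" "tgt e = v"
  using assms by (metis imageE split_list)


lemma conn_self: "conn F S x y \<Longrightarrow> conn F {y. conn F S x y} x y"
proof (induction rule: conn.induct)
  case (conn_refl x) then show ?case by (auto intro: conn.conn_refl)
next
  case (conn_step x e)
  then show ?case using conn.conn_step[of F S x e] by (auto intro!: conn.conn_step)
qed

lemma conn_self': "conn F S x y \<Longrightarrow> conn F {x. conn F S x y} x y"
proof (induction rule: conn_converse_induct)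
  case refl then show ?case by (auto intro: conn.conn_refl)
next
  case (step e)
  then show ?case using conn_Cons[of e F S y] by (auto intro!: conn_Cons)
qed

lemma conn_first: "conn F S x y \<Longrightarrow> x \<noteq> y \<Longrightarrow> \<exists>e\<in>F. src e = x \<and> conn F S (tgt e) y"
  by (induction rule: conn_converse_induct) auto

lemma conn_last: "conn F S x y \<Longrightarrow> x \<noteq> y \<Longrightarrow> \<exists>e\<in>F. tgt e = y \<and> conn F S x (src e)"
  by (induction rule: conn.induct) auto

text \<open>
  Let \<open>v\<close> be the last node of \<open>P\<close> that an ear (a path meeting \<open>P\<close> only in its ends) reaches from \<open>s\<close>. If \<open>v \<noteq> t\<close>,
  a walk avoiding \<open>v\<close> yields a second ear, from before \<open>v\<close> to behind \<open>v\<close>, overlapping the first one.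
\<close>

lemma braess_or_disjoint_paths:
  assumes cl: "closed F s t" and ne: "F \<noteq> {}" and st: "s \<noteq> t"
    and no_cut: "\<And>z. z \<noteq> s \<Longrightarrow> z \<noteq> t \<Longrightarrow> conn F (- {z}) s t"
  shows "(braess F s t \<and> cross F s t) \<or>
    (\<exists>P Q. spath F s P t \<and> spath F s Q t \<and> tgt ` set P \<inter> tgt ` set Q = {t})"
proof -
  obtain P where P: "spath F s P t" using conn_spath[OF closed_conn[OF cl ne]] by blast
  note eP = spath_ends[OF P]
  define V where "V = insert s (tgt ` set P)"
  \<comment> \<open>Besides \<open>s\<close>, the set \<open>W\<close> contains the nodes reachable
    from \<open>s\<close> without touching \<open>P\<close> again; \<open>J v\<close> will say that
    an ear from \<open>s\<close> ends in \<open>v\<close>.\<close>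
  define W where "W = {x. conn F (insert s (- V)) s x}"
  have sW: "s \<in> W" by (auto simp: W_def intro: conn_refl)
  have WV: "x = s" if "x \<in> W" "x \<in> V" for x using that conn_in by (auto simp: W_def)
  have W_step: "tgt e \<in> W" if "e \<in> F" "src e \<in> W" "tgt e \<notin> V" for e
    using that conn_step[of F "insert s (- V)" s e] by (auto simp: W_def)
  define J where "J v \<longleftrightarrow> (\<exists>e\<in>F. tgt e = v \<and> src e \<in> W)" for v
  have "P \<noteq> []" using eP(6) st by auto
  then obtain a P' where aP: "P = a # P'" by (cases P) auto
  have "J (tgt a)" using eP(1,6) sW by (auto simp: J_def aP)
  then have "\<exists>e\<in>set P. J (tgt e)" by (simp add: aP)
  from split_list_last_prop[OF this] obtain P1 e0 P2 where
    P12: "P = P1 @ e0 # P2" and e0: "J (tgt e0)" and last: "\<forall>e\<in>set P2. \<not> J (tgt e)"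
    by blast
  define v where "v = tgt e0"
  have vV: "v \<in> V" and vs: "v \<noteq> s" using eP(4) by (auto simp: v_def V_def P12)
  have dP: "v \<notin> tgt ` set P1" "v \<notin> tgt ` set P2" "tgt ` set P1 \<inter> tgt ` set P2 = {}"
    "s \<notin> tgt ` set P1" "s \<notin> tgt ` set P2"
    using P by (auto simp: spath_def P12 v_def)
  obtain ev where ev: "ev \<in> F" "tgt ev = v" "src ev \<in> W" using e0 by (auto simp: J_def v_def)
  have "conn F W s (src ev)" using ev(3) conn_self unfolding W_def by fastforce
  then obtain E where E: "spath F s E (src ev)" "insert s (tgt ` set E) \<subseteq> W" using conn_spath by blast
  have vW: "v \<notin> W" using WV vV vs by blast
  let ?E1 = "E @ [ev]"
  have E1: "spath F s ?E1 v"
  proof (rule spath_append[OF E(1)])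
    show "spath F (src ev) [ev] v" using ev vW by (auto simp: spath_def)
    show "tgt ` set [ev] \<inter> insert s (tgt ` set E) = {}" using E(2) ev(2) vW by auto
  qed
  have tE1: "tgt ` set ?E1 \<subseteq> insert v W" using E(2) ev by auto
  show ?thesis
  proof (cases "v = t")
    case True
    have "x = t" if "x \<in> tgt ` set P" "x \<in> tgt ` set ?E1" for x
    proof -
      have "x \<in> V" "x \<noteq> s" using that(1) eP(4) by (auto simp: V_def)
      moreover have "x \<in> insert v W" using that(2) tE1 by blast
      ultimately show ?thesis using WV True by blast
    qed
    moreover have "t \<in> tgt ` set P" "t \<in> tgt ` set ?E1" using eP(5) st True ev(2) by auto
    ultimately have "tgt ` set P \<inter> tgt ` set ?E1 = {t}" by blast
    then show ?thesis using P E1 True by blast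
  next
    case False
    \<comment> \<open>\<open>Y\<close> gathers all that lies before \<open>v\<close>. A walk around
      \<open>v\<close> leaves \<open>Y\<close> for the last time somewhere, and its next node on
      \<open>P\<close> must lie behind \<open>v\<close>.\<close>
    define Y where "Y = W \<union> tgt ` set P1"
    have tP: "t \<in> tgt ` set P" using eP(5) st by blast
    have "walk v P2 t" using eP(6) by (simp add: P12 v_def)
    then have tP2: "t \<in> tgt ` set P2" using walk_end_in[of v P2 t] False by (cases P2) auto
    have tY: "t \<notin> Y" using tP2 dP(3) WV[of t] tP st by (auto simp: Y_def V_def)
    obtain e where e: "e \<in> F" "src e \<in> - {v} \<inter> Y" "conn F (- {v} - Y) (tgt e) t"
      using last_exit[OF no_cut[OF vs False] _ tY] sW by (auto simp: Y_def)
    have tV: "t \<in> V" using tP by (simp add: V_def)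
    obtain E2 b where E2: "spath F (src e) E2 b" "b \<in> V \<inter> (- {v} - Y)"
      "tgt ` set E2 \<subseteq> insert b (- {v} - Y - V)" "E2 \<noteq> []" "b \<noteq> tgt e \<Longrightarrow> tgt e \<notin> V"
      using ear[OF e(1) e(3) tV] e(2) by blast
    have bP2: "b \<in> tgt ` set P2" using E2(2) sW by (auto simp: V_def Y_def P12 v_def)
    have nJ: "\<not> J b" using last bP2 by auto
    \<comment> \<open>An arc \<open>e\<close> starting in \<open>W\<close> would either complete an
      ear from \<open>s\<close> to \<open>b\<close>, which lies behind the last such place
      \<open>v\<close>, or lead into \<open>W\<close> and thus back into \<open>Y\<close>.\<close>
    have "src e \<notin> W"
    proof
      assume w: "src e \<in> W"
      show False
      proof (cases "tgt e \<in> V")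
        case True
        then show False using E2(5) nJ w e(1) unfolding J_def by blast
      next
        case False
        then have "tgt e \<in> Y" using W_step[OF e(1) w] by (simp add: Y_def)
        then show False using conn_in[OF e(3)] by blast
      qed
    qed
    then have uP1: "src e \<in> tgt ` set P1" using e(2) by (simp add: Y_def)
    obtain eu A X where A: "P1 = A @ eu # X" "tgt eu = src e" by (rule split_at_tgt[OF uP1])
    obtain eb C D where C: "P2 = C @ eb # D" "tgt eb = b" by (rule split_at_tgt[OF bP2])
    have PP: "P = (A @ [eu]) @ (X @ [e0]) @ (C @ [eb]) @ D" by (simp add: P12 A C)
    have "braess F s t \<and> cross F s t"
    proof (rule braess_crossI[of F s "A @ [eu]" "X @ [e0]" "C @ [eb]" D t "src e" v b ?E1 E2])
      show "spath F s ((A @ [eu]) @ (X @ [e0]) @ (C @ [eb]) @ D) t" using P PP by simp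
      show "walk s (A @ [eu]) (src e)" "walk (src e) (X @ [e0]) v" "walk v (C @ [eb]) b" "walk b D t"
        using eP(6) A(2) C(2) by (auto simp: PP v_def)
      show "spath F s ?E1 v" by (rule E1)
      show "spath F (src e) E2 b" by (rule E2(1))
      show "tgt ` set ?E1 \<inter> tgt ` set ((A @ [eu]) @ (X @ [e0]) @ (C @ [eb]) @ D) \<subseteq> {v}"
        unfolding PP[symmetric] using tE1 WV eP(4) unfolding V_def by blast
      show "tgt ` set E2 \<inter> insert s (tgt ` set ((A @ [eu]) @ (X @ [e0]) @ (C @ [eb]) @ D)) \<subseteq> {b}"
        unfolding PP[symmetric] V_def[symmetric] using E2(3) by blast
      have "b \<notin> W" "b \<noteq> v" using E2(2) by (auto simp: Y_def)
      then have "tgt ` set E2 \<inter> insert v W = {}" using E2(3) unfolding Y_def by blast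
      then show "tgt ` set ?E1 \<inter> tgt ` set E2 = {}" using tE1 by blast
    qed auto
    then show ?thesis by blast
  qed
qed

text \<open>Between its last node on \<open>P\<close> and its next node on \<open>Q\<close>, the
  connecting walk is the bridge of a Wheatstone net whose fourth corner is \<open>t\<close>. The
  main path follows \<open>P\<close>, crosses the bridge and continues on \<open>Q\<close>; the rest
  of \<open>P\<close> and the start of \<open>Q\<close> are the ears.\<close>

lemma braess_of_connected_paths:
  assumes P: "spath F s P t" and Q: "spath F s Q t" and PQ: "tgt ` set P \<inter> tgt ` set Q = {t}"
    and c: "conn F (- {s, t}) k q" and k: "k \<in> tgt ` set P" and q: "q \<in> tgt ` set Q"
  shows "braess F s t \<and> cross F s t"
proof -
  note eP = spath_ends[OF P] and eQ = spath_ends[OF Q]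
  define K where "K = tgt ` set P - {t}"
  define L where "L = tgt ` set Q - {t}"
  have kq: "k \<in> - {s, t}" "q \<in> - {s, t}" using conn_in[OF c] by auto
  have kK: "k \<in> K" and qL: "q \<in> L" using k q kq by (auto simp: K_def L_def)
  have KL: "K \<inter> L = {}" using PQ by (auto simp: K_def L_def)
  then have "q \<notin> K" using qL by blast
  then obtain e where e: "e \<in> F" "src e \<in> - {s, t} \<inter> K" "conn F (- {s, t} - K) (tgt e) q"
    using last_exit[OF c kK] by blast
  obtain E v where E: "spath F (src e) E v" "v \<in> L \<inter> (- {s, t} - K)"
      "tgt ` set E \<subseteq> insert v (- {s, t} - K - L)" "E \<noteq> []"
  proof (rule ear[OF e(1,3) qL])
    show "src e \<notin> - {s, t} - K" using e(2) by blast
  qed (rule that)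
  have uP: "src e \<in> tgt ` set P" using e(2) by (simp add: K_def)
  have vQ: "v \<in> tgt ` set Q" using E(2) by (simp add: L_def)
  obtain eu A A' where A: "P = A @ eu # A'" "tgt eu = src e" by (rule split_at_tgt[OF uP])
  obtain ev C C' where C: "Q = C @ ev # C'" "tgt ev = v" by (rule split_at_tgt[OF vQ])
  have vt: "v \<noteq> t" and ut: "src e \<noteq> t" using E(2) e(2) by auto
  have wP: "walk s (A @ [eu]) (src e)" "walk (src e) A' t" using eP(6) A by auto
  have wQ: "walk s (C @ [ev]) v" "walk v C' t" using eQ(6) C by auto
  have C'ne: "C' \<noteq> []" using wQ(2) vt by auto
  have tC: "t \<in> tgt ` set C'" using walk_end_in[OF wQ(2) C'ne] .
  have A'ne: "A' \<noteq> []" using wP(2) ut by auto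
  have tA: "t \<in> tgt ` set A'" using walk_end_in[OF wP(2) A'ne] .
  have dP: "distinct (s # map tgt (A @ [eu]) @ map tgt A')" using P by (simp add: spath_def A(1))
  have dQ: "distinct (s # map tgt (C @ [ev]) @ map tgt C')" using Q by (simp add: spath_def C(1))
  have K': "tgt ` set (A @ [eu]) \<subseteq> K" "tgt ` set A' \<subseteq> insert t K"
    using dP tA by (auto simp: K_def A(1))
  have L': "tgt ` set (C @ [ev]) \<subseteq> L" "tgt ` set C' \<subseteq> insert t L" "v \<notin> tgt ` set C'"
    using dQ tC C(2) by (auto simp: L_def C(1))
  have sKL: "s \<notin> K" "s \<notin> L" "t \<notin> K" "t \<notin> L" using eP(4) eQ(4) by (auto simp: K_def L_def)
  have tE: "tgt ` set E \<inter> insert s (insert t (K \<union> (L - {v}))) = {}" using E(2,3) KL sKL by blast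
  show ?thesis
  proof (rule braess_crossI[of F s "A @ [eu]" E C' "[]" t "src e" v t "C @ [ev]" A'])
    show "walk s (A @ [eu]) (src e)" "walk v C' t" by fact+
    show "walk (src e) E v" by (rule spath_ends(6)[OF E(1)])
    show "E \<noteq> []" "C' \<noteq> []" by fact+
    have sp1: "spath F s (A @ [eu]) (src e)" and sp2: "spath F (src e) A' t"
      using P wP dP A by (auto simp: spath_def)
    have sp3: "spath F s (C @ [ev]) v" and sp4: "spath F v C' t"
      using Q wQ dQ C by (auto simp: spath_def)
    show "spath F s (C @ [ev]) v" "spath F (src e) A' t" by fact+
    have "spath F s ((A @ [eu]) @ E) v"
    proof (rule spath_append[OF sp1 E(1)])
      show "tgt ` set E \<inter> insert s (tgt ` set (A @ [eu])) = {}" using tE K'(1) by blast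
    qed
    then have "spath F s (((A @ [eu]) @ E) @ C') t"
    proof (rule spath_append[OF _ sp4])
      have "tgt ` set C' \<inter> tgt ` set (A @ [eu]) = {}" using K'(1) L'(2) KL sKL by blast
      moreover have "tgt ` set C' \<inter> tgt ` set E = {}" using tE L'(2,3) by blast
      moreover have "s \<notin> tgt ` set C'" using dQ by auto
      ultimately show "tgt ` set C' \<inter> insert s (tgt ` set ((A @ [eu]) @ E)) = {}"
        unfolding set_append image_Un by blast
    qed
    then show "spath F s ((A @ [eu]) @ E @ C' @ []) t" by simp
    have *: "tgt ` set ((A @ [eu]) @ E @ C' @ []) = tgt ` set (A @ [eu]) \<union> tgt ` set E \<union> tgt ` set C'"
      by (auto simp: image_Un)
    have CC: "tgt ` set (C @ [ev]) \<inter> tgt ` set C' = {}" using dQ by auto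
    show "tgt ` set (C @ [ev]) \<inter> tgt ` set ((A @ [eu]) @ E @ C' @ []) \<subseteq> {v}"
      unfolding *
    proof
      fix x assume x: "x \<in> tgt ` set (C @ [ev]) \<inter> (tgt ` set (A @ [eu]) \<union> tgt ` set E \<union> tgt ` set C')"
      then have "x \<in> L" using L'(1) by blast
      then have "x \<notin> tgt ` set (A @ [eu])" using K'(1) KL by blast
      then have "x \<in> tgt ` set E" using x CC by blast
      then show "x \<in> {v}" using \<open>x \<in> L\<close> tE by blast
    qed
    have AA: "tgt ` set A' \<inter> insert s (tgt ` set (A @ [eu])) = {}" using dP by auto
    show "tgt ` set A' \<inter> insert s (tgt ` set ((A @ [eu]) @ E @ C' @ [])) \<subseteq> {t}"
      unfolding *
    proof
      fix x assume x: "x \<in> tgt ` set A' \<inter> insert s (tgt ` set (A @ [eu]) \<union> tgt ` set E \<union> tgt ` set C')"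
      then have "x \<in> insert t K" using K'(2) by blast
      then have "x \<notin> tgt ` set E" using tE by blast
      then have "x \<in> tgt ` set C'" using x AA by blast
      then have "x \<in> insert t L" using L'(2) by blast
      then show "x \<in> {t}" using \<open>x \<in> insert t K\<close> KL by blast
    qed
    show "tgt ` set (C @ [ev]) \<inter> tgt ` set A' = {}" using L'(1) K'(2) KL sKL by blast
  qed auto
qed


text \<open>Without arcs into \<open>s\<close> or out of \<open>t\<close>, a walk can meet
  \<open>s\<close> only at its start and \<open>t\<close> only at its end.\<close>

lemma conn_interior:
  assumes "closed F s t" "conn F UNIV x y" "x \<noteq> s" "y \<noteq> t"
  shows "conn F (- {s, t}) x y"
  using assms(2-)
proof (induction rule: conn.induct)
  case (conn_refl x) then show ?case by (auto intro: conn.conn_refl)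
next
  case (conn_step x e)
  then show ?case
    using closedD(1,2)[OF assms(1) conn_step.hyps(2)] conn.conn_step[of F "- {s, t}" x e] by blast
qed

text \<open>
  \<open>U\<close> consists of the inner nodes that can reach an inner node of \<open>P\<close> or be reached from one, without using \<open>s\<close>
  and \<open>t\<close>. An arc between \<open>U\<close> and the other inner nodes lies on a walk that avoids \<open>P\<close>, and this
  walk contains a path disjoint from \<open>P\<close> but connected to it.
\<close>

lemma braess_or_parallel:
  assumes cl: "closed F s t" and st: "s \<noteq> t"
    and no_arc: "\<And>e. e \<in> F \<Longrightarrow> src e = s \<Longrightarrow> tgt e \<noteq> t"
    and P: "spath F s P t" and Q: "spath F s Q t" and PQ: "tgt ` set P \<inter> tgt ` set Q = {t}"
    and nb: "\<not> (braess F s t \<and> cross F s t)"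
  obtains F1 F2 where "F = F1 \<union> F2" "F1 \<inter> F2 = {}" "F1 \<noteq> {}" "F2 \<noteq> {}" "closed F1 s t" "closed F2 s t"
    "ends F1 \<inter> ends F2 = {s, t}"
proof -
  define S where "S = - {s, t}"
  define K where "K = tgt ` set P - {t}"
  define U where "U = {w. \<exists>k\<in>K. conn F S k w \<or> conn F S w k}"
  have sK: "s \<notin> K" "t \<notin> K" using spath_ends(4)[OF P] by (auto simp: K_def)
  have sU: "s \<notin> U" "t \<notin> U" using conn_in by (auto simp: U_def S_def)
  have KU: "K \<subseteq> U" using sK by (auto simp: U_def S_def intro: conn_refl)
  note D = closedD[OF cl]
  note int = conn_interior[OF cl, folded S_def]
  have nW: False if "spath F s P' t" "spath F s Q' t" "tgt ` set P' \<inter> tgt ` set Q' = {t}"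
    "conn F S k q" "k \<in> tgt ` set P'" "q \<in> tgt ` set Q'" for P' Q' k q
    using braess_of_connected_paths[OF that(1,2,3) _ that(5,6)] that(4) nb unfolding S_def by blast
  have tP: "t \<in> tgt ` set P" using spath_ends(5)[OF P] st by blast
  have US: "tgt e \<in> U" if e: "e \<in> F" "src e \<in> U" "tgt e \<noteq> t" for e
  proof (rule ccontr)
    assume nU: "tgt e \<notin> U"
    let ?w = "src e" and ?w' = "tgt e"
    have SS: "?w \<in> S" "?w' \<in> S" using e D(1)[OF e(1)] sU by (auto simp: S_def)
    have nk: "\<not> conn F S k ?w'" "\<not> conn F S ?w' k" if "k \<in> K" for k using nU that by (auto simp: U_def)
    then have nk1: "\<not> conn F S k ?w" if "k \<in> K" for k
      using that conn_step[of F S k e] e(1) SS by blast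
    then obtain k where k: "k \<in> K" "conn F S ?w k" using e(2) unfolding U_def by blast
    obtain f where f: "f \<in> F" "src f = s" "conn F UNIV (tgt f) ?w"
      using conn_first[OF D(4)[OF e(1)]] SS by (auto simp: S_def)
    \<comment> \<open>A walk from \<open>s\<close> through \<open>e\<close> to \<open>t\<close>
      whose other nodes lie in \<open>Z\<close> misses the inner nodes of \<open>P\<close>: nothing
      before \<open>e\<close> is reachable from \<open>K\<close>, and nothing behind
      \<open>e\<close> reaches \<open>K\<close>. Yet its second node reaches \<open>k\<close>, so
      the two paths are connected.\<close>
    define Z where "Z = {x. conn F UNIV x ?w \<and> x \<noteq> s} \<union> {x. conn F UNIV ?w' x}"
    have f_s: "tgt f \<noteq> s" using D(1) f by blast
    have w_t: "?w \<noteq> t" "?w' \<noteq> s" using D e by blast+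
    have ZK: "Z \<inter> K = {}"
    proof -
      have "x \<notin> K" if "conn F UNIV x ?w" "x \<noteq> s" for x
        using int[OF that w_t(1)] nk1 by blast
      moreover have "x \<notin> K" if "conn F UNIV ?w' x" for x
        using int[OF that w_t(2)] nk(2) sK by blast
      ultimately show ?thesis unfolding Z_def by blast
    qed
    have "conn F {x. conn F S x ?w} (tgt f) ?w" by (rule conn_self'[OF int[OF f(3) f_s w_t(1)]])
    then have c1: "conn F Z (tgt f) ?w"
      by (rule conn_mono) (use conn_in in \<open>auto simp: Z_def S_def elim: conn_mono\<close>)
    have c2: "conn F Z ?w' t"
      by (rule conn_mono[OF conn_self[OF D(5)[OF e(1)]]]) (auto simp: Z_def)
    have c: "conn F Z (tgt f) t" using conn_trans[OF conn_Cons[OF e(1) _ c2] c1] conn_in[OF c1] by blast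
    obtain p where p: "spath F (tgt f) p t" "insert (tgt f) (tgt ` set p) \<subseteq> Z" using conn_spath[OF c] by blast
    have sZ: "s \<notin> Z"
      using conn_last[of F UNIV ?w' s] D(1) w_t(2) unfolding Z_def by blast
    have Q': "spath F s (f # p) t" using p f sZ by (auto simp: spath_def)
    have "tgt ` set (f # p) \<subseteq> Z" using p(2) by auto
    moreover have "t \<in> tgt ` set (f # p)" using spath_ends(5)[OF Q'] st by blast
    ultimately have "tgt ` set (f # p) \<inter> tgt ` set P = {t}" using ZK tP unfolding K_def by blast
    moreover have "conn F S (tgt f) k" using conn_trans[OF k(2) int[OF f(3) f_s w_t(1)]] .
    ultimately show False using nW[OF Q' P] k(1) by (auto simp: K_def)
  qed
  have UT: "src e \<in> U" if e: "e \<in> F" "tgt e \<in> U" "src e \<noteq> s" for e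
  proof (rule ccontr)
    assume nU: "src e \<notin> U"
    let ?w = "tgt e" and ?w' = "src e"
    have SS: "?w \<in> S" "?w' \<in> S" using e D(2)[OF e(1)] sU by (auto simp: S_def)
    have nk: "\<not> conn F S k ?w'" "\<not> conn F S ?w' k" if "k \<in> K" for k using nU that by (auto simp: U_def)
    then have nk1: "\<not> conn F S ?w k" if "k \<in> K" for k
      using that conn_Cons[of e F S k] e(1) SS by blast
    then obtain k where k: "k \<in> K" "conn F S k ?w" using e(2) unfolding U_def by blast
    obtain f where f: "f \<in> F" "tgt f = t" "conn F UNIV ?w (src f)"
      using conn_last[OF D(5)[OF e(1)]] SS by (auto simp: S_def)
    define Z where "Z = {x. conn F UNIV x ?w'} \<union> {x. conn F UNIV ?w x \<and> x \<noteq> t}"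
    have f_t: "src f \<noteq> t" using D(2) f by blast
    have w_t: "?w \<noteq> s" "?w' \<noteq> t" using D e by blast+
    have ZK: "Z \<inter> K = {}"
    proof -
      have "x \<notin> K" if "conn F UNIV ?w x" "x \<noteq> t" for x
        using int[OF that(1) w_t(1) that(2)] nk1 by blast
      moreover have "x \<notin> K" if "conn F UNIV x ?w'" for x
        using int[OF that _ w_t(2)] nk(1) sK by blast
      ultimately show ?thesis unfolding Z_def by blast
    qed
    have tc: "x = t" if "conn F UNIV t x" for x using conn_first[OF that] D(2) by blast
    have "conn F {x. conn F S ?w x} ?w (src f)" by (rule conn_self[OF int[OF f(3) w_t(1) f_t]])
    then have c2: "conn F Z ?w (src f)"
      by (rule conn_mono) (use conn_in in \<open>auto simp: Z_def S_def elim: conn_mono\<close>)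
    have c1: "conn F Z s ?w'"
      by (rule conn_mono[OF conn_self'[OF D(4)[OF e(1)]]]) (auto simp: Z_def)
    have c: "conn F Z s (src f)" using conn_trans[OF conn_Cons[OF e(1) _ c2] c1] conn_in[OF c1] by blast
    obtain p where p: "spath F s p (src f)" "insert s (tgt ` set p) \<subseteq> Z" using conn_spath[OF c] by blast
    have tZ: "t \<notin> Z" using tc[of ?w'] w_t unfolding Z_def by blast
    have Q': "spath F s (p @ [f]) t" using p f tZ st by (auto simp: spath_def)
    have "tgt ` set (p @ [f]) \<subseteq> insert t Z" using p(2) f(2) by auto
    moreover have "t \<in> tgt ` set (p @ [f])" using f(2) by auto
    ultimately have "tgt ` set (p @ [f]) \<inter> tgt ` set P = {t}" using ZK tP unfolding K_def by blast
    then have *: "tgt ` set P \<inter> tgt ` set (p @ [f]) = {t}" by blast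
    have cc: "conn F S k (src f)" using conn_trans[OF int[OF f(3) w_t(1) f_t] k(2)] .
    then have "src f \<noteq> s" using conn_in by (auto simp: S_def)
    then have "src f \<in> tgt ` set (p @ [f])" using spath_ends(5)[OF p(1)] by auto
    then show False using nW[OF P Q' * cc] k(1) by (auto simp: K_def)
  qed
  define F1 where "F1 = {e\<in>F. src e \<in> U \<or> tgt e \<in> U}"
  have first: "\<exists>e\<in>F. src e = s \<and> tgt e \<in> tgt ` set R - {t}" if R: "spath F s R t" for R
  proof -
    have "R \<noteq> []" using spath_ends(6)[OF R] st by auto
    then obtain e R' where "R = e # R'" by (cases R) auto
    then show ?thesis using spath_ends(1,6)[OF R] no_arc by auto
  qed
  have QU: "q \<notin> U" if q: "q \<in> tgt ` set Q - {t}" for q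
  proof
    assume "q \<in> U"
    then obtain k where k: "k \<in> K" "conn F S k q \<or> conn F S q k" unfolding U_def by blast
    have QP: "tgt ` set Q \<inter> tgt ` set P = {t}" using PQ by blast
    show False using k(2) nW[OF P Q PQ, of k q] nW[OF Q P QP, of q k] k(1) q by (auto simp: K_def)
  qed
  have ne1: "F1 \<noteq> {}" using first[OF P] KU unfolding F1_def K_def by blast
  have ne2: "F - F1 \<noteq> {}" using first[OF Q] QU sU unfolding F1_def by blast
  note par = closed_parallel[OF cl st sU US UT F1_def refl ne1 ne2]
  show ?thesis by (rule that[OF _ _ ne1 ne2 par]) (auto simp: F1_def)
qed

theorem closed_sp_or_braess:
  assumes "finite F" "F \<noteq> {}" "s \<noteq> t" "closed F s t"
  shows "sp F s t \<or> (braess F s t \<and> cross F s t)"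
  using assms
proof (induction "card F" arbitrary: F s t rule: less_induct)
  case less
  have smaller: "sp F' s' t' \<or> (braess F' s' t' \<and> cross F' s' t')"
    if "F' \<subset> F" "F' \<noteq> {}" "s' \<noteq> t'" "closed F' s' t'" for F' s' t'
  proof (rule less.hyps)
    show "card F' < card F" using psubset_card_mono[OF less.prems(1) that(1)] .
    show "finite F'" using that(1) less.prems(1) finite_subset by blast
  qed fact+
  \<comment> \<open>Arcs from \<open>s\<close> to \<open>t\<close> are split off before anything
    else. Without them, both of two disjoint paths have inner nodes, which makes both branches of a
    parallel split nonempty.\<close>
  show ?case
  proof (cases "\<exists>e\<in>F. src e = s \<and> tgt e = t")
    case True
    then obtain e where e: "e \<in> F" "src e = s" "tgt e = t" by blast
    have se: "sp {e} s t" using sp_arc[of e] e less.prems(3) by auto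
    show ?thesis
    proof (cases "F = {e}")
      case True then show ?thesis using se by simp
    next
      case False
      then have ne: "F - {e} \<noteq> {}" using e by blast
      have cl: "closed (F - {e}) s t" by (rule closed_remove_arc[OF less.prems(4) e])
      have F: "F = {e} \<union> (F - {e})" using e by blast
      have "sp (F - {e}) s t \<or> (braess (F - {e}) s t \<and> cross (F - {e}) s t)"
        using smaller[OF _ ne less.prems(3) cl] e by blast
      then show ?thesis
      proof
        assume *: "sp (F - {e}) s t"
        have "ends {e} = {s, t}" using e by (auto simp: ends_def)
        then have "ends {e} \<inter> ends (F - {e}) = {s, t}"
          using closed_terminals[OF cl ne less.prems(3)] by blast
        then show ?thesis using sp_parallel[OF se *] F by auto
      next
        assume "braess (F - {e}) s t \<and> cross (F - {e}) s t"
        then show ?thesis using braess_mono cross_mono Diff_subset by metis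
      qed
    qed
  next
    case no_arc: False
    show ?thesis
    proof (cases "\<exists>z. z \<noteq> s \<and> z \<noteq> t \<and> \<not> conn F (- {z}) s t")
      case True
      then obtain z where z: "z \<noteq> s" "z \<noteq> t" "\<not> conn F (- {z}) s t" by blast
      obtain F1 F2 where *: "F = F1 \<union> F2" "F1 \<inter> F2 = {}" "F1 \<noteq> {}" "F2 \<noteq> {}" "closed F1 s z" "closed F2 z t"
        "ends F1 \<inter> ends F2 = {z}"
        by (rule closed_series[OF less.prems(4,2,3) z])
      have sub: "F1 \<subset> F" "F2 \<subset> F" using * by blast+
      have 1: "sp F1 s z \<or> (braess F1 s z \<and> cross F1 s z)"
        by (rule smaller[OF sub(1) *(3) z(1)[symmetric] *(5)])
      have 2: "sp F2 z t \<or> (braess F2 z t \<and> cross F2 z t)"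
        by (rule smaller[OF sub(2) *(4) z(2) *(6)])
      have c1: "conn F1 UNIV s z" by (rule closed_conn[OF *(5,3)])
      have c2: "conn F2 UNIV z t" by (rule closed_conn[OF *(6,4)])
      obtain w1 w2 where w: "spath F1 s w1 z" "spath F2 z w2 t"
        using conn_spath[OF c1] conn_spath[OF c2] by blast
      consider "sp F1 s z" "sp F2 z t" | "braess F1 s z" "cross F1 s z" | "braess F2 z t" "cross F2 z t"
        using 1 2 by blast
      then show ?thesis
      proof cases
        case 1
        then show ?thesis using sp_series[OF 1 *(7)] *(1) by simp
      next
        case 2
        then show ?thesis
          using braess_series_left[OF 2(1) w(2) *(7)] cross_series_left[OF 2(2) c2 *(7)] *(1) by simp
      next
        case 3
        then show ?thesis
          using braess_series_right[OF 3(1) w(1) *(7)] cross_series_right[OF 3(2) c1 *(7)] *(1) by simp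
      qed
    next
      case False
      show ?thesis
      proof (cases "braess F s t \<and> cross F s t")
        case nb: False
        have na: "\<And>e. e \<in> F \<Longrightarrow> src e = s \<Longrightarrow> tgt e \<noteq> t" using no_arc by blast
        have nc: "\<And>z. z \<noteq> s \<Longrightarrow> z \<noteq> t \<Longrightarrow> conn F (- {z}) s t" using False by blast
        obtain P Q where PQ: "spath F s P t" "spath F s Q t" "tgt ` set P \<inter> tgt ` set Q = {t}"
          using braess_or_disjoint_paths[OF less.prems(4,2,3) nc] nb by blast
        obtain F1 F2 where *: "F = F1 \<union> F2" "F1 \<inter> F2 = {}" "F1 \<noteq> {}" "F2 \<noteq> {}" "closed F1 s t" "closed F2 s t"
          "ends F1 \<inter> ends F2 = {s, t}"
          by (rule braess_or_parallel[OF less.prems(4,3) na PQ nb])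
        have sub: "F1 \<subset> F" "F2 \<subset> F" using * by blast+
        have "sp F1 s t" using smaller[OF sub(1) *(3) less.prems(3) *(5)] nb braess_mono cross_mono sub by blast
        moreover have "sp F2 s t" using smaller[OF sub(2) *(4) less.prems(3) *(6)] nb braess_mono cross_mono sub by blast
        ultimately show ?thesis using sp_parallel[OF _ _ *(2) *(7)] *(1) by simp
      qed blast
    qed
  qed
qed

end

section \<open>Wardrop flows\<close>

sublocale net \<subseteq> ae: arc_ends "tail G" "head G" .

context net begin

lemma cas_iff_walk: "cas x p y \<longleftrightarrow> ae.walk x p y"
  by (induction p arbitrary: x) auto

lemma awalk_iff: "awalk x p y \<longleftrightarrow> x \<in> verts G \<and> set p \<subseteq> arcs G \<and> ae.walk x p y"
  by (simp add: awalk_def cas_iff_walk)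

lemma awalk_verts_walk: "ae.walk x p y \<Longrightarrow> awalk_verts x p = x # map (head G) p"
  by (induction p arbitrary: x) auto

lemma SP_iff: "p \<in> SP G s t \<longleftrightarrow> ae.spath (arcs G) s p t"
  using source_in_verts awalk_verts_walk
  by (auto simp: SP_def apath_def awalk_iff ae.spath_def)

lemma SP_distinct: "p \<in> SP G s t \<Longrightarrow> distinct p"
  by (auto simp: SP_iff ae.spath_def distinct_map)

lemma SP_arcs: "p \<in> SP G s t \<Longrightarrow> set p \<subseteq> arcs G"
  by (auto simp: SP_iff ae.spath_def)

lemma finite_SP: "finite (SP G s t)"
  unfolding SP_def by (rule apaths_finite)

lemma SP_awalk: "p \<in> SP G s t \<Longrightarrow> awalk s p t"
  by (simp add: SP_def apath_def)

abbreviation "ef \<equiv> edge_flow G s t"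
abbreviation "pl \<equiv> path_latency G s t"

lemma edge_flow_if: "ef \<phi> e = (\<Sum>p\<in>SP G s t. if e \<in> set p then \<phi> p else 0)"
  unfolding edge_flow_def by (rule sum.inter_filter[OF finite_SP])

lemma edge_flow_nonneg: "is_flow G s t \<phi> \<Longrightarrow> 0 \<le> ef \<phi> e"
  unfolding edge_flow_def is_flow_def by (auto intro!: sum_nonneg)

text \<open>Double counting of the pairs of a path and an arc on it. It translates between path
  latencies and arc loads.\<close>

lemma sum_edge_flow:
  assumes "finite F" "\<And>p. p \<in> SP G s t \<Longrightarrow> set p \<subseteq> F"
  shows "(\<Sum>e\<in>F. ef \<phi> e * c e) = (\<Sum>p\<in>SP G s t. \<phi> p * (\<Sum>e\<in>set p. c e))"
proof -
  have "(\<Sum>e\<in>F. ef \<phi> e * c e) = (\<Sum>e\<in>F. \<Sum>p\<in>SP G s t. if e \<in> set p then \<phi> p * c e else 0)"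
    unfolding edge_flow_if sum_distrib_right by (intro sum.cong refl) auto
  also have "\<dots> = (\<Sum>p\<in>SP G s t. \<Sum>e\<in>F. if e \<in> set p then \<phi> p * c e else 0)"
    by (rule sum.swap)
  also have "\<dots> = (\<Sum>p\<in>SP G s t. \<phi> p * (\<Sum>e\<in>set p. c e))"
  proof (rule sum.cong[OF refl])
    fix p assume p: "p \<in> SP G s t"
    have "(\<Sum>e\<in>F. if e \<in> set p then \<phi> p * c e else 0) = (\<Sum>e\<in>F \<inter> set p. \<phi> p * c e)"
      by (rule sum.inter_restrict[OF assms(1), symmetric])
    also have "F \<inter> set p = set p" using assms(2)[OF p] by blast
    finally show "(\<Sum>e\<in>F. if e \<in> set p then \<phi> p * c e else 0) = \<phi> p * (\<Sum>e\<in>set p. c e)"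
      by (simp add: sum_distrib_left)
  qed
  finally show ?thesis .
qed

lemma path_latency_SP: "p \<in> SP G s t \<Longrightarrow> pl l \<phi> p = (\<Sum>e\<in>set p. l e (ef \<phi> e))"
  unfolding path_latency_def by (simp add: sum_list_distinct_conv_sum_set SP_distinct)

lemma sum_set_le_sum_list:
  fixes f :: "'c \<Rightarrow> real"
  shows "(\<And>x. x \<in> set xs \<Longrightarrow> 0 \<le> f x) \<Longrightarrow> sum f (set xs) \<le> sum_list (map f xs)"
proof (induction xs)
  case (Cons a xs)
  then have IH: "sum f (set xs) \<le> sum_list (map f xs)" "0 \<le> f a" by auto
  then show ?case by (cases "a \<in> set xs") (auto simp: insert_absorb)
qed simp

text \<open>Latencies are nonnegative, so cutting out cycles saves cost. The Wardrop condition thus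
  has to be verified against simple paths only.\<close>

lemma awalk_SP_latency:
  assumes "latency_function G l" "is_flow G s t \<phi>" "awalk s q t"
  obtains q' where "q' \<in> SP G s t" "pl l \<phi> q' \<le> pl l \<phi> q"
proof -
  let ?q = "awalk_to_apath q"
  have q: "?q \<in> SP G s t" using apath_awalk_to_apath[OF assms(3)] by (simp add: SP_def)
  have nn: "0 \<le> l e (ef \<phi> e)" if "e \<in> arcs G" for e
    using assms(1) edge_flow_nonneg[OF assms(2)] that unfolding latency_function_def by blast
  have qa: "set q \<subseteq> arcs G" using assms(3) by (simp add: awalk_iff)
  have "pl l \<phi> ?q = (\<Sum>e\<in>set ?q. l e (ef \<phi> e))" by (rule path_latency_SP[OF q])
  also have "\<dots> \<le> (\<Sum>e\<in>set q. l e (ef \<phi> e))"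
    by (rule sum_mono2) (use awalk_to_apath_subset[OF assms(3)] nn qa in auto)
  also have "\<dots> \<le> pl l \<phi> q"
    unfolding path_latency_def by (rule sum_set_le_sum_list) (use nn qa in auto)
  finally show ?thesis using q that by blast
qed

lemma wardrop_positive_SP:
  assumes "wardrop_flow G s t r l \<phi>" "0 < \<phi> p"
  shows "p \<in> SP G s t"
  using assms unfolding wardrop_flow_def is_flow_def by (metis less_irrefl)

lemma wardrop_latency_le:
  assumes "wardrop_flow G s t r l \<phi>" "0 < \<phi> p" "awalk s q t"
  shows "pl l \<phi> p \<le> pl l \<phi> q"
  using assms SP_awalk[OF wardrop_positive_SP[OF assms(1,2)]] unfolding wardrop_flow_def by blast

lemma positive_path:
  assumes "wardrop_flow G s t r l \<phi>" "0 < r"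
  obtains p where "p \<in> SP G s t" "0 < \<phi> p"
proof -
  have "\<not> (\<forall>p\<in>SP G s t. \<phi> p \<le> 0)"
  proof
    assume "\<forall>p\<in>SP G s t. \<phi> p \<le> 0"
    then have "flow_value G s t \<phi> \<le> 0" unfolding flow_value_def by (auto intro: sum_nonpos)
    then show False using assms unfolding wardrop_flow_def by simp
  qed
  then show ?thesis using that by force
qed

text \<open>All used paths cost the same and no path costs less. With latencies frozen at their
  values under \<open>\<phi>\<close>, the flow \<open>\<phi>\<close> is therefore a cheapest flow of
  its value: the variational inequality for Wardrop flows.\<close>

lemma wardrop_value:
  assumes "wardrop_flow G s t r l \<phi>" "0 < \<phi> p"
  shows "(\<Sum>e\<in>arcs G. ef \<phi> e * l e (ef \<phi> e)) = r * pl l \<phi> p"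
    and "is_flow G s t \<psi> \<Longrightarrow> flow_value G s t \<psi> = r \<Longrightarrow> r * pl l \<phi> p \<le> (\<Sum>e\<in>arcs G. ef \<psi> e * l e (ef \<phi> e))"
proof -
  note le = wardrop_latency_le[OF assms(1)]
  have p: "awalk s p t" using SP_awalk[OF wardrop_positive_SP[OF assms]] .
  have eq: "pl l \<phi> q = pl l \<phi> p" if "q \<in> SP G s t" "0 < \<phi> q" for q
    using le[OF assms(2) SP_awalk[OF that(1)]] le[OF that(2) p] by simp
  have flow: "is_flow G s t \<phi>" "flow_value G s t \<phi> = r" using assms(1) by (auto simp: wardrop_flow_def)
  have "(\<Sum>e\<in>arcs G. ef \<phi> e * l e (ef \<phi> e)) = (\<Sum>q\<in>SP G s t. \<phi> q * pl l \<phi> q)"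
    by (simp add: sum_edge_flow SP_arcs path_latency_SP)
  also have "\<dots> = (\<Sum>q\<in>SP G s t. \<phi> q * pl l \<phi> p)"
  proof (rule sum.cong[OF refl])
    fix q assume q: "q \<in> SP G s t"
    then have "0 \<le> \<phi> q" using flow(1) by (simp add: is_flow_def)
    then show "\<phi> q * pl l \<phi> q = \<phi> q * pl l \<phi> p" using eq[OF q] by (cases "\<phi> q = 0") auto
  qed
  also have "\<dots> = r * pl l \<phi> p" by (simp add: sum_distrib_right[symmetric] flow(2)[unfolded flow_value_def])
  finally show "(\<Sum>e\<in>arcs G. ef \<phi> e * l e (ef \<phi> e)) = r * pl l \<phi> p" .
  assume \<psi>: "is_flow G s t \<psi>" "flow_value G s t \<psi> = r"
  have "r * pl l \<phi> p = (\<Sum>q\<in>SP G s t. \<psi> q * pl l \<phi> p)" by (simp add: sum_distrib_right[symmetric] \<psi>(2)[unfolded flow_value_def])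
  also have "\<dots> \<le> (\<Sum>q\<in>SP G s t. \<psi> q * pl l \<phi> q)"
    by (rule sum_mono) (use \<psi>(1) le[OF assms(2) SP_awalk] in \<open>auto simp: is_flow_def intro!: mult_left_mono\<close>)
  also have "\<dots> = (\<Sum>e\<in>arcs G. ef \<psi> e * l e (ef \<phi> e))"
    by (simp add: sum_edge_flow SP_arcs path_latency_SP)
  finally show "r * pl l \<phi> p \<le> (\<Sum>e\<in>arcs G. ef \<psi> e * l e (ef \<phi> e))" .
qed

text \<open>The variational inequalities of both flows add up to a sum of products
  \<open>?d e\<close> that is at most 0, while monotonicity makes each product nonnegative. Hence
  all vanish, and both flows produce the same latency on each arc, even where their loads
  differ.\<close>

lemma wardrop_unique:
  assumes l: "latency_function G l" and r: "0 < r"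
    and \<phi>: "wardrop_flow G s t r l \<phi>" and \<psi>: "wardrop_flow G s t r l \<psi>"
    and p: "0 < \<phi> p" and q: "0 < \<psi> q"
  shows "pl l \<phi> p = pl l \<psi> q"
proof -
  have fl: "is_flow G s t \<phi>" "flow_value G s t \<phi> = r" "is_flow G s t \<psi>" "flow_value G s t \<psi> = r"
    using \<phi> \<psi> by (auto simp: wardrop_flow_def)
  let ?d = "\<lambda>e. (ef \<phi> e - ef \<psi> e) * (l e (ef \<phi> e) - l e (ef \<psi> e))"
  have pos: "0 \<le> ?d e" if e: "e \<in> arcs G" for e
  proof -
    have m: "mono_on {0..} (l e)" using l e by (simp add: latency_function_def)
    have nn: "0 \<le> ef \<phi> e" "0 \<le> ef \<psi> e" using fl edge_flow_nonneg by auto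
    show ?thesis
    proof (cases "ef \<phi> e \<le> ef \<psi> e")
      case True
      then have "l e (ef \<phi> e) \<le> l e (ef \<psi> e)" using m nn by (auto simp: mono_on_def)
      then show ?thesis using True by (simp add: mult_nonpos_nonpos)
    next
      case False
      then have "l e (ef \<psi> e) \<le> l e (ef \<phi> e)" using m nn by (auto simp: mono_on_def)
      then show ?thesis using False by simp
    qed
  qed
  have "(\<Sum>e\<in>arcs G. ?d e) = (\<Sum>e\<in>arcs G. (ef \<phi> e * l e (ef \<phi> e) - ef \<psi> e * l e (ef \<phi> e))
      + (ef \<psi> e * l e (ef \<psi> e) - ef \<phi> e * l e (ef \<psi> e)))"
    by (intro sum.cong refl) (simp add: left_diff_distrib right_diff_distrib)
  also have "\<dots> = (\<Sum>e\<in>arcs G. ef \<phi> e * l e (ef \<phi> e)) - (\<Sum>e\<in>arcs G. ef \<psi> e * l e (ef \<phi> e))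
      + ((\<Sum>e\<in>arcs G. ef \<psi> e * l e (ef \<psi> e)) - (\<Sum>e\<in>arcs G. ef \<phi> e * l e (ef \<psi> e)))"
    by (simp only: sum.distrib sum_subtractf)
  also have "\<dots> \<le> 0"
    using wardrop_value(1)[OF \<phi> p] wardrop_value(2)[OF \<phi> p fl(3,4)]
      wardrop_value(1)[OF \<psi> q] wardrop_value(2)[OF \<psi> q fl(1,2)] by linarith
  finally have le: "(\<Sum>e\<in>arcs G. ?d e) \<le> 0" .
  have "0 \<le> (\<Sum>e\<in>arcs G. ?d e)" by (rule sum_nonneg) (rule pos)
  with le have "(\<Sum>e\<in>arcs G. ?d e) = 0" by (rule antisym)
  then have "?d e = 0" if "e \<in> arcs G" for e using sum_nonneg_0[of "arcs G" ?d e] pos that by simp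
  then have eq: "l e (ef \<phi> e) = l e (ef \<psi> e)" if "e \<in> arcs G" for e
    using that by (metis mult_eq_0_iff eq_iff_diff_eq_0)
  have plq: "pl l \<phi> w = pl l \<psi> w" if "set w \<subseteq> arcs G" for w
    unfolding path_latency_def using that eq by (intro arg_cong[of _ _ sum_list] map_cong) auto
  have P: "p \<in> SP G s t" and Q: "q \<in> SP G s t"
    using wardrop_positive_SP \<phi> \<psi> p q by blast+
  show ?thesis
    using wardrop_latency_le[OF \<phi> p SP_awalk[OF Q]] wardrop_latency_le[OF \<psi> q SP_awalk[OF P]]
      plq[OF SP_arcs[OF P]] plq[OF SP_arcs[OF Q]] by simp
qed

lemma wardrop_latency_eq:
  assumes "latency_function G l" "0 < r" "wardrop_flow G s t r l \<phi>" "0 < \<phi> p"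
  shows "wardrop_latency G s t r l = pl l \<phi> p"
proof -
  have "(THE x. \<exists>\<phi>. wardrop_flow G s t r l \<phi> \<and>
          (\<forall>p. awalk s p t \<longrightarrow> 0 < \<phi> p \<longrightarrow> pl l \<phi> p = x)) = pl l \<phi> p"
  proof (rule the_equality)
    show "\<exists>\<phi>'. wardrop_flow G s t r l \<phi>' \<and> (\<forall>q. awalk s q t \<longrightarrow> 0 < \<phi>' q \<longrightarrow> pl l \<phi>' q = pl l \<phi> p)"
      using wardrop_unique[OF assms(1,2,3,3) _ assms(4)] assms(3) by blast
  next
    fix x
    assume "\<exists>\<phi>'. wardrop_flow G s t r l \<phi>' \<and> (\<forall>q. awalk s q t \<longrightarrow> 0 < \<phi>' q \<longrightarrow> pl l \<phi>' q = x)"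
    then obtain \<psi> where \<psi>: "wardrop_flow G s t r l \<psi>" "\<And>q. awalk s q t \<Longrightarrow> 0 < \<psi> q \<Longrightarrow> pl l \<psi> q = x"
      by blast
    obtain q where q: "q \<in> SP G s t" "0 < \<psi> q" using positive_path[OF \<psi>(1) assms(2)] by blast
    show "x = pl l \<phi> p"
      using \<psi>(2)[OF SP_awalk[OF q(1)] q(2)] wardrop_unique[OF assms(1,2) \<psi>(1) assms(3) q(2) assms(4)] by simp
  qed
  then show ?thesis using assms(2) unfolding wardrop_latency_def by simp
qed

section \<open>Existence of Wardrop flows\<close>

definition flows :: "real \<Rightarrow> ('b list \<Rightarrow> real) set" where
  "flows r = {\<phi>. is_flow G s t \<phi> \<and> flow_value G s t \<phi> = r}"

lemma edge_flow_le: "\<phi> \<in> flows r \<Longrightarrow> ef \<phi> e \<le> r"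
  unfolding flows_def edge_flow_def flow_value_def is_flow_def
  by (auto intro!: sum_mono2 simp: finite_SP)

lemma flow_le: "\<phi> \<in> flows r \<Longrightarrow> p \<in> SP G s t \<Longrightarrow> \<phi> p \<le> r"
  unfolding flows_def flow_value_def is_flow_def
  by (auto intro!: member_le_sum simp: finite_SP)

text \<open>Flows are functions on all arc lists, so this is Tychonoff's theorem: each coordinate
  ranges over \<open>{0..r}\<close> or, off the simple paths, over \<open>{0}\<close>.\<close>

lemma compact_flows: "compact (flows r)"
proof -
  let ?B = "PiE UNIV (\<lambda>p. if p \<in> SP G s t then {0..r} else {0::real})"
  have "compactin (product_topology (\<lambda>p. euclidean) UNIV) ?B"
    by (subst compactin_PiE) auto
  then have "compactin euclidean ?B" by (simp only: euclidean_product_topology)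
  then have c: "compact ?B" by simp
  have "closed {\<phi>. (\<Sum>p\<in>SP G s t. \<phi> p) = r}"
    by (intro closed_Collect_eq continuous_intros continuous_on_sum) 
      (auto intro: continuous_on_product_coordinates)
  moreover have "flows r = ?B \<inter> {\<phi>. (\<Sum>p\<in>SP G s t. \<phi> p) = r}"
    using flow_le by (fastforce simp: flows_def is_flow_def flow_value_def PiE_UNIV_domain Pi_iff split: if_splits)
  ultimately show ?thesis using c by (simp add: compact_Int_closed)
qed


text \<open>Beckmann's potential. Its rate of change with the load of \<open>e\<close> is the
  latency of \<open>e\<close>, so at a minimum no shift of flow to another path can pay off.\<close>

definition beckmann :: "('b \<Rightarrow> real \<Rightarrow> real) \<Rightarrow> ('b list \<Rightarrow> real) \<Rightarrow> real" where
  "beckmann l \<phi> = (\<Sum>e\<in>arcs G. integral {0..ef \<phi> e} (l e))"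

lemma continuous_beckmann:
  assumes "latency_function G l"
  shows "continuous_on (flows r) (beckmann l)"
  unfolding beckmann_def
proof (rule continuous_on_sum)
  fix e assume e: "e \<in> arcs G"
  have "continuous_on {0..r} (l e)"
    using assms e unfolding latency_function_def by (auto intro: continuous_on_subset)
  then have 1: "continuous_on {0..r} (\<lambda>x. integral {0..x} (l e))"
    by (intro indefinite_integral_continuous_1 integrable_continuous_real)
  have 2: "continuous_on (flows r) (\<lambda>\<phi>. ef \<phi> e)"
    unfolding edge_flow_def
    by (intro continuous_on_sum) (auto intro: continuous_on_subset[OF continuous_on_product_coordinates])
  show "continuous_on (flows r) (\<lambda>\<phi>. integral {0..ef \<phi> e} (l e))"
    by (rule continuous_on_compose2[OF 1 2])
      (use edge_flow_le edge_flow_nonneg in \<open>auto simp: flows_def\<close>)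
qed

text \<open>Monotonicity bounds the integrand by its value at \<open>y\<close>, from above if
  \<open>y\<close> is the right end and from below if it is the left one. This replaces a
  differentiability argument.\<close>

lemma integral_difference_le:
  fixes f :: "real \<Rightarrow> real"
  assumes "continuous_on {0..} f" "mono_on {0..} f" "0 \<le> x" "0 \<le> y"
  shows "integral {0..y} f - integral {0..x} f \<le> f y * (y - x)"
proof -
  have int: "f integrable_on {a..b}" if "0 \<le> a" for a b
    using that assms(1) by (intro integrable_continuous_real) (auto intro: continuous_on_subset)
  show ?thesis
  proof (cases "x \<le> y")
    case True
    have "integral {0..x} f + integral {x..y} f = integral {0..y} f"
      by (rule Henstock_Kurzweil_Integration.integral_combine) (use True assms int in auto)
    moreover have "integral {x..y} f \<le> integral {x..y} (\<lambda>_. f y)"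
      by (rule integral_le) (use int assms True in \<open>auto simp: mono_on_def\<close>)
    ultimately show ?thesis using True by (simp add: mult.commute)
  next
    case False
    have "integral {0..y} f + integral {y..x} f = integral {0..x} f"
      by (rule Henstock_Kurzweil_Integration.integral_combine) (use False assms int in auto)
    moreover have "integral {y..x} (\<lambda>_. f y) \<le> integral {y..x} f"
      by (rule integral_le) (use int assms False in \<open>auto simp: mono_on_def\<close>)
    ultimately show ?thesis using False by (simp add: algebra_simps)
  qed
qed

lemma beckmann_difference_le:
  assumes "latency_function G l" "is_flow G s t \<phi>" "is_flow G s t \<psi>"
  shows "beckmann l \<psi> - beckmann l \<phi> \<le> (\<Sum>e\<in>arcs G. l e (ef \<psi> e) * (ef \<psi> e - ef \<phi> e))"
  unfolding beckmann_def sum_subtractf[symmetric]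
  by (intro sum_mono integral_difference_le)
    (use assms edge_flow_nonneg in \<open>auto simp: latency_function_def\<close>)

text \<open>Moving a small amount \<open>\<epsilon>\<close> from a used path \<open>p\<close> to a
  path \<open>q\<close> cannot lower the potential. Divided by \<open>\<epsilon>\<close>, the bound
  on the potential difference tends to the latency of \<open>q\<close> minus that of
  \<open>p\<close>.\<close>

lemma beckmann_minimum_wardrop:
  assumes l: "latency_function G l" and \<phi>: "\<phi> \<in> flows r"
    and min: "\<And>\<psi>. \<psi> \<in> flows r \<Longrightarrow> beckmann l \<phi> \<le> beckmann l \<psi>"
  shows "wardrop_flow G s t r l \<phi>"
proof -
  have f: "is_flow G s t \<phi>" "flow_value G s t \<phi> = r" using \<phi> by (auto simp: flows_def)
  have simple: "pl l \<phi> p \<le> pl l \<phi> q" if p: "p \<in> SP G s t" "0 < \<phi> p" and q: "q \<in> SP G s t" for p q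
  proof (cases "p = q")
    case False
    define \<psi> where "\<psi> \<epsilon> = \<phi>(p := \<phi> p - \<epsilon>, q := \<phi> q + \<epsilon>)" for \<epsilon>
    \<comment> \<open>\<open>c e\<close> is the change of load on \<open>e\<close> per unit moved;
      it is 0 on arcs common to both paths.\<close>
    define c where "c e = (if e \<in> set q then 1 else 0) - (if e \<in> set p then 1 else (0::real))" for e
    have \<psi>: "\<psi> \<epsilon> x = \<phi> x + (if x = q then \<epsilon> else 0) - (if x = p then \<epsilon> else 0)" for \<epsilon> x
      using False by (auto simp: \<psi>_def)
    have "0 \<le> \<phi> x" for x using f(1) unfolding is_flow_def by (cases "x \<in> SP G s t") auto
    then have flow: "is_flow G s t (\<psi> \<epsilon>)" if "0 \<le> \<epsilon>" "\<epsilon> \<le> \<phi> p" for \<epsilon>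
      using that f(1) p(1) q unfolding is_flow_def by (auto simp: \<psi> intro: add_nonneg_nonneg)
    have val: "flow_value G s t (\<psi> \<epsilon>) = r" for \<epsilon>
      using f(2) p(1) q finite_SP unfolding flow_value_def \<psi> by (simp add: sum.distrib sum_subtractf)
    have efc: "ef (\<psi> \<epsilon>) e = ef \<phi> e + \<epsilon> * c e" for \<epsilon> e
      using p(1) q finite_SP unfolding edge_flow_def \<psi> c_def by (simp add: sum.distrib sum_subtractf)
    have step: "0 \<le> (\<Sum>e\<in>arcs G. l e (ef \<phi> e + \<epsilon> * c e) * c e)" if e: "0 < \<epsilon>" "\<epsilon> \<le> \<phi> p" for \<epsilon>
    proof -
      have "\<psi> \<epsilon> \<in> flows r" using flow val e by (auto simp: flows_def)
      then have "0 \<le> beckmann l (\<psi> \<epsilon>) - beckmann l \<phi>" using min by simp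
      also have "\<dots> \<le> (\<Sum>e\<in>arcs G. l e (ef (\<psi> \<epsilon>) e) * (ef (\<psi> \<epsilon>) e - ef \<phi> e))"
        by (rule beckmann_difference_le[OF l f(1) flow]) (use e in auto)
      also have "\<dots> = \<epsilon> * (\<Sum>e\<in>arcs G. l e (ef \<phi> e + \<epsilon> * c e) * c e)"
        by (simp add: efc sum_distrib_left algebra_simps)
      finally show ?thesis using e(1) by (simp add: zero_le_mult_iff)
    qed
    define \<epsilon> where "\<epsilon> n = \<phi> p * inverse (real (Suc n))" for n
    have e0: "0 < \<epsilon> n" "\<epsilon> n \<le> \<phi> p" for n
      using p(2) by (auto simp: \<epsilon>_def field_simps)
    have lim: "\<epsilon> \<longlonglongrightarrow> 0"
      unfolding \<epsilon>_def using tendsto_mult_right_zero[OF LIMSEQ_inverse_real_of_nat] by simp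
    have "(\<lambda>n. \<Sum>e\<in>arcs G. l e (ef \<phi> e + \<epsilon> n * c e) * c e) \<longlonglongrightarrow> (\<Sum>e\<in>arcs G. l e (ef \<phi> e) * c e)"
    proof (intro tendsto_sum tendsto_mult tendsto_const)
      fix e assume e: "e \<in> arcs G"
      have 1: "continuous_on {0..} (l e)" using l e by (simp add: latency_function_def)
      have 2: "(\<lambda>n. ef \<phi> e + \<epsilon> n * c e) \<longlonglongrightarrow> ef \<phi> e"
        using tendsto_add[OF tendsto_const tendsto_mult_right[OF lim, of "c e"], of "ef \<phi> e"]
        by (simp add: mult.commute)
      \<comment> \<open>Latencies are continuous on \<open>{0..}\<close> only, so the perturbed
        loads must be known to be nonnegative.\<close>
      have "0 \<le> ef (\<psi> (\<epsilon> n)) e" for n using edge_flow_nonneg flow e0 less_imp_le by blast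
      then have 3: "\<forall>\<^sub>F n in sequentially. ef \<phi> e + \<epsilon> n * c e \<in> {0..}" by (simp add: efc)
      show "(\<lambda>n. l e (ef \<phi> e + \<epsilon> n * c e)) \<longlonglongrightarrow> l e (ef \<phi> e)"
        by (rule continuous_on_tendsto_compose[OF 1 2 _ 3]) (simp add: edge_flow_nonneg f)
    qed
    then have "0 \<le> (\<Sum>e\<in>arcs G. l e (ef \<phi> e) * c e)"
      by (rule LIMSEQ_le_const) (use step e0 in auto)
    also have "\<dots> = (\<Sum>e\<in>arcs G. if e \<in> set q then l e (ef \<phi> e) else 0) - (\<Sum>e\<in>arcs G. if e \<in> set p then l e (ef \<phi> e) else 0)"
      unfolding sum_subtractf[symmetric] by (intro sum.cong refl) (simp add: c_def)
    also have "\<dots> = pl l \<phi> q - pl l \<phi> p"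
      using sum.inter_restrict[of "arcs G" "\<lambda>e. l e (ef \<phi> e)" "set q"] sum.inter_restrict[of "arcs G" "\<lambda>e. l e (ef \<phi> e)" "set p"]
      by (simp add: path_latency_SP p q Int_absorb1 SP_arcs)
    finally show ?thesis by simp
  qed simp
  show ?thesis
    unfolding wardrop_flow_def
  proof (intro conjI f allI impI)
    fix p q assume *: "awalk s p t" "awalk s q t" "0 < \<phi> p"
    have p: "p \<in> SP G s t" using f(1) *(3) unfolding is_flow_def by (metis less_irrefl)
    obtain q' where "q' \<in> SP G s t" "pl l \<phi> q' \<le> pl l \<phi> q" by (rule awalk_SP_latency[OF l f(1) *(2)])
    then show "pl l \<phi> p \<le> pl l \<phi> q" using simple[OF p *(3)] by force
  qed
qed

lemma wardrop_exists:
  assumes "latency_function G l" "0 \<le> r" "awalk s p t"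
  obtains \<phi> where "wardrop_flow G s t r l \<phi>"
proof -
  have "awalk_to_apath p \<in> SP G s t" using apath_awalk_to_apath[OF assms(3)] by (simp add: SP_def)
  then obtain q where q: "q \<in> SP G s t" by blast
  have "(\<lambda>p. if p = q then r else 0) \<in> flows r"
    using q assms(2) finite_SP by (auto simp: flows_def is_flow_def flow_value_def)
  then have "flows r \<noteq> {}" by blast
  then obtain \<phi> where "\<phi> \<in> flows r" "\<And>\<psi>. \<psi> \<in> flows r \<Longrightarrow> beckmann l \<phi> \<le> beckmann l \<psi>"
    using continuous_attains_inf[OF compact_flows _ continuous_beckmann[OF assms(1)]] by blast
  then show ?thesis using that beckmann_minimum_wardrop[OF assms(1)] by blast
qed


section \<open>From flows on paths to flows on arcs\<close>

lemma walk_balance: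
  "ae.walk x p y \<Longrightarrow> (\<Sum>e\<leftarrow>p. if head G e = z then 1 else 0) + (if z = x then 1 else 0) =
     (\<Sum>e\<leftarrow>p. if tail G e = z then 1 else 0) + (if z = y then 1 else (0::real))"
proof (induction p arbitrary: x)
  case (Cons e p)
  from Cons.prems have "tail G e = x" "ae.walk (head G e) p y" by auto
  then show ?case using Cons.IH[of "head G e"] by (auto simp: eq_commute[of z])
qed simp

lemma SP_balance:
  assumes "p \<in> SP G s t"
  shows "z \<noteq> s \<Longrightarrow> z \<noteq> t \<Longrightarrow> (\<Sum>e\<in>set p. if head G e = z then 1 else 0) =
      (\<Sum>e\<in>set p. if tail G e = z then 1 else (0::real))"
    and "s \<noteq> t \<Longrightarrow> (\<Sum>e\<in>set p. if tail G e = s then 1 else (0::real)) = 1"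
proof -
  have w: "ae.walk s p t" and s: "s \<notin> head G ` set p" using assms by (auto simp: SP_iff ae.spath_def)
  note * = walk_balance[OF w, unfolded sum_list_distinct_conv_sum_set[OF SP_distinct[OF assms]]]
  show "(\<Sum>e\<in>set p. if head G e = z then 1 else 0) =
      (\<Sum>e\<in>set p. if tail G e = z then 1 else (0::real))" if "z \<noteq> s" "z \<noteq> t"
    using *[of z] that by simp
  have "(\<Sum>e\<in>set p. if head G e = s then 1 else (0::real)) = 0"
    using s by (intro sum.neutral) auto
  then show "(\<Sum>e\<in>set p. if tail G e = s then 1 else (0::real)) = 1" if "s \<noteq> t"
    using *[of s] that by simp
qed

text \<open>\<open>F\<close> may be any set that contains all simple paths. Flows of a net and of
  its subgraph thereby become comparable as flows on the same pruned arc set.\<close>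

lemma flow_eflow:
  assumes "is_flow G s t \<phi>" "finite F" "\<And>p. p \<in> SP G s t \<Longrightarrow> set p \<subseteq> F" "s \<noteq> t"
  shows "ae.eflow F s t (ef \<phi>) (flow_value G s t \<phi>)"
proof -
  have sum: "sum (ef \<phi>) {e\<in>F. P e} = (\<Sum>p\<in>SP G s t. \<phi> p * (\<Sum>e\<in>set p. if P e then 1 else 0))" for P
  proof -
    have "sum (ef \<phi>) {e\<in>F. P e} = (\<Sum>e\<in>F. ef \<phi> e * (if P e then 1 else 0))"
      by (simp add: sum.inter_filter assms(2) if_distrib cong: if_cong)
    then show ?thesis using sum_edge_flow[OF assms(2,3)] by simp
  qed
  show ?thesis
    unfolding ae.eflow_def sum
  proof (intro conjI allI impI ballI)
    show "0 \<le> ef \<phi> e" for e by (rule edge_flow_nonneg[OF assms(1)])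
    show "(\<Sum>p\<in>SP G s t. \<phi> p * (\<Sum>e\<in>set p. if head G e = x then 1 else 0)) =
        (\<Sum>p\<in>SP G s t. \<phi> p * (\<Sum>e\<in>set p. if tail G e = x then 1 else 0))" if "x \<noteq> s" "x \<noteq> t" for x
      by (intro sum.cong refl) (simp add: SP_balance(1) that)
    show "(\<Sum>p\<in>SP G s t. \<phi> p * (\<Sum>e\<in>set p. if tail G e = s then 1 else 0)) = flow_value G s t \<phi>"
      unfolding flow_value_def by (intro sum.cong refl) (simp add: SP_balance(2) assms(4))
  qed
qed

text \<open>
  Every prefix of a walk along used arcs is a cheapest walk: an arc extending it lies on a used
  path, and rerouting that path does not pay off.
\<close>

lemma used_walk_cheapest:
  assumes W: "wardrop_flow G s t r l \<phi>"
    and p: "ae.walk s p x" and used: "\<And>e. e \<in> set p \<Longrightarrow> 0 < ef \<phi> e"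
    and \<alpha>: "awalk s \<alpha> x" and l: "latency_function G l"
  shows "pl l \<phi> p \<le> pl l \<phi> \<alpha>"
  using p used \<alpha>
proof (induction p arbitrary: x \<alpha> rule: rev_induct)
  case Nil
  have f: "is_flow G s t \<phi>" using W by (simp add: wardrop_flow_def)
  have "0 \<le> l e (ef \<phi> e)" if "e \<in> set \<alpha>" for e
    using l that Nil(3) edge_flow_nonneg[OF f] unfolding latency_function_def awalk_iff by blast
  then show ?case unfolding path_latency_def by (auto intro!: sum_list_nonneg)
next
  case (snoc e p)
  have f: "is_flow G s t \<phi>" using W by (simp add: wardrop_flow_def)
  have w: "ae.walk s p (tail G e)" "x = head G e" using snoc.prems(1) by auto
  have "0 < ef \<phi> e" using snoc.prems(2) by simp
  then obtain q where q: "q \<in> SP G s t" "e \<in> set q" "0 < \<phi> q"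
    unfolding edge_flow_def using sum_nonpos[of "{p \<in> SP G s t. e \<in> set p}" \<phi>] by force
  obtain q1 q2 where q12: "q = q1 @ e # q2" using split_list[OF q(2)] by blast
  have wq: "awalk s q1 (tail G e)" "ae.walk (head G e) q2 t" "set q2 \<subseteq> arcs G"
    using SP_awalk[OF q(1)] unfolding q12 by (auto simp: awalk_iff)
  have "awalk s (\<alpha> @ q2) t" using wq snoc.prems(3) w by (auto simp: awalk_iff)
  then have "pl l \<phi> q \<le> pl l \<phi> (\<alpha> @ q2)" by (rule wardrop_latency_le[OF W q(3)])
  moreover have "pl l \<phi> p \<le> pl l \<phi> q1" using snoc.IH[OF w(1) _ wq(1)] snoc.prems(2) by simp
  ultimately show ?case by (simp add: path_latency_def q12)
qed

end

lemma net_subgraph: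
  assumes "net G s t" "subgraph H G" "pre_digraph.awalk H s p t"
  shows "net H s t" "tail H = tail G" "head H = head G" "SP H s t \<subseteq> SP G s t"
proof -
  interpret net G s t by fact
  have s: "verts H \<subseteq> verts G" "arcs H \<subseteq> arcs G" "wf_digraph H" and c: "tail H = tail G" "head H = head G"
    using assms(2) by (auto simp: subgraph_def compatible_def)
  interpret H: wf_digraph H by fact
  show th: "tail H = tail G" "head H = head G" by fact+
  have "s \<in> verts H" "t \<in> verts H"
    using H.awalk_hd_in_verts[OF assms(3)] H.awalk_last_in_verts[OF assms(3)] by auto
  then show net: "net H s t"
    using s finite_subset[OF s(1)] finite_subset[OF s(2)] by unfold_locales auto
  show "SP H s t \<subseteq> SP G s t"
    unfolding SP_def using subgraph_apath_imp_apath[OF _ assms(2)] by blast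
qed

section \<open>Series-parallel nets resist, Braess nets are vulnerable\<close>

context net begin

theorem sp_not_vulnerable:
  assumes sp: "ae.sp F s t" and F: "F \<subseteq> arcs G" "\<And>p. p \<in> SP G s t \<Longrightarrow> set p \<subseteq> F"
  shows "\<not> vulnerable G s t"
proof
  assume "vulnerable G s t"
  then obtain r l H p0 where r: "0 \<le> r" and l: "latency_function G l" and H: "subgraph H G"
    and p0: "pre_digraph.awalk H s p0 t"
    and less: "wardrop_latency H s t r l < wardrop_latency G s t r l"
    unfolding vulnerable_def by blast
  have "r \<noteq> 0" using less by (auto simp: wardrop_latency_def)
  then have r: "0 < r" using r by simp
  note HG = net_subgraph[OF _ H p0]
  have netG: "net G s t" by unfold_locales
  note HG = HG[OF netG]
  interpret H: net H s t by (rule HG(1))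
  have ae: "H.ae.walk = ae.walk" "H.ae.eflow = ae.eflow" using HG by simp_all
  have arcsH: "arcs H \<subseteq> arcs G" using H by auto
  have lH: "latency_function H l" using l arcsH unfolding latency_function_def by blast
  have st: "s \<noteq> t" and fin: "finite F" using ae.sp_facts[OF sp] by auto
  obtain \<psi> where \<psi>: "wardrop_flow H s t r l \<psi>" using H.wardrop_exists[OF lH less_imp_le[OF r] p0] by blast
  have p0G: "awalk s p0 t" using p0 H by (rule subgraph_awalk_imp_awalk)
  obtain \<phi> where \<phi>: "wardrop_flow G s t r l \<phi>" using wardrop_exists[OF l less_imp_le[OF r] p0G] by blast
  have f\<phi>: "is_flow G s t \<phi>" "flow_value G s t \<phi> = r" and f\<psi>: "is_flow H s t \<psi>" "flow_value H s t \<psi> = r"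
    using \<phi> \<psi> by (auto simp: wardrop_flow_def)
  have "ae.eflow F s t (ef \<phi>) r" using flow_eflow[OF f\<phi>(1) fin F(2) st] f\<phi>(2) by simp
  moreover have "ae.eflow F s t (H.ef \<psi>) r"
    using H.flow_eflow[OF f\<psi>(1) fin _ st] f\<psi>(2) F(2) HG(4) ae by (metis subsetD)
  ultimately obtain p where p: "ae.walk s p t" "set p \<subseteq> F" "\<forall>e\<in>set p. ef \<phi> e \<le> H.ef \<psi> e \<and> 0 < H.ef \<psi> e"
    using ae.sp_flow_path[OF sp _ _ order_refl r] by blast
  obtain p1 where p1: "p1 \<in> SP G s t" "0 < \<phi> p1" by (rule positive_path[OF \<phi> r])
  obtain p2 where p2: "p2 \<in> SP H s t" "0 < \<psi> p2" by (rule H.positive_path[OF \<psi> r])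
  have "awalk s p t" using p F source_in_verts by (auto simp: awalk_iff)
  then have "pl l \<phi> p1 \<le> pl l \<phi> p" by (rule wardrop_latency_le[OF \<phi> p1(2)])
  also have "\<dots> \<le> H.pl l \<psi> p"
    unfolding path_latency_def
  proof (rule sum_list_mono)
    fix e assume e: "e \<in> set p"
    then have "mono_on {0..} (l e)" using l p(2) F(1) unfolding latency_function_def by blast
    then show "l e (ef \<phi> e) \<le> l e (H.ef \<psi> e)"
      using p(3) e edge_flow_nonneg[OF f\<phi>(1)] H.edge_flow_nonneg[OF f\<psi>(1)] by (auto simp: mono_on_def)
  qed
  \<comment> \<open>Every arc of \<open>p\<close> carries flow in \<open>H\<close>, but possibly no
    flow is sent along \<open>p\<close> as a whole, so the Wardrop condition does not apply to
    \<open>p\<close> directly.\<close>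
  also have "\<dots> \<le> H.pl l \<psi> p2"
    by (rule H.used_walk_cheapest[OF \<psi> _ _ H.SP_awalk[OF p2(1)] lH]) (use p ae in auto)
  finally show False
    using less wardrop_latency_eq[OF l r \<phi> p1(2)] H.wardrop_latency_eq[OF lH r \<psi> p2(2)] by simp
qed

text \<open>Telescoping along the walk. A feasible potential is a dual certificate that bounds the
  cost of all walks from below.\<close>

lemma walk_potential:
  fixes \<pi> :: "'a \<Rightarrow> real"
  assumes "\<And>e. e \<in> set p \<Longrightarrow> \<pi> (head G e) \<le> \<pi> (tail G e) + c e" "ae.walk x p y"
  shows "\<pi> y - \<pi> x \<le> (\<Sum>e\<leftarrow>p. c e)"
  using assms by (induction p arbitrary: x) force+

theorem braess_vulnerable:
  assumes "ae.braess (arcs G) s t"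
  shows "vulnerable G s t"
proof -
  from assms obtain p1 p2 p3 e1 e2 e3 e4 \<pi> \<rho> where
    sp: "ae.spath (arcs G) s p1 t" "ae.spath (arcs G) s p2 t" "ae.spath (arcs G) s p3 t" and d: "distinct [e1, e2, e3, e4]" and
    i: "set p1 \<inter> {e1, e2, e3, e4} = {e1, e4}"
      "set p2 \<inter> {e1, e2, e3, e4} = {e2, e3}"
      "set p3 \<inter> {e1, e2, e3, e4} = {e1, e2}" and
    \<pi>: "\<forall>e \<in> set p1 \<union> set p2 \<union> set p3.
        \<pi> (head G e) \<le> \<pi> (tail G e) + (if e \<in> {e1, e2, e3, e4} then 1 else 0)"
       "\<pi> t = \<pi> s + 2" "\<forall>x y. \<pi> x - \<pi> y \<le> (2 :: real)" and
    \<rho>: "\<forall>e \<in> set p1 \<union> set p2.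
        \<rho> (head G e) \<le> \<rho> (tail G e) + (if e \<in> {e1, e2} then 1 / 2 else if e \<in> {e3, e4} then 1 else 0)"
     "\<rho> t = \<rho> s + (3 / 2 :: real)"
    unfolding ae.braess_def ae.braess_data_def by (elim exE conjE) (rule that)
  let ?D = "{e1, e2, e3, e4}"
  define l where "l e x = (if e \<in> {e1, e2} then x else if e \<in> {e3, e4} then 1
    else if e \<in> set p1 \<union> set p2 \<union> set p3 then 0 else (2 :: real))" for e x
  have lG: "latency_function G l"
  proof -
    have "l e = (if e \<in> {e1, e2} then (\<lambda>x. x) else if e \<in> {e3, e4} then (\<lambda>_. 1)
        else if e \<in> set p1 \<union> set p2 \<union> set p3 then (\<lambda>_. 0) else (\<lambda>_. 2))" for e
      by (auto simp: l_def fun_eq_iff)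
    then have "continuous_on {0..} (l e) \<and> mono_on {0..} (l e) \<and> (\<forall>x\<ge>0. 0 \<le> l e x)" for e
      by (simp add: mono_on_def)
    then show ?thesis by (simp add: latency_function_def)
  qed
  have P: "p1 \<in> SP G s t" "p2 \<in> SP G s t" "p3 \<in> SP G s t" using sp by (simp_all add: SP_iff)
  define \<phi> where "\<phi> p = (if p = p3 then 1 else (0::real))" for p
  have ef\<phi>: "ef \<phi> e = (if e \<in> set p3 then 1 else 0)" for e
    unfolding edge_flow_def \<phi>_def using P finite_SP by simp
  have mem: "e1 \<in> set p3" "e2 \<in> set p3" "e3 \<notin> set p3" "e4 \<notin> set p3" "e1 \<in> set p1" "e1 \<notin> set p2"
    "e2 \<in> set p2" "e2 \<notin> set p1" "e3 \<notin> set p1" "e4 \<in> set p1" using i d by auto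
  have "pl l \<phi> p3 = (\<Sum>e\<in>set p3. (if e = e1 then 1 else 0) + (if e = e2 then 1 else 0))"
    unfolding path_latency_SP[OF P(3)]
  proof (rule sum.cong[OF refl])
    fix e assume "e \<in> set p3"
    then show "l e (ef \<phi> e) = (if e = e1 then 1 else 0) + (if e = e2 then 1 else 0)" using mem d by (auto simp: l_def ef\<phi>)
  qed
  also have "\<dots> = 2" using mem by (simp add: sum.distrib)
  finally have pl3: "pl l \<phi> p3 = 2" .
  have lo: "2 \<le> pl l \<phi> q" if q: "awalk s q t" for q
  proof -
    have "\<pi> (head G e) \<le> \<pi> (tail G e) + l e (ef \<phi> e)" if e: "e \<in> set q" for e
    proof (cases "e \<in> set p1 \<union> set p2 \<union> set p3")
      case True
      have "(if e \<in> ?D then 1 else 0) \<le> l e (ef \<phi> e)" using True mem by (auto simp: l_def ef\<phi>)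
      then show ?thesis using bspec[OF \<pi>(1) True] by linarith
    next
      \<comment> \<open>Arcs off the three paths cost 2, which no difference of \<open>\<pi>\<close>
        exceeds; the bound on \<open>\<pi>\<close> serves this case.\<close>
      case False
      then have "e \<notin> ?D" using i by blast
      then have "l e (ef \<phi> e) = 2" using False by (simp add: l_def)
      then show ?thesis using \<pi>(3)[rule_format, of "head G e" "tail G e"] by linarith
    qed
    then have "\<pi> t - \<pi> s \<le> pl l \<phi> q"
      unfolding path_latency_def using q by (intro walk_potential) (auto simp: awalk_iff)
    then show ?thesis using \<pi>(2) by simp
  qed
  have W: "wardrop_flow G s t 1 l \<phi>"
    unfolding wardrop_flow_def is_flow_def flow_value_def
    using P lo pl3 finite_SP by (auto simp: \<phi>_def split: if_splits)
  have LG: "wardrop_latency G s t 1 l = 2"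
    using wardrop_latency_eq[OF lG _ W, of p3] pl3 by (simp add: \<phi>_def)
  \<comment> \<open>\<open>H\<close> loses the bridge and everything else off \<open>p1\<close> and
    \<open>p2\<close>, so \<open>\<rho>\<close> has to be feasible on the arcs of these two paths
    only.\<close>
  define H where "H = G\<lparr>arcs := set p1 \<union> set p2\<rparr>"
  have HG: "verts H = verts G" "arcs H = set p1 \<union> set p2" "tail H = tail G" "head H = head G" by (simp_all add: H_def)
  have sub: "set p1 \<union> set p2 \<subseteq> arcs G" using SP_arcs P by blast
  have netH: "net H s t"
    by unfold_locales (use sub source_in_verts target_in_verts in \<open>auto simp: HG\<close>)
  interpret H: net H s t by (rule netH)
  have ae: "H.ae.walk = ae.walk" "H.ae.spath = ae.spath" using HG by simp_all
  have subH: "subgraph H G"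
    unfolding subgraph_def compatible_def using sub wf_digraph_axioms H.wf_digraph_axioms by (simp add: HG)
  have PH: "p1 \<in> SP H s t" "p2 \<in> SP H s t"
    using sp unfolding H.SP_iff ae ae.spath_def HG by auto
  define \<psi> where "\<psi> p = (if p = p1 then 1 / 2 else 0) + (if p = p2 then 1 / 2 else (0::real))" for p
  have ef\<psi>: "H.ef \<psi> e = (if e \<in> set p1 then 1 / 2 else 0) + (if e \<in> set p2 then 1 / 2 else 0)" for e
    unfolding edge_flow_def \<psi>_def using PH H.finite_SP by (simp add: sum.distrib)
  have lH: "latency_function H l" using lG sub unfolding latency_function_def HG by blast
  have "H.pl l \<psi> p1 = (\<Sum>e\<in>set p1. (if e = e1 then 1 / 2 else 0) + (if e = e4 then 1 else 0))"
    unfolding H.path_latency_SP[OF PH(1)]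
  proof (rule sum.cong[OF refl])
    fix e assume "e \<in> set p1"
    then show "l e (H.ef \<psi> e) = (if e = e1 then 1 / 2 else 0) + (if e = e4 then 1 else 0)"
      using mem d by (auto simp: l_def ef\<psi>)
  qed
  also have "\<dots> = 3 / 2" using mem by (simp add: sum.distrib)
  finally have plH1: "H.pl l \<psi> p1 = 3 / 2" .
  have "H.pl l \<psi> p2 = (\<Sum>e\<in>set p2. (if e = e2 then 1 / 2 else 0) + (if e = e3 then 1 else 0))"
    unfolding H.path_latency_SP[OF PH(2)]
  proof (rule sum.cong[OF refl])
    fix e assume "e \<in> set p2"
    moreover have "e4 \<notin> set p2" using i d by auto
    ultimately show "l e (H.ef \<psi> e) = (if e = e2 then 1 / 2 else 0) + (if e = e3 then 1 else 0)"
      using mem d by (auto simp: l_def ef\<psi>)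
  qed
  also have "\<dots> = 3 / 2"
  proof -
    have "e3 \<in> set p2" using i by auto
    then show ?thesis using mem by (simp add: sum.distrib)
  qed
  finally have plH2: "H.pl l \<psi> p2 = 3 / 2" .
  have loH: "3 / 2 \<le> H.pl l \<psi> q" if q: "H.awalk s q t" for q
  proof -
    have "\<rho> (head G e) \<le> \<rho> (tail G e) + l e (H.ef \<psi> e)" if e: "e \<in> set q" for e
    proof -
      have True: "e \<in> set p1 \<union> set p2" using e q unfolding H.awalk_iff HG by blast
      have "(if e \<in> {e1, e2} then 1 / 2 else if e \<in> {e3, e4} then 1 else 0) \<le> l e (H.ef \<psi> e)"
        using True mem by (auto simp: l_def ef\<psi>)
      then show ?thesis using bspec[OF \<rho>(1) True] by linarith
    qed
    then have "\<rho> t - \<rho> s \<le> H.pl l \<psi> q"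
      unfolding path_latency_def using q unfolding H.awalk_iff ae by (intro walk_potential) auto
    then show ?thesis using \<rho>(2) by simp
  qed
  have pos: "p = p1 \<or> p = p2" if "0 < \<psi> p" for p using that by (auto simp: \<psi>_def split: if_splits)
  have WH: "wardrop_flow H s t 1 l \<psi>"
    unfolding wardrop_flow_def is_flow_def flow_value_def
  proof (intro conjI allI impI ballI)
    show "0 \<le> \<psi> p" for p by (simp add: \<psi>_def)
    show "\<psi> p = 0" if "p \<notin> SP H s t" for p using that PH by (auto simp: \<psi>_def)
    show "sum \<psi> (SP H s t) = 1" using PH H.finite_SP unfolding \<psi>_def by (simp add: sum.distrib)
    show "H.pl l \<psi> p \<le> H.pl l \<psi> q" if "H.awalk s q t" "0 < \<psi> p" for p q
      using pos[OF that(2)] plH1 plH2 loH[OF that(1)] by auto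
  qed
  have "0 < \<psi> p1" by (simp add: \<psi>_def)
  then have LH: "wardrop_latency H s t 1 l = 3 / 2"
    using H.wardrop_latency_eq[OF lH _ WH] plH1 by simp
  show ?thesis
    unfolding vulnerable_def
    by (rule exI[of _ 1], rule exI[of _ l], rule exI[of _ H])
      (use lG subH H.SP_awalk[OF PH(1)] LG LH in auto)
qed

end

section \<open>Pruning and the decision criterion\<close>

context net begin

lemma conn_verts:
  assumes "F \<subseteq> arcs G" "ae.conn F S x y" "x \<in> verts G"
  shows "ae.conn F (S \<inter> verts G) x y"
  using assms(2,3)
proof (induction rule: ae.conn.induct)
  case (conn_refl x) then show ?case by (simp add: ae.conn_refl)
next
  case (conn_step x e)
  then show ?case using ae.conn_step[of F "S \<inter> verts G" x e] assms(1) by auto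
qed

text \<open>\<open>closed\<close> and \<open>test\<close> let \<open>z\<close> range over the whole
  type, a program only over the nodes of the net. This lemma bridges the gap.\<close>

lemma conn_avoid_nonvertex:
  assumes "F \<subseteq> arcs G" "ae.conn F S x y" "x \<in> verts G" "z \<notin> verts G"
  shows "ae.conn F (- {z}) x y"
  using ae.conn_mono[OF conn_verts[OF assms(1-3)], of F "- {z}"] assms(4) by blast

text \<open>For a fixed \<open>z\<close> all arcs are judged by the same arc set \<open>F\<close>,
  so one search from \<open>s\<close> and one towards \<open>t\<close> serve all of them.\<close>

definition prune :: "'a \<Rightarrow> 'b set \<Rightarrow> 'b set" where
  "prune z F = {e\<in>F. ae.conn F (- {z}) s (tail G e) \<or> ae.conn F (- {z}) (head G e) t}"

lemma prune_subset: "prune z F \<subseteq> F"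
  by (auto simp: prune_def)

text \<open>The parts of a simple path before and behind \<open>e\<close> have no node in common, so
  at least one of them avoids \<open>z\<close>.\<close>

lemma prune_SP:
  assumes "p \<in> SP G s t" "set p \<subseteq> F"
  shows "set p \<subseteq> prune z F"
proof
  fix e assume "e \<in> set p"
  then obtain p1 p2 where p: "p = p1 @ e # p2" by (meson split_list)
  have w: "ae.walk s p1 (tail G e)" "ae.walk (head G e) p2 t"
    and d: "distinct (s # map (head G) p1 @ head G e # map (head G) p2)"
    using assms(1) by (auto simp: SP_iff ae.spath_def p)
  let ?A = "insert s (head G ` set p1)" and ?B = "insert (head G e) (head G ` set p2)"
  have "?A \<inter> ?B = {}" using d by auto
  then have "?A \<subseteq> - {z} \<or> ?B \<subseteq> - {z}" by blast
  moreover have F: "set p1 \<subseteq> F" "set p2 \<subseteq> F" "e \<in> F" using assms(2) by (auto simp: p)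
  ultimately show "e \<in> prune z F"
    using ae.walk_conn[OF w(1) F(1)] ae.walk_conn[OF w(2) F(2)] by (auto simp: prune_def)
qed

definition prune_all :: "'a list \<Rightarrow> 'b set \<Rightarrow> 'b set" where
  "prune_all zs F = fold prune zs F"

lemma prune_all_subset: "prune_all zs F \<subseteq> F"
proof (induction zs arbitrary: F)
  case (Cons z zs)
  then show ?case using prune_subset[of z F] by (fastforce simp: prune_all_def)
qed (simp add: prune_all_def)

lemma prune_all_SP: "p \<in> SP G s t \<Longrightarrow> set p \<subseteq> F \<Longrightarrow> set p \<subseteq> prune_all zs F"
  by (induction zs arbitrary: F) (simp_all add: prune_all_def prune_SP)

text \<open>Every pass can only shrink the set, so a round that returns \<open>F\<close> contains no
  pass that changes it.\<close>

lemma prune_all_fixpoint: "prune_all zs F = F \<Longrightarrow> z \<in> set zs \<Longrightarrow> prune z F = F"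
proof (induction zs)
  case (Cons y zs)
  have eq: "prune_all zs (prune y F) = F" using Cons.prems(1) by (simp add: prune_all_def)
  then have y: "prune y F = F" using prune_all_subset[of zs "prune y F"] prune_subset[of y F] by blast
  then show ?case using Cons eq by auto
qed simp

lemma funpow_fixpoint:
  assumes "\<And>F. f F \<subseteq> F" "finite F" "card F \<le> m"
  shows "f ((f ^^ m) F) = (f ^^ m) (F :: 'c set)"
  using assms(2,3)
proof (induction m arbitrary: F)
  case 0
  then show ?case using assms(1)[of "{}"] by simp
next
  case (Suc m)
  show ?case
  proof (cases "f F = F")
    case True
    then have "(f ^^ k) F = F" for k by (induction k) auto
    then show ?thesis using True by metis
  next
    case False
    then have "card (f F) < card F" using assms(1)[of F] Suc.prems(1) by (intro psubset_card_mono) auto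
    moreover have "finite (f F)" using assms(1)[of F] Suc.prems(1) by (rule finite_subset)
    ultimately have "f ((f ^^ m) (f F)) = (f ^^ m) (f F)" using Suc.IH Suc.prems(2) by simp
    then show ?thesis by (simp add: funpow_swap1)
  qed
qed

text \<open>
  Every round that changes the arc set removes an arc, so \<open>card (arcs G)\<close> rounds reach a fixed point.
\<close>

definition core :: "'a list \<Rightarrow> 'b set" where
  "core zs = (prune_all zs ^^ card (arcs G)) (arcs G)"

lemma core_facts:
  shows "core zs \<subseteq> arcs G" and "p \<in> SP G s t \<Longrightarrow> set p \<subseteq> core zs"
    and "set zs = verts G \<Longrightarrow> ae.closed (core zs) s t"
proof -
  have sub: "(prune_all zs ^^ k) F \<subseteq> F" for k F
  proof (induction k)
    case (Suc k)
    then show ?case using prune_all_subset[of zs "(prune_all zs ^^ k) F"] by simp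
  qed simp
  show A: "core zs \<subseteq> arcs G" unfolding core_def by (rule sub)
  have "set p \<subseteq> (prune_all zs ^^ k) (arcs G)" if "p \<in> SP G s t" for k
    using that by (induction k) (auto simp: SP_arcs prune_all_SP dest: SP_arcs subsetD)
  then show "set p \<subseteq> core zs" if "p \<in> SP G s t" using that unfolding core_def by blast
  assume zs: "set zs = verts G"
  have fix_all: "prune_all zs (core zs) = core zs"
    unfolding core_def by (rule funpow_fixpoint) (simp_all add: prune_all_subset)
  have V: "ae.conn (core zs) (- {z}) s (tail G e) \<or> ae.conn (core zs) (- {z}) (head G e) t"
    if "e \<in> core zs" "z \<in> verts G" for e z
    using prune_all_fixpoint[OF fix_all, of z] that zs unfolding prune_def by blast
  show "ae.closed (core zs) s t"
    unfolding ae.closed_def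
  proof (intro ballI allI)
    fix e z assume e: "e \<in> core zs"
    then have ve: "tail G e \<in> verts G" "head G e \<in> verts G" using A by auto
    show "ae.conn (core zs) (- {z}) s (tail G e) \<or> ae.conn (core zs) (- {z}) (head G e) t"
    proof (cases "z \<in> verts G")
      case True then show ?thesis using V e by blast
    next
      \<comment> \<open>The tail of \<open>e\<close> as separating node shows that the head reaches
        \<open>t\<close>; a walk within the net then avoids the non-node \<open>z\<close>.\<close>
      case False
      have "ae.conn (core zs) (- {tail G e}) (head G e) t"
        using V[OF e ve(1)] ae.conn_in by blast
      then show ?thesis using conn_avoid_nonvertex[OF A _ ve(2) False] by blast
    qed
  qed
qed

text \<open>The only simple path from a node to itself is empty and has latency 0, in the net as
  well as in every subgraph.\<close>

lemma trivial_not_vulnerable: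
  assumes "s = t"
  shows "\<not> vulnerable G s t"
proof
  have zero: "wardrop_latency K s t r l = 0"
    if K: "net K s t" "latency_function K l" "0 \<le> r" for K :: "('a, 'b) pre_digraph" and r l
  proof (cases "r = 0")
    case True then show ?thesis by (simp add: wardrop_latency_def)
  next
    case False
    then have r: "0 < r" using K by simp
    interpret K: net K s t by fact
    have "K.awalk s [] t" using K.source_in_verts assms by (simp add: K.awalk_iff)
    then obtain \<phi> where \<phi>: "wardrop_flow K s t r l \<phi>" using K.wardrop_exists[OF K(2,3)] by blast
    obtain p where p: "p \<in> SP K s t" "0 < \<phi> p" by (rule K.positive_path[OF \<phi> r])
    have "p = []"
    proof (rule ccontr)
      assume "p \<noteq> []"
      then have "t \<in> head K ` set p" "s \<notin> head K ` set p"
        using p(1) K.ae.walk_end_in by (auto simp: K.SP_iff K.ae.spath_def)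
      then show False using assms by simp
    qed
    then show ?thesis using K.wardrop_latency_eq[OF K(2) r \<phi> p(2)] by (simp add: path_latency_def)
  qed
  assume "vulnerable G s t"
  then obtain r l H p where *: "0 \<le> r" "latency_function G l" "subgraph H G" "pre_digraph.awalk H s p t"
    "wardrop_latency H s t r l < wardrop_latency G s t r l"
    unfolding vulnerable_def by blast
  have netG: "net G s t" by unfold_locales
  have "latency_function H l" using *(2,3) unfolding latency_function_def subgraph_def by blast
  then show False
    using zero[OF netG *(2,1)] zero[OF net_subgraph(1)[OF netG *(3,4)] _ *(1)] *(5) by simp
qed

theorem vulnerable_iff:
  assumes zs: "set zs = verts G"
  shows "vulnerable G s t \<longleftrightarrow> s \<noteq> t \<and>
    (\<exists>e1\<in>core zs. \<exists>e2\<in>core zs. ae.conn (core zs) UNIV (tail G e1) (head G e2) \<and>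
      (\<forall>z\<in>verts G. ae.conn (core zs) (- {z}) s (head G e2) \<or> ae.conn (core zs) (- {z}) (tail G e1) t))"
    (is "_ \<longleftrightarrow> s \<noteq> t \<and> ?T")
proof (cases "s = t")
  case True then show ?thesis using trivial_not_vulnerable by blast
next
  case st: False
  have A: "core zs \<subseteq> arcs G" by (rule core_facts(1))
  have T: "?T \<longleftrightarrow> ae.test (core zs) s t"
  proof
    assume ?T
    then obtain e1 e2 where e: "e1 \<in> core zs" "e2 \<in> core zs" "ae.conn (core zs) UNIV (tail G e1) (head G e2)"
      and z: "\<And>z. z \<in> verts G \<Longrightarrow> ae.conn (core zs) (- {z}) s (head G e2) \<or> ae.conn (core zs) (- {z}) (tail G e1) t"
      by blast
    have u: "tail G e1 \<in> verts G" using e A by auto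
    \<comment> \<open>At \<open>z = s\<close> the first alternative is impossible. The resulting
      walk to \<open>t\<close> takes care of all \<open>z\<close> that are not nodes.\<close>
    have "ae.conn (core zs) (- {s}) (tail G e1) t" using z[OF source_in_verts] ae.conn_in by blast
    then have "ae.conn (core zs) (- {z}) (tail G e1) t" if "z \<notin> verts G" for z
      using conn_avoid_nonvertex[OF A _ u that] by blast
    then show "ae.test (core zs) s t" unfolding ae.test_def using e z by blast
  qed (auto simp: ae.test_def)
  have fin: "finite (core zs)" using A finite_arcs by (rule finite_subset)
  show ?thesis
  proof (cases "core zs = {}")
    case True
    have "\<not> vulnerable G s t"
    proof
      assume "vulnerable G s t"
      then obtain H p where H: "subgraph H G" "pre_digraph.awalk H s p t" unfolding vulnerable_def by blast
      then have "awalk s p t" by (rule subgraph_awalk_imp_awalk[rotated])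
      then have "awalk_to_apath p \<in> SP G s t" using apath_awalk_to_apath by (simp add: SP_def)
      from core_facts(2)[OF this, of zs] this have "[] \<in> SP G s t" using True by simp
      then show False using st by (simp add: SP_iff ae.spath_def)
    qed
    then show ?thesis using True by simp
  next
    case False
    consider "ae.sp (core zs) s t" | "ae.braess (core zs) s t" "ae.cross (core zs) s t"
      using ae.closed_sp_or_braess[OF fin False st core_facts(3)[OF zs]] by blast
    then show ?thesis
    proof cases
      case 1
      then show ?thesis using sp_not_vulnerable[OF 1 A core_facts(2)] ae.sp_not_test[OF 1] T by blast
    next
      case 2
      then show ?thesis
        using braess_vulnerable[OF ae.braess_mono[OF 2(1) A]] ae.cross_imp_test[OF 2(2)] T st by blast
    qed
  qed
qed

end

section \<open>A while language compiled to the random access machine\<close>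

text \<open>Scalars and arrays are separate name spaces, so that proofs about programs need not
  exclude aliasing. Addresses occur only in the correctness proof of the compiler.\<close>

datatype com =
    Skip
  | Lit nat nat
  | Plus nat nat nat
  | Minus nat nat nat
  | Inp nat nat
  | Get nat nat nat
  | Put nat nat nat
  | Seq com com (infixr ";;" 60)
  | Cond nat com com
  | While nat com

text \<open>
  The first component of a state is a clock. Each of its ticks covers at most ten machine steps.
\<close>

type_synonym st = "nat \<times> (nat \<Rightarrow> nat) \<times> (nat \<Rightarrow> nat \<Rightarrow> nat)"

inductive run :: "nat list \<Rightarrow> com \<Rightarrow> st \<Rightarrow> st \<Rightarrow> bool" for xs where
  run_Skip: "run xs Skip (k, V, A) (k, V, A)"
| run_Lit: "run xs (Lit x c) (k, V, A) (Suc k, V(x := c), A)"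
| run_Plus: "run xs (Plus x y z) (k, V, A) (Suc k, V(x := V y + V z), A)"
| run_Minus: "run xs (Minus x y z) (k, V, A) (Suc k, V(x := V y - V z), A)"
| run_Inp: "run xs (Inp x y) (k, V, A) (Suc k, V(x := (if V y < length xs then xs ! V y else 0)), A)"
| run_Get: "run xs (Get x j y) (k, V, A) (Suc k, V(x := A j (V y)), A)"
| run_Put: "run xs (Put j y x) (k, V, A) (Suc k, V, A(j := (A j)(V y := V x)))"
| run_Seq: "run xs c \<sigma> \<sigma>' \<Longrightarrow> run xs d \<sigma>' \<sigma>'' \<Longrightarrow> run xs (c ;; d) \<sigma> \<sigma>''"
| run_Cond_true: "V x \<noteq> 0 \<Longrightarrow> run xs c (Suc k, V, A) \<sigma> \<Longrightarrow> run xs (Cond x c d) (k, V, A) \<sigma>"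
| run_Cond_false: "V x = 0 \<Longrightarrow> run xs d (Suc k, V, A) \<sigma> \<Longrightarrow> run xs (Cond x c d) (k, V, A) \<sigma>"
| run_While_true: "V x \<noteq> 0 \<Longrightarrow> run xs c (Suc k, V, A) \<sigma> \<Longrightarrow> run xs (While x c) \<sigma> \<sigma>' \<Longrightarrow>
    run xs (While x c) (k, V, A) \<sigma>'"
| run_While_false: "V x = 0 \<Longrightarrow> run xs (While x c) (k, V, A) (Suc k, V, A)"

text \<open>Total correctness: some terminating run satisfies \<open>Q\<close>. The clock is visible
  to \<open>Q\<close>, so running times are ordinary postconditions.\<close>

definition wp :: "nat list \<Rightarrow> com \<Rightarrow> (nat \<Rightarrow> (nat \<Rightarrow> nat) \<Rightarrow> (nat \<Rightarrow> nat \<Rightarrow> nat) \<Rightarrow> bool) \<Rightarrow>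
    nat \<Rightarrow> (nat \<Rightarrow> nat) \<Rightarrow> (nat \<Rightarrow> nat \<Rightarrow> nat) \<Rightarrow> bool" where
  "wp xs c Q k V A \<longleftrightarrow> (\<exists>k' V' A'. run xs c (k, V, A) (k', V', A') \<and> Q k' V' A')"

inductive_cases run_SkipE: "run xs Skip \<sigma> \<sigma>'"
  and run_LitE: "run xs (Lit x c) \<sigma> \<sigma>'"
  and run_PlusE: "run xs (Plus x y z) \<sigma> \<sigma>'"
  and run_MinusE: "run xs (Minus x y z) \<sigma> \<sigma>'"
  and run_InpE: "run xs (Inp x y) \<sigma> \<sigma>'"
  and run_GetE: "run xs (Get x j y) \<sigma> \<sigma>'"
  and run_PutE: "run xs (Put j y x) \<sigma> \<sigma>'"
  and run_SeqE: "run xs (c ;; d) \<sigma> \<sigma>'"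
  and run_CondE: "run xs (Cond x c d) \<sigma> \<sigma>'"

lemma wp_basic [simp]:
  "wp xs Skip Q k V A \<longleftrightarrow> Q k V A"
  "wp xs (Lit x c) Q k V A \<longleftrightarrow> Q (Suc k) (V(x := c)) A"
  "wp xs (Plus x y z) Q k V A \<longleftrightarrow> Q (Suc k) (V(x := V y + V z)) A"
  "wp xs (Minus x y z) Q k V A \<longleftrightarrow> Q (Suc k) (V(x := V y - V z)) A"
  "wp xs (Inp x y) Q k V A \<longleftrightarrow> Q (Suc k) (V(x := (if V y < length xs then xs ! V y else 0))) A"
  "wp xs (Get x j y) Q k V A \<longleftrightarrow> Q (Suc k) (V(x := A j (V y))) A"
  "wp xs (Put j y x) Q k V A \<longleftrightarrow> Q (Suc k) V (A(j := (A j)(V y := V x)))"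
  unfolding wp_def
  by (blast elim: run_SkipE intro: run_Skip, blast elim: run_LitE intro: run_Lit,
      blast elim: run_PlusE intro: run_Plus, blast elim: run_MinusE intro: run_Minus,
      blast elim: run_InpE intro: run_Inp, blast elim: run_GetE intro: run_Get,
      blast elim: run_PutE intro: run_Put)

lemma wp_Seq [simp]: "wp xs (c ;; d) Q = wp xs c (wp xs d Q)"
  unfolding wp_def by (intro ext) (force elim: run_SeqE intro: run_Seq)

lemma wp_Cond [simp]:
  "wp xs (Cond x c d) Q k V A \<longleftrightarrow> (if V x \<noteq> 0 then wp xs c Q (Suc k) V A else wp xs d Q (Suc k) V A)"
proof (cases "V x = 0")
  case True
  then have "run xs (Cond x c d) (k, V, A) \<sigma> \<longleftrightarrow> run xs d (Suc k, V, A) \<sigma>" for \<sigma>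
    by (auto elim!: run_CondE intro: run_Cond_false)
  then show ?thesis using True by (simp add: wp_def)
next
  case False
  then have "run xs (Cond x c d) (k, V, A) \<sigma> \<longleftrightarrow> run xs c (Suc k, V, A) \<sigma>" for \<sigma>
    by (auto elim!: run_CondE intro: run_Cond_true)
  then show ?thesis using False by (simp add: wp_def)
qed

lemma wp_mono: "wp xs c Q k V A \<Longrightarrow> (\<And>k' V' A'. Q k' V' A' \<Longrightarrow> Q' k' V' A') \<Longrightarrow> wp xs c Q' k V A"
  unfolding wp_def by blast

text \<open>Each iteration costs a tick for the test and at most \<open>B\<close> for the body, and
  the failing test costs one more. Any decrease of the measure is allowed, which suits amortised
  bounds.\<close>

lemma wp_While:
  assumes init: "I n V A"
    and body: "\<And>k n V A. I n V A \<Longrightarrow> V x \<noteq> 0 \<Longrightarrow>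
      wp xs c (\<lambda>k' V' A'. k' \<le> k + B \<and> (\<exists>n'<n. I n' V' A')) k V A"
    and exit: "\<And>k' n' V' A'. I n' V' A' \<Longrightarrow> V' x = 0 \<Longrightarrow> k' \<le> k + Suc B * n + 1 \<Longrightarrow> Q k' V' A'"
  shows "wp xs (While x c) Q k V A"
  using init exit
proof (induction n arbitrary: k V A rule: less_induct)
  case (less n)
  show ?case
  proof (cases "V x = 0")
    case True
    then show ?thesis unfolding wp_def
      using run_While_false[of V x xs c k A] less.prems(2)[OF less.prems(1) True, of "Suc k"] by auto
  next
    case False
    obtain k1 V1 A1 n1 where 1: "run xs c (Suc k, V, A) (k1, V1, A1)" "k1 \<le> Suc k + B" "n1 < n" "I n1 V1 A1"
      using body[OF less.prems(1) False, of "Suc k"] unfolding wp_def by blast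
    have "wp xs (While x c) Q k1 V1 A1"
    proof (rule less.IH[OF 1(3,4)])
      fix k' n' V' A' assume *: "I n' V' A'" "V' x = 0" "k' \<le> k1 + Suc B * n1 + 1"
      have "Suc B * Suc n1 \<le> Suc B * n" using 1(3) by (intro mult_le_mono2) simp
      then have "k' \<le> k + Suc B * n + 1" using *(3) 1(2) by simp
      then show "Q k' V' A'" by (rule less.prems(2)[OF *(1,2)])
    qed
    then show ?thesis using run_While_true[OF _ 1(1)] False unfolding wp_def by blast
  qed
qed

section \<open>Compilation to machine code\<close>

fun csize :: "com \<Rightarrow> nat" where
  "csize Skip = 0"
| "csize (Get x j y) = 8"
| "csize (Put j y x) = 8"
| "csize (c ;; d) = csize c + csize d"
| "csize (Cond x c d) = csize c + csize d + 2"
| "csize (While x c) = csize c + 2"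
| "csize _ = 1"

text \<open>Five doublings replace the missing multiplication by 32. Arrays are interleaved modulo
  32 because no bound on their lengths is known in advance.\<close>

definition address :: "nat \<Rightarrow> nat \<Rightarrow> instr list" where
  "address j y = [Add 31 y y, Add 31 31 31, Add 31 31 31, Add 31 31 31, Add 31 31 31,
     Const 30 (32 + j), Add 31 31 30]"

text \<open>
  Scalar \<open>x\<close> lives in register \<open>x < 30\<close> and entry \<open>i\<close> of array \<open>j < 32\<close> in register
  \<open>32 * i + 32 + j\<close>; registers 30 and 31 serve to compute addresses.
\<close>

fun compile :: "nat \<Rightarrow> com \<Rightarrow> instr list" where
  "compile a Skip = []"
| "compile a (Lit x c) = [Const x c]"
| "compile a (Plus x y z) = [Add x y z]"
| "compile a (Minus x y z) = [Sub x y z]"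
| "compile a (Inp x y) = [Read x y]"
| "compile a (Get x j y) = address j y @ [Load x 31]"
| "compile a (Put j y x) = address j y @ [Store 31 x]"
| "compile a (c ;; d) = compile a c @ compile (a + csize c) d"
| "compile a (Cond x c d) = JumpZero x (a + csize c + 2) # compile (Suc a) c @
     Jump (a + csize c + csize d + 2) # compile (a + csize c + 2) d"
| "compile a (While x c) = JumpZero x (a + csize c + 2) # compile (Suc a) c @ [Jump a]"

lemma length_compile [simp]: "length (compile a c) = csize c"
  by (induction c arbitrary: a) (auto simp: address_def)

fun well_addressed :: "com \<Rightarrow> bool" where
  "well_addressed Skip \<longleftrightarrow> True"
| "well_addressed (Lit x c) \<longleftrightarrow> x < 30"
| "well_addressed (Plus x y z) \<longleftrightarrow> x < 30 \<and> y < 30 \<and> z < 30"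
| "well_addressed (Minus x y z) \<longleftrightarrow> x < 30 \<and> y < 30 \<and> z < 30"
| "well_addressed (Inp x y) \<longleftrightarrow> x < 30 \<and> y < 30"
| "well_addressed (Get x j y) \<longleftrightarrow> x < 30 \<and> y < 30 \<and> j < 32"
| "well_addressed (Put j y x) \<longleftrightarrow> x < 30 \<and> y < 30 \<and> j < 32"
| "well_addressed (c ;; d) \<longleftrightarrow> well_addressed c \<and> well_addressed d"
| "well_addressed (Cond x c d) \<longleftrightarrow> x < 30 \<and> well_addressed c \<and> well_addressed d"
| "well_addressed (While x c) \<longleftrightarrow> x < 30 \<and> well_addressed c"

definition rep :: "(nat \<Rightarrow> nat) \<Rightarrow> (nat \<Rightarrow> nat) \<Rightarrow> (nat \<Rightarrow> nat \<Rightarrow> nat) \<Rightarrow> bool" where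
  "rep R V A \<longleftrightarrow> (\<forall>x<30. R x = V x) \<and> (\<forall>j<32. \<forall>i. R (32 * i + (32 + j)) = A j i)"

lemma rep_scalar: "rep R V A \<Longrightarrow> x < 30 \<Longrightarrow> rep (R(x := v)) (V(x := v)) A"
  by (auto simp: rep_def)

lemma rep_temp: "rep R V A \<Longrightarrow> rep (R(30 := v, 31 := w)) V A"
  by (auto simp: rep_def)

lemma rep_array:
  assumes "rep R V A" "j < 32"
  shows "rep (R(32 * i + (32 + j) := v)) V (A(j := (A j)(i := v)))"
proof -
  have "32 * i' + (32 + j') = 32 * i + (32 + j) \<longleftrightarrow> i' = i \<and> j' = j" if "j' < 32" for i' j'
  proof
    assume eq: "32 * i' + (32 + j') = 32 * i + (32 + j)"
    then have "i' = i" using that assms(2) by linarith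
    then show "i' = i \<and> j' = j" using eq by simp
  qed simp
  then show ?thesis using assms by (auto simp: rep_def)
qed

definition code_at :: "instr list \<Rightarrow> nat \<Rightarrow> instr list \<Rightarrow> bool" where
  "code_at P a is \<longleftrightarrow> (\<exists>pre post. P = pre @ is @ post \<and> length pre = a)"

lemma code_at_append: "code_at P a (is @ js) \<Longrightarrow> code_at P a is \<and> code_at P (a + length is) js"
proof -
  assume "code_at P a (is @ js)"
  then obtain pre post where *: "P = pre @ (is @ js) @ post" "length pre = a"
    unfolding code_at_def by blast
  have "P = pre @ is @ (js @ post)" "P = (pre @ is) @ js @ post" "length (pre @ is) = a + length is"
    using * by simp_all
  then show ?thesis
    unfolding code_at_def using *(2) by blast
qed

lemma code_at_Cons: "code_at P a (i # is) \<Longrightarrow> P ! a = i \<and> a < length P \<and> code_at P (Suc a) is"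
proof -
  assume c: "code_at P a (i # is)"
  then obtain pre post where "P = pre @ (i # is) @ post" "length pre = a" unfolding code_at_def by blast
  then have "P ! a = i" "a < length P" by (auto simp: nth_append)
  then show ?thesis using code_at_append[of P a "[i]" "is"] c by simp
qed

lemma step_code: "code_at P a (i # is) \<Longrightarrow> step P xs (a, R) = exec_instr xs i (a, R)"
  using code_at_Cons[of P a i "is"] by (simp add: step_def)

lemma steps_add:
  "(step P xs ^^ m) \<sigma> = \<sigma>' \<Longrightarrow> (step P xs ^^ n) \<sigma>' = \<sigma>'' \<Longrightarrow> (step P xs ^^ (m + n)) \<sigma> = \<sigma>''"
  by (simp add: add.commute[of m] funpow_add)

fun is_jump :: "instr \<Rightarrow> bool" where
  "is_jump (Jump _) = True" | "is_jump (JumpZero _ _) = True" | "is_jump _ = False"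

text \<open>Array accesses compile to eight instructions without jumps; this evaluates them in one
  go.\<close>

lemma straight_line:
  assumes "code_at P a is" "\<forall>i\<in>set is. \<not> is_jump i"
  shows "(step P xs ^^ length is) (a, R) = (a + length is, fold (\<lambda>i R. snd (exec_instr xs i (0, R))) is R)"
  using assms
proof (induction "is" arbitrary: a R)
  case (Cons i "is")
  have "exec_instr xs i (a, R) = (Suc a, snd (exec_instr xs i (0, R)))"
    using Cons.prems(2) by (cases i) auto
  then have "step P xs (a, R) = (Suc a, snd (exec_instr xs i (0, R)))"
    using step_code[OF Cons.prems(1)] by simp
  then show ?case
    using Cons.IH[of "Suc a"] Cons.prems code_at_Cons[OF Cons.prems(1)] by (simp add: funpow_swap1)
qed simp

text \<open>Ten steps per tick suffice, since an array access takes eight and the tests and jumps of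
  a conditional or of one loop iteration take at most two. Jump targets are absolute, so the code is
  placed at an arbitrary position \<open>a\<close> of a fixed program.\<close>

lemma compile_correct:
  assumes "run xs c \<sigma> \<sigma>'" "well_addressed c" "code_at P a (compile a c)" "rep R (fst (snd \<sigma>)) (snd (snd \<sigma>))"
  shows "\<exists>n R'. (step P xs ^^ n) (a, R) = (a + csize c, R') \<and> rep R' (fst (snd \<sigma>')) (snd (snd \<sigma>')) \<and>
    n + 10 * fst \<sigma> \<le> 10 * fst \<sigma>'"
  using assms
proof (induction arbitrary: a R rule: run.induct)
  case (run_Skip k V A)
  then show ?case by (intro exI[of _ 0] exI[of _ R]) simp
next
  case (run_Lit x c k V A)
  have rep: "rep (R(x := c)) (V(x := c)) A" using run_Lit by (intro rep_scalar) auto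
  have "step P xs (a, R) = (Suc a, R(x := c))"
    using step_code[of P a "Const x c" "[]" xs R] run_Lit by simp
  then have "(step P xs ^^ 1) (a, R) = (Suc a, R(x := c))" by simp
  then show ?case using rep by (auto simp: fun_upd_def intro!: exI[of _ "1 :: nat"])
next
  case (run_Plus x y z k V A)
  then have "R y = V y" "R z = V z" by (simp_all add: rep_def)
  have rep: "rep (R(x := V y + V z)) (V(x := V y + V z)) A" using run_Plus by (intro rep_scalar) auto
  have "step P xs (a, R) = (Suc a, R(x := V y + V z))"
    using step_code[of P a "Add x y z" "[]" xs R] run_Plus \<open>R y = V y\<close> \<open>R z = V z\<close> by simp
  then have "(step P xs ^^ 1) (a, R) = (Suc a, R(x := V y + V z))" by simp
  then show ?case using rep by (auto simp: fun_upd_def intro!: exI[of _ "1 :: nat"])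
next
  case (run_Minus x y z k V A)
  then have "R y = V y" "R z = V z" by (simp_all add: rep_def)
  have rep: "rep (R(x := V y - V z)) (V(x := V y - V z)) A" using run_Minus by (intro rep_scalar) auto
  have "step P xs (a, R) = (Suc a, R(x := V y - V z))"
    using step_code[of P a "Sub x y z" "[]" xs R] run_Minus \<open>R y = V y\<close> \<open>R z = V z\<close> by simp
  then have "(step P xs ^^ 1) (a, R) = (Suc a, R(x := V y - V z))" by simp
  then show ?case using rep by (auto simp: fun_upd_def intro!: exI[of _ "1 :: nat"])
next
  case (run_Inp x y k V A)
  then have "R y = V y" by (auto simp: rep_def)
  have rep: "rep (R(x := (if V y < length xs then xs ! V y else 0)))
      (V(x := (if V y < length xs then xs ! V y else 0))) A"
    using run_Inp by (intro rep_scalar) auto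
  have "step P xs (a, R) = (Suc a, R(x := (if V y < length xs then xs ! V y else 0)))"
    using step_code[of P a "Read x y" "[]" xs R] run_Inp \<open>R y = V y\<close> by simp
  then have "(step P xs ^^ 1) (a, R) = (Suc a, R(x := (if V y < length xs then xs ! V y else 0)))" by simp
  then show ?case using rep by (cases "V y < length xs") (auto simp: fun_upd_def intro!: exI[of _ "1 :: nat"])
next
  case (run_Get x j y k V A)
  let ?R = "R(30 := 32 + j, 31 := 32 * V y + (32 + j))"
  have y: "R y = V y" and j: "R (32 * V y + (32 + j)) = A j (V y)" using run_Get by (auto simp: rep_def)
  have "(step P xs ^^ length (compile a (Get x j y))) (a, R) = (a + 8, ?R(x := A j (V y)))"
    by (subst straight_line[OF run_Get(2)]) (use y j run_Get in \<open>auto simp: address_def fun_eq_iff\<close>)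
  then have "(step P xs ^^ 8) (a, R) = (a + 8, ?R(x := A j (V y)))"
    unfolding length_compile csize.simps .
  moreover have "rep (?R(x := A j (V y))) (V(x := A j (V y))) A"
    using run_Get by (intro rep_scalar rep_temp) auto
  ultimately show ?case by (intro exI[of _ 8]) (auto simp: fun_upd_def)
next
  case (run_Put j y x k V A)
  let ?R = "R(30 := 32 + j, 31 := 32 * V y + (32 + j))"
  have y: "R y = V y" "R x = V x" using run_Put by (auto simp: rep_def)
  have "(step P xs ^^ length (compile a (Put j y x))) (a, R) = (a + 8, ?R(32 * V y + (32 + j) := V x))"
    by (subst straight_line[OF run_Put(2)]) (use y run_Put in \<open>auto simp: address_def fun_eq_iff\<close>)
  then have "(step P xs ^^ 8) (a, R) = (a + 8, ?R(32 * V y + (32 + j) := V x))"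
    unfolding length_compile csize.simps .
  moreover have "rep (?R(32 * V y + (32 + j) := V x)) V (A(j := (A j)(V y := V x)))"
    using run_Put by (intro rep_array rep_temp) auto
  ultimately show ?case by (intro exI[of _ 8]) (auto simp: fun_upd_def)
next
  case (run_Seq c \<sigma> \<sigma>' d \<sigma>'')
  have code: "code_at P a (compile a c)" "code_at P (a + csize c) (compile (a + csize c) d)"
    using code_at_append[of P a "compile a c" "compile (a + csize c) d"] run_Seq.prems(2) by simp_all
  obtain n R' where 1: "(step P xs ^^ n) (a, R) = (a + csize c, R')"
      "rep R' (fst (snd \<sigma>')) (snd (snd \<sigma>'))" "n + 10 * fst \<sigma> \<le> 10 * fst \<sigma>'"
    using run_Seq.IH(1)[OF _ code(1) run_Seq.prems(3)] run_Seq.prems(1) by auto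
  obtain n2 R'' where 2: "(step P xs ^^ n2) (a + csize c, R') = (a + csize c + csize d, R'')"
      "rep R'' (fst (snd \<sigma>'')) (snd (snd \<sigma>''))" "n2 + 10 * fst \<sigma>' \<le> 10 * fst \<sigma>''"
    using run_Seq.IH(2)[OF _ code(2) 1(2)] run_Seq.prems(1) by auto
  show ?case
    using steps_add[OF 1(1) 2(1)] 1 2 by (intro exI[of _ "n + n2"] exI[of _ R'']) (simp add: add.assoc)
next
  case (run_Cond_true V x c k A \<sigma> d)
  have code: "code_at P a (JumpZero x (a + csize c + 2) # compile (Suc a) c @
      Jump (a + csize c + csize d + 2) # compile (a + csize c + 2) d)"
    using run_Cond_true.prems(2) by simp
  note c1 = code_at_Cons[OF code]
  note c2 = code_at_append[OF c1[THEN conjunct2, THEN conjunct2]]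
  have "step P xs (a, R) = (Suc a, R)"
    using step_code[OF code] run_Cond_true by (simp add: rep_def)
  then have s1: "(step P xs ^^ 1) (a, R) = (Suc a, R)" by simp
  obtain n R' where 1: "(step P xs ^^ n) (Suc a, R) = (Suc a + csize c, R')"
      "rep R' (fst (snd \<sigma>)) (snd (snd \<sigma>))" "n + 10 * Suc k \<le> 10 * fst \<sigma>"
    using run_Cond_true.IH[OF _ c2[THEN conjunct1], of R] run_Cond_true.prems by auto
  have "step P xs (Suc a + csize c, R') = (a + csize c + csize d + 2, R')"
    using step_code[OF c2[THEN conjunct2], of xs R'] by simp
  then have s2: "(step P xs ^^ 1) (Suc a + csize c, R') = (a + csize c + csize d + 2, R')" by simp
  show ?case
    using steps_add[OF steps_add[OF s1 1(1)] s2] 1(2,3)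
    by (intro exI[of _ "1 + n + 1"] exI[of _ R']) (simp add: add.assoc)
next
  case (run_Cond_false V x d k A \<sigma> c)
  have code: "code_at P a (JumpZero x (a + csize c + 2) # compile (Suc a) c @
      Jump (a + csize c + csize d + 2) # compile (a + csize c + 2) d)"
    using run_Cond_false.prems(2) by simp
  note c1 = code_at_Cons[OF code]
  note c2 = code_at_append[OF c1[THEN conjunct2, THEN conjunct2]]
  note c3 = code_at_Cons[OF c2[THEN conjunct2]]
  have code_d: "code_at P (a + csize c + 2) (compile (a + csize c + 2) d)" using c3 by simp
  have "step P xs (a, R) = (a + csize c + 2, R)"
    using step_code[OF code] run_Cond_false by (simp add: rep_def)
  then have s1: "(step P xs ^^ 1) (a, R) = (a + csize c + 2, R)" by simp
  obtain n R' where 1: "(step P xs ^^ n) (a + csize c + 2, R) = (a + csize c + 2 + csize d, R')"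
      "rep R' (fst (snd \<sigma>)) (snd (snd \<sigma>))" "n + 10 * Suc k \<le> 10 * fst \<sigma>"
    using run_Cond_false.IH[OF _ code_d, of R] run_Cond_false.prems by auto
  show ?case
    using steps_add[OF s1 1(1)] 1(2,3)
    by (intro exI[of _ "1 + n"] exI[of _ R']) (simp add: add.assoc add.commute add.left_commute)
next
  case (run_While_true V x c k A \<sigma> \<sigma>')
  have code: "code_at P a (JumpZero x (a + csize c + 2) # compile (Suc a) c @ [Jump a])"
    using run_While_true.prems(2) by simp
  note c1 = code_at_Cons[OF code]
  note c2 = code_at_append[OF c1[THEN conjunct2, THEN conjunct2]]
  have "step P xs (a, R) = (Suc a, R)"
    using step_code[OF code] run_While_true by (simp add: rep_def)
  then have s1: "(step P xs ^^ 1) (a, R) = (Suc a, R)" by simp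
  obtain n R' where 1: "(step P xs ^^ n) (Suc a, R) = (Suc a + csize c, R')"
      "rep R' (fst (snd \<sigma>)) (snd (snd \<sigma>))" "n + 10 * Suc k \<le> 10 * fst \<sigma>"
    using run_While_true.IH(1)[OF _ c2[THEN conjunct1], of R] run_While_true.prems by auto
  have "step P xs (Suc a + csize c, R') = (a, R')"
    using step_code[OF c2[THEN conjunct2], of xs R'] by simp
  then have s2: "(step P xs ^^ 1) (Suc a + csize c, R') = (a, R')" by simp
  obtain n2 R'' where 2: "(step P xs ^^ n2) (a, R') = (a + csize (While x c), R'')"
      "rep R'' (fst (snd \<sigma>')) (snd (snd \<sigma>'))" "n2 + 10 * fst \<sigma> \<le> 10 * fst \<sigma>'"
    using run_While_true.IH(2)[OF run_While_true.prems(1,2) 1(2)] by auto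
  show ?case
    using steps_add[OF steps_add[OF steps_add[OF s1 1(1)] s2] 2(1)] 1(3) 2(2,3)
    by (intro exI[of _ "1 + n + 1 + n2"] exI[of _ R'']) simp
next
  case (run_While_false V x c k A)
  have code: "code_at P a (JumpZero x (a + csize c + 2) # compile (Suc a) c @ [Jump a])"
    using run_While_false.prems(2) by simp
  have "step P xs (a, R) = (a + csize (While x c), R)"
    using step_code[OF code] run_While_false by (simp add: rep_def)
  then show ?case using run_While_false by (intro exI[of _ 1] exI[of _ R]) simp
qed

lemma compile_answers:
  assumes "wp xs c (\<lambda>k V A. k \<le> K \<and> V 0 = of_bool b) 0 (\<lambda>_. 0) (\<lambda>_ _. 0)" "well_addressed c" "10 * K \<le> T"
  shows "answers_within (compile 0 c) xs T b"
proof -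
  let ?P = "compile 0 c"
  obtain k V A where r: "run xs c (0, \<lambda>_. 0, \<lambda>_ _. 0) (k, V, A)" "k \<le> K" "V 0 = of_bool b"
    using assms(1) unfolding wp_def by blast
  have "code_at ?P 0 ?P" unfolding code_at_def by (intro exI[of _ "[]"]) simp
  from compile_correct[OF r(1) assms(2) this, of "\<lambda>_. 0"] obtain n R where
    n: "(step ?P xs ^^ n) (0, \<lambda>_. 0) = (csize c, R)" "rep R V A" "n \<le> 10 * k"
    by (auto simp: rep_def)
  have halt: "(step ?P xs ^^ i) (csize c, R) = (csize c, R)" for i
    by (induction i) (auto simp: step_def)
  have "n + (T - n) = T" using n(3) r(2) assms(3) by simp
  then have "(step ?P xs ^^ T) (0, \<lambda>_. 0) = (csize c, R)" using steps_add[OF n(1) halt] by metis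
  then show ?thesis using n(2) r(3) by (simp add: answers_within_def rep_def)
qed

section \<open>Graph search in linear time\<close>

definition ptr :: "nat set \<Rightarrow> nat" where
  "ptr S = (if S = {} then 0 else Suc (Min S))"

context
  fixes T E :: "nat \<Rightarrow> nat" and m :: nat
begin

interpretation arc_ends T E .

text \<open>Lists are built from the last arc to the first, so their cells are sorted by arc number:
  behind arc \<open>e\<close>, its list continues with \<open>adj (Suc e) (T e)\<close>.\<close>

definition adj :: "nat \<Rightarrow> nat \<Rightarrow> nat set" where
  "adj q x = {e. q \<le> e \<and> e < m \<and> T e = x}"

text \<open>
  The arcs leaving a node form a linked list. The list cell of arc \<open>e\<close> is \<open>e + 1\<close>, and 0 ends the list.
\<close>

definition pending :: "nat \<Rightarrow> nat set" where
  "pending c = (if c = 0 then {} else adj (c - 1) (T (c - 1)))"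

lemma finite_adj: "finite (adj q x)"
  by (simp add: adj_def)

lemma pending_ptr: "pending (ptr (adj q x)) = adj q x"
proof (cases "adj q x = {}")
  case False
  have M: "Min (adj q x) \<in> adj q x" using False finite_adj by (rule Min_in[rotated])
  have "e \<in> adj q x \<longleftrightarrow> e \<in> adj (Min (adj q x)) (T (Min (adj q x)))" for e
    using M Min_le[OF finite_adj, of e q x] by (auto simp: adj_def)
  then show ?thesis using False by (auto simp: pending_def ptr_def)
qed (simp add: pending_def ptr_def)

lemma ptr_le: "ptr (adj q x) \<le> m"
proof (cases "adj q x = {}")
  case False
  then have "Min (adj q x) \<in> adj q x" using finite_adj by (rule Min_in[rotated])
  then show ?thesis using False by (simp add: ptr_def adj_def)
qed (simp add: ptr_def)

lemma adj_Suc: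
  assumes "e < m"
  shows "adj e x = (if T e = x then insert e (adj (Suc e) x) else adj (Suc e) x)"
  using assms by (auto simp: adj_def Suc_le_eq) (metis le_neq_implies_less)+

lemma ptr_adj_Suc:
  assumes "e < m"
  shows "ptr (adj e x) = (if T e = x then Suc e else ptr (adj (Suc e) x))"
proof (cases "T e = x")
  case True
  have "Min (insert e (adj (Suc e) x)) = e"
    by (rule Min_eqI) (auto simp: finite_adj adj_def)
  then show ?thesis using True by (simp add: adj_Suc[OF assms] ptr_def)
qed (simp add: adj_Suc[OF assms])

lemma pending_Suc: "e < m \<Longrightarrow> pending (Suc e) = insert e (adj (Suc e) (T e))"
  by (simp add: pending_def adj_Suc)

text \<open>The arcs already dealt with: their tail has left the queue, and they do not belong to
  the unread rest \<open>c\<close> of the current list.\<close>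

definition scanned :: "nat list \<Rightarrow> nat \<Rightarrow> nat \<Rightarrow> nat set" where
  "scanned qs h c = {e. e < m \<and> T e \<in> set (take h qs)} - pending c"

text \<open>\<open>qs\<close> keeps every entry ever queued and \<open>h\<close> counts those taken
  out, so \<open>set qs\<close> doubles as the set of nodes reached so far.\<close>

definition sinv :: "nat set \<Rightarrow> nat set \<Rightarrow> nat \<Rightarrow> nat list \<Rightarrow> nat \<Rightarrow> nat \<Rightarrow> bool" where
  "sinv F S x qs h c \<longleftrightarrow> distinct qs \<and> set qs \<subseteq> {w. conn F S x w} \<and> (x \<in> S \<longrightarrow> x \<in> set qs) \<and>
     h \<le> length qs \<and> c \<le> m \<and> pending c \<subseteq> {e. T e \<in> set (take h qs)} \<and>
     (\<forall>e\<in>scanned qs h c. e \<in> F \<longrightarrow> E e \<in> S \<longrightarrow> E e \<in> set qs)"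

text \<open>
  The factor 2 lets an arc pay for its own scan and for the queue entry that this scan may create.
\<close>

definition smeas :: "nat list \<Rightarrow> nat \<Rightarrow> nat \<Rightarrow> nat" where
  "smeas qs h c = 2 * card ({..<m} - scanned qs h c) + (length qs - h)"

lemma card_minus_insert: "e < m \<Longrightarrow> e \<notin> X \<Longrightarrow> Suc (card ({..<m} - insert e X)) = card ({..<m} - X)"
  by (metis Diff_iff Diff_insert card_Suc_Diff1 finite_Diff finite_lessThan lessThan_iff)

lemma scanned_next:
  assumes "sinv F S x qs h (Suc e)"
  shows "scanned (qs @ ys) h (ptr (adj (Suc e) (T e))) = insert e (scanned qs h (Suc e))"
    "e < m" "e \<notin> scanned qs h (Suc e)" "T e \<in> set (take h qs)"
proof -
  show e: "e < m" using assms by (simp add: sinv_def)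
  show Te: "T e \<in> set (take h qs)" using assms pending_Suc[OF e] by (auto simp: sinv_def)
  show "e \<notin> scanned qs h (Suc e)" by (simp add: scanned_def pending_Suc[OF e])
  have "take h (qs @ ys) = take h qs" using assms by (simp add: sinv_def)
  then show "scanned (qs @ ys) h (ptr (adj (Suc e) (T e))) = insert e (scanned qs h (Suc e))"
    using e Te unfolding scanned_def pending_ptr pending_Suc[OF e] by (auto simp: adj_def)
qed

lemma sinv_skip:
  assumes "sinv F S x qs h (Suc e)" "e \<in> F \<Longrightarrow> E e \<in> S \<Longrightarrow> E e \<in> set qs"
  shows "sinv F S x qs h (ptr (adj (Suc e) (T e)))"
    and "smeas qs h (ptr (adj (Suc e) (T e))) < smeas qs h (Suc e)"
proof -
  note n = scanned_next(1)[OF assms(1), of "[]", unfolded append_Nil2] scanned_next(2-4)[OF assms(1)]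
  show "sinv F S x qs h (ptr (adj (Suc e) (T e)))"
    using assms(2) assms(1)[unfolded sinv_def] pending_Suc[OF n(2)] ptr_le
    unfolding sinv_def n(1) pending_ptr by auto
  show "smeas qs h (ptr (adj (Suc e) (T e))) < smeas qs h (Suc e)"
    unfolding smeas_def n(1) using card_minus_insert[OF n(2,3)] by linarith
qed

lemma sinv_push:
  assumes "sinv F S x qs h (Suc e)" "e \<in> F" "E e \<in> S" "E e \<notin> set qs"
  shows "sinv F S x (qs @ [E e]) h (ptr (adj (Suc e) (T e)))"
    and "smeas (qs @ [E e]) h (ptr (adj (Suc e) (T e))) < smeas qs h (Suc e)"
proof -
  note n = scanned_next(1)[OF assms(1), of "[E e]"] scanned_next(2-4)[OF assms(1)]
  have h: "h \<le> length qs" using assms(1) by (simp add: sinv_def)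
  have "conn F S x (T e)" using assms(1) n(4) set_take_subset[of h qs] by (auto simp: sinv_def)
  then have c: "conn F S x (E e)" using assms conn_step by blast
  show "sinv F S x (qs @ [E e]) h (ptr (adj (Suc e) (T e)))"
    using assms(4) assms(1)[unfolded sinv_def] pending_Suc[OF n(2)] ptr_le c
    unfolding sinv_def n(1) pending_ptr by auto
  show "smeas (qs @ [E e]) h (ptr (adj (Suc e) (T e))) < smeas qs h (Suc e)"
    unfolding smeas_def n(1) using card_minus_insert[OF n(2,3)] h by simp
qed

text \<open>The arcs leaving the popped node become eligible and pending at the same moment, so
  \<open>scanned\<close> does not change and the measure falls by the queue entry.\<close>

lemma sinv_pop:
  assumes "sinv F S x qs h 0" "h < length qs"
  shows "sinv F S x qs (Suc h) (ptr (adj 0 (qs ! h)))"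
    and "smeas qs (Suc h) (ptr (adj 0 (qs ! h))) < smeas qs h 0"
proof -
  have tk: "take (Suc h) qs = take h qs @ [qs ! h]" using assms(2) by (rule take_Suc_conv_app_nth)
  have "distinct (take (Suc h) qs)" using assms(1) by (auto simp: sinv_def)
  then have new: "qs ! h \<notin> set (take h qs)" unfolding tk by simp
  have n: "scanned qs (Suc h) (ptr (adj 0 (qs ! h))) = scanned qs h 0"
    unfolding scanned_def pending_ptr tk using new by (auto simp: adj_def pending_def)
  show "sinv F S x qs (Suc h) (ptr (adj 0 (qs ! h)))"
    using assms ptr_le[of 0 "qs ! h"] unfolding sinv_def n pending_ptr tk by (auto simp: adj_def)
  show "smeas qs (Suc h) (ptr (adj 0 (qs ! h))) < smeas qs h 0"
    unfolding smeas_def n using assms(2) by simp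
qed

lemma sinv_end:
  assumes "sinv F S x qs (length qs) 0" "F \<subseteq> {..<m}"
  shows "set qs = {w. conn F S x w}"
proof
  show "set qs \<subseteq> {w. conn F S x w}" using assms by (simp add: sinv_def)
  have "w \<in> set qs" if "conn F S x w" for w
    using that
  proof (induction y\<equiv>x w rule: conn.induct)
    case conn_refl then show ?case using assms by (simp add: sinv_def)
  next
    case (conn_step e)
    then have "e \<in> scanned qs (length qs) 0" using assms(2) by (auto simp: scanned_def pending_def)
    then show ?case using assms(1) conn_step by (auto simp: sinv_def)
  qed
  then show "{w. conn F S x w} \<subseteq> set qs" by blast
qed

lemma scanned_start: "scanned qs 0 0 = {}"
  unfolding scanned_def take_0 list.set(1) by blast

lemma sinv_start:
  assumes "qs = (if x \<in> S then [x] else [])"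
  shows "sinv F S x qs 0 0"
  unfolding sinv_def scanned_start
proof (intro conjI)
  show "distinct qs" "x \<in> S \<longrightarrow> x \<in> set qs" using assms by simp_all
  show "set qs \<subseteq> {w. conn F S x w}" using assms conn_refl by (cases "x \<in> S") simp_all
  have "pending 0 = {}" by (simp add: pending_def)
  then show "pending 0 \<subseteq> {e. T e \<in> set (take 0 qs)}" by (simp only: empty_subsetI)
qed simp_all

lemma smeas_start: "smeas qs 0 0 \<le> 2 * m + length qs"
  by (simp add: smeas_def scanned_start)

end

text \<open>Scanning an arc, popping a node and stopping are three kinds of iteration of a single
  loop, so one measure counts them all. Tests rest on truncated subtraction:
  \<open>a - b + (b - a)\<close> is nonzero if and only if the numbers differ, and stamp minus mark
  is nonzero if and only if the node is unmarked, because no mark exceeds the stamp.\<close>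

definition search_body :: "nat \<Rightarrow> nat \<Rightarrow> nat \<Rightarrow> nat \<Rightarrow> nat \<Rightarrow> com" where
  "search_body fir nxt en mark st =
    Cond 14
      (Minus 19 14 5 ;; Get 9 2 19 ;;
       Cond 9
         (Get 18 en 19 ;; Minus 9 18 7 ;; Minus 10 7 18 ;; Plus 9 9 10 ;;
          Get 10 mark 18 ;; Minus 10 st 10 ;;
          Cond 9 (Cond 10 (Put mark 18 st ;; Put 9 13 18 ;; Plus 13 13 5) Skip) Skip)
         Skip ;;
       Get 14 nxt 19)
      (Minus 9 13 12 ;;
       Cond 9 (Get 19 9 12 ;; Get 14 fir 19 ;; Plus 12 12 5) (Lit 11 0))"

definition search :: "nat \<Rightarrow> nat \<Rightarrow> nat \<Rightarrow> nat \<Rightarrow> nat \<Rightarrow> nat \<Rightarrow> com" where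
  "search sv fir nxt en mark st =
    Plus st st 5 ;; Lit 12 0 ;; Lit 13 0 ;; Minus 9 sv 7 ;; Minus 10 7 sv ;; Plus 9 9 10 ;;
    Cond 9 (Put mark sv st ;; Put 9 13 sv ;; Plus 13 13 5) Skip ;;
    Lit 14 0 ;; Lit 11 1 ;; While 11 (search_body fir nxt en mark st)"

definition search_frame where
  "search_frame mark st V0 A0 V A \<longleftrightarrow>
     (\<forall>x. x \<notin> {9, 10, 11, 12, 13, 14, 18, 19, st} \<longrightarrow> V x = V0 x) \<and>
     (\<forall>j. j \<noteq> mark \<longrightarrow> j \<noteq> 9 \<longrightarrow> A j = A0 j)"
  for mark st :: nat and V0 V :: "nat \<Rightarrow> nat" and A0 A :: "nat \<Rightarrow> nat \<Rightarrow> nat"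

text \<open>The loop flag is part of the measure \<open>N\<close>, so that the last iteration, which
  merely clears the flag, also makes progress.\<close>

definition search_inv where
  "search_inv T E m F z x mark st \<tau> V0 A0 N V A \<longleftrightarrow> search_frame mark st V0 A0 V A \<and>
     V st = \<tau> \<and> V 11 \<le> 1 \<and> (\<forall>w. A mark w \<le> \<tau>) \<and>
     (\<exists>qs. sinv T E m F (- {z}) x qs (V 12) (V 14) \<and> V 13 = length qs \<and>
       (\<forall>i<length qs. A 9 i = qs ! i) \<and> (\<forall>w. A mark w = \<tau> \<longleftrightarrow> w \<in> set qs) \<and>
       (V 11 = 0 \<longrightarrow> V 14 = 0 \<and> V 12 = length qs) \<and> N = smeas T m qs (V 12) (V 14) + V 11)"
  for T E :: "nat \<Rightarrow> nat" and m :: nat and F :: "nat set" and z x mark st \<tau> :: nat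
    and V0 :: "nat \<Rightarrow> nat" and A0 :: "nat \<Rightarrow> nat \<Rightarrow> nat" and N :: nat
    and V :: "nat \<Rightarrow> nat" and A :: "nat \<Rightarrow> nat \<Rightarrow> nat"

lemma wp_search_body:
  assumes lists: "\<And>x. A0 fir x = ptr (adj T m 0 x)" "\<And>e. e < m \<Longrightarrow> A0 nxt e = ptr (adj T m (Suc e) (T e))"
      "\<And>e. e < m \<Longrightarrow> A0 en e = E e"
    and F: "F = {e. e < m \<and> A0 2 e \<noteq> 0}" and one: "V0 5 = 1" and z: "V0 7 = z"
    and dist: "mark \<notin> {2, 9, fir, nxt, en}" "9 \<notin> {fir, nxt, en}"
      "st \<notin> {5, 7, 9, 10, 11, 12, 13, 14, 18, 19}"
    and inv: "search_inv T E m F z x mark st \<tau> V0 A0 N V A" and go: "V 11 \<noteq> 0"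
  shows "wp xs (search_body fir nxt en mark st)
    (\<lambda>k' V' A'. k' \<le> k + 20 \<and> (\<exists>N'<N. search_inv T E m F z x mark st \<tau> V0 A0 N' V' A')) k V A"
proof -
  from inv obtain qs where
    fr: "search_frame mark st V0 A0 V A" and st: "V st = \<tau>" and go1: "V 11 \<le> 1" and mle: "\<And>w. A mark w \<le> \<tau>"
    and si: "sinv T E m F (- {z}) x qs (V 12) (V 14)" and qt: "V 13 = length qs"
    and qs: "\<And>i. i < length qs \<Longrightarrow> A 9 i = qs ! i" and mk: "\<And>w. A mark w = \<tau> \<longleftrightarrow> w \<in> set qs"
    and N: "N = smeas T m qs (V 12) (V 14) + V 11"
    unfolding search_inv_def by blast
  have V: "V 5 = 1" "V 7 = z" "V 11 = 1"
    using fr one z dist go go1 by (auto simp: search_frame_def)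
  have A: "A fir = A0 fir" "A nxt = A0 nxt" "A en = A0 en" "A 2 = A0 2"
    using fr dist by (auto simp: search_frame_def)
  have dist': "nxt \<noteq> mark" "fir \<noteq> mark" "en \<noteq> mark" "9 \<noteq> mark" "2 \<noteq> mark"
    using dist by auto
  note dist = dist dist'
  show ?thesis
  proof (cases "V 14 = 0")
    case c0: True
    show ?thesis
    proof (cases "V 12 < length qs")
      case True
      note p = sinv_pop[OF si[unfolded c0] True]
      let ?V = "V(9 := length qs - V 12, 19 := A 9 (V 12), 14 := A fir (A 9 (V 12)), 12 := Suc (V 12))"
      have run: "wp xs (search_body fir nxt en mark st) Q k V A = Q (Suc (Suc (Suc (Suc (Suc (Suc k)))))) ?V A" for Q
        using c0 True V(1) qt dist unfolding search_body_def by simp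
      let ?N = "smeas T m qs (Suc (V 12)) (ptr (adj T m 0 (qs ! V 12))) + 1"
      have "search_inv T E m F z x mark st \<tau> V0 A0 ?N ?V A"
        unfolding search_inv_def
      proof (intro conjI exI[of _ qs])
        show "search_frame mark st V0 A0 ?V A" using fr by (simp add: search_frame_def)
        show "sinv T E m F (- {z}) x qs (?V 12) (?V 14)"
          using p(1) A(1) lists(1) qs[OF True] by simp
        show "?N = smeas T m qs (?V 12) (?V 14) + ?V 11"
          using A(1) lists(1) qs[OF True] V by simp
      qed (use st V mle qt qs mk dist in auto)
      moreover have "?N < N" using p(2) V c0 by (simp add: N)
      ultimately show ?thesis unfolding run by auto
    next
      case False
      then have h: "V 12 = length qs" using si by (simp add: sinv_def)
      let ?V = "V(9 := 0, 11 := 0)"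
      have run: "wp xs (search_body fir nxt en mark st) Q k V A = Q (Suc (Suc (Suc (Suc k)))) ?V A" for Q
        using c0 h V(1) qt dist unfolding search_body_def by simp
      let ?N = "smeas T m qs (V 12) 0"
      have "search_inv T E m F z x mark st \<tau> V0 A0 ?N ?V A"
        unfolding search_inv_def
      proof (intro conjI exI[of _ qs])
        show "search_frame mark st V0 A0 ?V A" using fr by (simp add: search_frame_def)
        show "sinv T E m F (- {z}) x qs (?V 12) (?V 14)" using si by simp
        show "?N = smeas T m qs (?V 12) (?V 14) + ?V 11" using c0 by simp
      qed (use st V mle qt qs mk dist h c0 in auto)
      moreover have "?N < N" using V c0 by (simp add: N)
      ultimately show ?thesis unfolding run by auto
    qed
  next
    case c: False
    define e where "e = V 14 - 1"
    have e: "V 14 = Suc e" using c by (simp add: e_def)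
    have si': "sinv T E m F (- {z}) x qs (V 12) (Suc e)" using si e by simp
    have em: "e < m" by (rule scanned_next(2)[OF si'])
    have Ae: "A nxt e = ptr (adj T m (Suc e) (T e))" "A en e = E e" "A 2 e \<noteq> 0 \<longleftrightarrow> e \<in> F"
      using A lists em F by auto
    let ?d = "E e - z + (z - E e)"
    show ?thesis
    proof (cases "e \<in> F \<and> ?d \<noteq> 0 \<and> \<tau> - A mark (E e) \<noteq> 0")
      case True
      then have t: "e \<in> F" "E e \<in> - {z}" "E e \<notin> set qs" using mk[of "E e"] by auto
      note p = sinv_push[OF si' t]
      have alive: "A 2 e \<noteq> 0" using t(1) Ae(3) by blast
      let ?V = "V(19 := e, 9 := A 2 e, 18 := E e, 9 := E e - z, 10 := z - E e, 9 := ?d,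
        10 := A mark (E e), 10 := \<tau> - A mark (E e), 13 := Suc (V 13), 14 := A nxt e)"
      let ?A = "A(mark := (A mark)(E e := \<tau>), 9 := (A 9)(V 13 := E e))"
      have run: "wp xs (search_body fir nxt en mark st) Q k V A = Q (Suc (Suc (Suc (Suc (Suc (Suc (Suc (Suc (Suc (Suc (Suc (Suc (Suc (Suc (Suc (Suc k)))))))))))))))) ?V ?A" for Q
        using True alive e V(1,2) st Ae(2) dist unfolding search_body_def by simp
      let ?N = "smeas T m (qs @ [E e]) (V 12) (A nxt e) + 1"
      have "search_inv T E m F z x mark st \<tau> V0 A0 ?N ?V ?A"
        unfolding search_inv_def
      proof (intro conjI exI[of _ "qs @ [E e]"])
        show "search_frame mark st V0 A0 ?V ?A" using fr by (simp add: search_frame_def)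
        show "sinv T E m F (- {z}) x (qs @ [E e]) (?V 12) (?V 14)" using p(1) Ae(1) by simp
        show "\<forall>i<length (qs @ [E e]). ?A 9 i = (qs @ [E e]) ! i"
          using qs qt by (auto simp: nth_append less_Suc_eq)
        show "\<forall>w. (?A mark w = \<tau>) = (w \<in> set (qs @ [E e]))" using mk dist by simp
        show "\<forall>w. ?A mark w \<le> \<tau>" using mle dist by simp
      qed (use st V dist qt in auto)
      moreover have "?N < N" using p(2) Ae V by (simp add: N e)
      ultimately show ?thesis unfolding run by auto
    next
      case False
      then have skip: "e \<in> F \<Longrightarrow> E e \<in> - {z} \<Longrightarrow> E e \<in> set qs"
        using mk[of "E e"] mle[of "E e"] by auto
      note p = sinv_skip[OF si' skip]
      let ?N = "smeas T m qs (V 12) (A nxt e) + 1"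
      have less: "?N < N" using p(2) Ae V by (simp add: N e)
      \<comment> \<open>An arc is skipped if it is absent, leads to \<open>z\<close> or leads to a
        marked node. The three cases differ only in temporaries and in the ticks spent.\<close>
      have fin: ?thesis
        if run: "\<And>Q. wp xs (search_body fir nxt en mark st) Q k V A = Q k' V' A" and k': "k' \<le> k + 20"
          and V': "V' 12 = V 12" "V' 13 = V 13" "V' 14 = A nxt e" "V' 11 = 1" "V' st = \<tau>"
          "search_frame mark st V0 A0 V' A" for k' V'
      proof -
        have "search_inv T E m F z x mark st \<tau> V0 A0 ?N V' A"
          unfolding search_inv_def
        proof (intro conjI exI[of _ qs])
          show "sinv T E m F (- {z}) x qs (V' 12) (V' 14)" using p(1) Ae(1) V' by simp
        qed (use V' mle qt qs mk in auto)
        then show ?thesis unfolding run using k' less by auto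
      qed
      show ?thesis
      proof (cases "e \<in> F")
        case False
        then have alive: "A 2 e = 0" using Ae by simp
        show ?thesis
        proof (rule fin)
          show "wp xs (search_body fir nxt en mark st) Q k V A =
            Q (Suc (Suc (Suc (Suc (Suc k))))) (V(19 := e, 9 := 0, 14 := A nxt e)) A" for Q
            using alive e V(1) dist unfolding search_body_def by simp
        qed (use fr V st dist in \<open>simp_all add: search_frame_def\<close>)
      next
        case F: True
        then have alive: "A 2 e \<noteq> 0" using Ae by blast
        let ?V = "V(19 := e, 9 := A 2 e, 18 := E e, 9 := E e - z, 10 := z - E e, 9 := ?d,
          10 := A mark (E e), 10 := \<tau> - A mark (E e), 14 := A nxt e)"
        show ?thesis
        proof (cases "?d = 0")
          case True
          show ?thesis
          proof (rule fin)
            show "wp xs (search_body fir nxt en mark st) Q k V A = Q (Suc (Suc (Suc (Suc (Suc (Suc (Suc (Suc (Suc (Suc (Suc (Suc k)))))))))))) ?V A" for Q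
              using True alive e V(1,2) st Ae(2) dist unfolding search_body_def by simp
          qed (use fr V st dist in \<open>simp_all add: search_frame_def\<close>)
        next
          case d: False
          then have "\<tau> - A mark (E e) = 0" using False F by blast
          show ?thesis
          proof (rule fin)
            show "wp xs (search_body fir nxt en mark st) Q k V A = Q (Suc (Suc (Suc (Suc (Suc (Suc (Suc (Suc (Suc (Suc (Suc (Suc (Suc k))))))))))))) ?V A" for Q
              using d \<open>\<tau> - A mark (E e) = 0\<close> alive e V(1,2) st Ae(2) dist
              unfolding search_body_def by simp
          qed (use fr V st dist in \<open>simp_all add: search_frame_def\<close>)
        qed
      qed
    qed
  qed
qed

lemma wp_search:
  assumes lists: "\<And>x. A fir x = ptr (adj T m 0 x)" "\<And>e. e < m \<Longrightarrow> A nxt e = ptr (adj T m (Suc e) (T e))"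
      "\<And>e. e < m \<Longrightarrow> A en e = E e"
    and F: "F = {e. e < m \<and> A 2 e \<noteq> 0}" and one: "V 5 = 1"
    and dist: "mark \<notin> {2, 9, fir, nxt, en}" "9 \<notin> {fir, nxt, en}"
      "st \<notin> {5, 7, 9, 10, 11, 12, 13, 14, 18, 19}" "sv \<notin> {9, 10, 11, 12, 13, 14, 18, 19, st}"
    and mark: "\<And>w. A mark w \<le> V st"
    and Q: "\<And>k' V' A'. k' \<le> k + 100 * Suc m \<Longrightarrow> search_frame mark st V A V' A' \<Longrightarrow>
      V' st = Suc (V st) \<Longrightarrow> (\<And>w. A' mark w \<le> Suc (V st)) \<Longrightarrow>
      (\<And>w. A' mark w = Suc (V st) \<longleftrightarrow> arc_ends.conn T E F (- {V 7}) (V sv) w) \<Longrightarrow> Q k' V' A'"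
  shows "wp xs (search sv fir nxt en mark st) Q k V A"
proof -
  interpret arc_ends T E .
  let ?\<tau> = "Suc (V st)"
  let ?z = "V 7" and ?x = "V sv"
  \<comment> \<open>The initial measure is at most \<open>2 * m + 2\<close>: two for each arc, one
    queue entry and the flag. With 21 ticks per iteration this stays below
    \<open>100 * Suc m\<close>.\<close>
  have loop: "wp xs (While 11 (search_body fir nxt en mark st)) Q k1 V1 A1"
    if inv: "search_inv T E m F ?z ?x mark st ?\<tau> V A N V1 A1" and N: "N \<le> 2 * m + 2" and k1: "k1 \<le> k + 12"
    for k1 V1 A1 N
  proof (rule wp_While[where I = "search_inv T E m F ?z ?x mark st ?\<tau> V A" and B = 20, OF inv])
    fix k n V' A'
    assume "search_inv T E m F ?z ?x mark st ?\<tau> V A n V' A'" "V' 11 \<noteq> 0"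
    then show "wp xs (search_body fir nxt en mark st)
        (\<lambda>k' V'' A''. k' \<le> k + 20 \<and> (\<exists>n'<n. search_inv T E m F ?z ?x mark st ?\<tau> V A n' V'' A'')) k V' A'"
      using dist by (intro wp_search_body lists F one refl) auto
  next
    fix k' n' V' A'
    assume inv': "search_inv T E m F ?z ?x mark st ?\<tau> V A n' V' A'" and "V' 11 = 0"
      and k': "k' \<le> k1 + Suc 20 * N + 1"
    then obtain qs where fr: "search_frame mark st V A V' A'" "V' st = ?\<tau>" "\<forall>w. A' mark w \<le> ?\<tau>"
      and qs: "sinv T E m F (- {?z}) ?x qs (length qs) 0" "\<forall>w. A' mark w = ?\<tau> \<longleftrightarrow> w \<in> set qs"
      unfolding search_inv_def by force
    have "F \<subseteq> {..<m}" using F by auto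
    then have "set qs = {w. conn F (- {?z}) ?x w}" by (rule sinv_end[OF qs(1)])
    moreover have "k' \<le> k + 100 * Suc m"
      using k' k1 mult_le_mono2[OF N, of "Suc 20"] by simp
    ultimately show "Q k' V' A'" using Q fr qs(2) by simp
  qed
  \<comment> \<open>Raising the stamp by one unmarks all nodes at once.\<close>
  have fresh: "A mark w \<noteq> ?\<tau>" "A mark w \<le> ?\<tau>" for w using mark[of w] by auto
  have dist': "nxt \<noteq> mark" "fir \<noteq> mark" "en \<noteq> mark" "9 \<noteq> mark" "2 \<noteq> mark" "st \<noteq> sv"
    using dist by auto
  show ?thesis
  proof (cases "?x - ?z + (?z - ?x) = 0")
    \<comment> \<open>A search that starts in the node to be avoided reaches nothing; its queue
      stays empty.\<close>
    case True
    let ?V = "V(st := ?\<tau>, 12 := 0, 13 := 0, 9 := ?x - ?z, 10 := ?z - ?x, 9 := 0, 14 := 0, 11 := 1)"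
    have "search_inv T E m F ?z ?x mark st ?\<tau> V A (smeas T m [] 0 0 + 1) ?V A"
      unfolding search_inv_def
    proof (intro conjI exI[of _ "[]"])
      show "search_frame mark st V A ?V A" by (simp add: search_frame_def)
      show "sinv T E m F (- {?z}) ?x [] (?V 12) (?V 14)"
        using sinv_start[of "[]" ?x "- {?z}"] True dist by auto
    qed (use dist dist' fresh in auto)
    moreover have "smeas T m [] 0 0 + 1 \<le> 2 * m + 2" using smeas_start[of T m "[]"] by simp
    ultimately show ?thesis
      using True one dist dist' loop unfolding search_def by simp
  next
    case False
    let ?V = "V(st := ?\<tau>, 12 := 0, 13 := 0, 9 := ?x - ?z, 10 := ?z - ?x, 9 := ?x - ?z + (?z - ?x),
      13 := 1, 14 := 0, 11 := 1)"
    let ?A = "A(mark := (A mark)(?x := ?\<tau>), 9 := (A 9)(0 := ?x))"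
    have "search_inv T E m F ?z ?x mark st ?\<tau> V A (smeas T m [?x] 0 0 + 1) ?V ?A"
      unfolding search_inv_def
    proof (intro conjI exI[of _ "[?x]"])
      show "search_frame mark st V A ?V ?A" by (simp add: search_frame_def)
      show "sinv T E m F (- {?z}) ?x [?x] (?V 12) (?V 14)"
        using sinv_start[of "[?x]" ?x "- {?z}"] False dist by auto
    qed (use dist dist' fresh in auto)
    moreover have "smeas T m [?x] 0 0 + 1 \<le> 2 * m + 2" using smeas_start[of T m "[?x]"] by simp
    ultimately show ?thesis
      using False one dist dist' loop unfolding search_def by simp
  qed
qed

text \<open>Backward search is forward search with tails and heads exchanged.\<close>

lemma conn_reverse:
  fixes T E :: "'b \<Rightarrow> 'a"
  shows "arc_ends.conn E T F S y x \<longleftrightarrow> arc_ends.conn T E F S x y"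
proof -
  have *: "arc_ends.conn E T F S y x" if "arc_ends.conn T E F S x y" for T E :: "'b \<Rightarrow> 'a" and x y
  proof -
    interpret f: arc_ends T E .
    interpret b: arc_ends E T .
    show ?thesis
      using that by (induction rule: f.conn.induct) (auto intro: b.conn_refl b.conn_Cons)
  qed
  show ?thesis using * by blast
qed

section \<open>The decision program\<close>

text \<open>Counters run down because the machine tests for zero; a counter value
  \<open>Suc i\<close> stands for index \<open>i\<close>.\<close>

lemma wp_for:
  assumes start: "V x = i" "I i V A"
    and body: "\<And>k i V A. I (Suc i) V A \<Longrightarrow> V x = Suc i \<Longrightarrow>
      wp xs c (\<lambda>k' V' A'. k' \<le> k + B \<and> V' x = i \<and> I i V' A') k V A"
    and exit: "\<And>k' V' A'. I 0 V' A' \<Longrightarrow> k' \<le> k + Suc B * i + 1 \<Longrightarrow> Q k' V' A'"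
  shows "wp xs (While x c) Q k V A"
proof (rule wp_While[where I = "\<lambda>n V A. V x = n \<and> I n V A" and n = i and B = B])
  show "V x = i \<and> I i V A" using start by simp
next
  fix k n V A assume *: "V x = n \<and> I n V A" "V x \<noteq> 0"
  then obtain j where j: "n = Suc j" by (cases n) auto
  show "wp xs c (\<lambda>k' V' A'. k' \<le> k + B \<and> (\<exists>n'<n. V' x = n' \<and> I n' V' A')) k V A"
    by (rule wp_mono[OF body[of j]]) (use * j in auto)
next
  fix k' n' V' A' assume "V' x = n' \<and> I n' V' A'" "V' x = 0" "k' \<le> k + Suc B * i + 1"
  then show "Q k' V' A'" using exit by auto
qed

definition unch where
  "unch X J V0 A0 V A \<longleftrightarrow> (\<forall>x. x \<notin> X \<longrightarrow> V x = V0 x) \<and> (\<forall>j. j \<notin> J \<longrightarrow> A j = A0 j)"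
  for X J :: "nat set" and V0 V :: "nat \<Rightarrow> nat" and A0 A :: "nat \<Rightarrow> nat \<Rightarrow> nat"

lemma unch_refl: "unch X J V A V A"
  by (simp add: unch_def)

text \<open>
  Scalars: 0 answer; 1 to 4 numbers of nodes and arcs, source, target; 5 and 22 the constants 1 and
  0; 6, 8, 21 loop counters; 7 node to avoid; 11 to 14 loop flag, queue head, queue end and
  list cell of the search; 15 and 16 stamps of the latest forward and backward search; 17 the node \<open>u\<close>; 20 and
  23 arcs; 9, 10, 18, 19 temporaries.

  Arrays: 0 tail; 1 head; 2 whether the arc is present; 3 next cell and 4 first cell of the lists of leaving arcs;
  5 and 6 the same for entering arcs; 7 and 8 marks of the forward and backward search; 9 queue;
  10 candidates for the arc that enters \<open>v\<close>. A node counts as marked if its mark equals the current stamp, so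
  marks need no resetting, which would take too long if there are more nodes than arcs.
\<close>

definition load_body :: com where
  "load_body =
     Minus 20 8 5 ;; Plus 9 20 20 ;; Lit 10 4 ;; Plus 9 9 10 ;; Inp 18 9 ;; Plus 9 9 5 ;; Inp 19 9 ;;
     Put 0 20 18 ;; Put 1 20 19 ;; Put 2 20 5 ;;
     Get 9 4 18 ;; Put 3 20 9 ;; Put 4 18 8 ;;
     Get 9 6 19 ;; Put 5 20 9 ;; Put 6 19 8 ;; Minus 8 8 5"

definition both :: com where
  "both = search 3 4 3 1 7 15 ;; search 4 6 5 0 8 16"

definition prune_body :: com where
  "prune_body =
     Minus 20 8 5 ;; Get 18 0 20 ;; Get 9 7 18 ;; Minus 9 15 9 ;;
     Get 19 1 20 ;; Get 10 8 19 ;; Minus 10 16 10 ;;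
     Cond 9 (Cond 10 (Put 2 20 22) Skip) Skip ;; Minus 8 8 5"

definition prune_z :: com where
  "prune_z = Minus 7 21 5 ;; both ;; Plus 8 2 22 ;; While 8 prune_body ;; Minus 21 21 5"

definition prune_round :: com where
  "prune_round = Plus 21 1 22 ;; While 21 prune_z ;; Minus 6 6 5"

text \<open>An arc becomes a candidate if it is present and its head is reachable from
  \<open>u\<close>; later passes only delete candidates.\<close>

definition cand_body :: com where
  "cand_body = Minus 20 8 5 ;; Get 18 1 20 ;; Get 9 7 18 ;; Minus 9 15 9 ;; Get 10 2 20 ;;
     Cond 9 (Lit 10 0) Skip ;; Put 10 20 10 ;; Minus 8 8 5"

definition drop_body :: com where
  "drop_body = Minus 20 8 5 ;; Get 18 1 20 ;; Get 9 7 18 ;; Minus 9 15 9 ;;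
     Cond 9 (Put 10 20 22) Skip ;; Minus 8 8 5"

text \<open>If \<open>u\<close> reaches \<open>t\<close> around \<open>z\<close>, then
  \<open>z\<close> rules out nothing; otherwise it rules out exactly the heads that \<open>s\<close>
  cannot reach around \<open>z\<close>. One pair of searches thus treats all candidates together,
  which saves a factor \<open>m\<close> over testing pairs of arcs.\<close>

definition test_z :: com where
  "test_z = Minus 7 21 5 ;; both ;; Get 10 8 17 ;; Minus 10 16 10 ;;
     Cond 10 (Plus 8 2 22 ;; While 8 drop_body) Skip ;; Minus 21 21 5"

definition found_body :: com where
  "found_body = Minus 20 8 5 ;; Get 9 10 20 ;; Cond 9 (Lit 0 1) Skip ;; Minus 8 8 5"

text \<open>
  Nodes are smaller than scalar 1, so a search that avoids this number avoids nothing.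
\<close>

definition test_arc :: com where
  "test_arc = Get 17 0 23 ;; Plus 7 1 22 ;; search 17 4 3 1 7 15 ;;
     Plus 8 2 22 ;; While 8 cand_body ;;
     Plus 21 1 22 ;; While 21 test_z ;;
     Plus 8 2 22 ;; While 8 found_body"

definition test_body :: com where
  "test_body = Minus 23 6 5 ;; Get 9 2 23 ;; Cond 9 test_arc Skip ;; Minus 6 6 5"

text \<open>Both guards skip with register 0 still 0, which is the answer no; this is right for nets
  without arcs and for \<open>s = t\<close>.\<close>

definition decide :: com where
  "decide =
     Lit 5 1 ;; Inp 1 22 ;; Lit 9 1 ;; Inp 2 9 ;; Lit 9 2 ;; Inp 3 9 ;; Lit 9 3 ;; Inp 4 9 ;;
     Cond 2
       (Minus 9 3 4 ;; Minus 10 4 3 ;; Plus 9 9 10 ;;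
        Cond 9
          (Plus 8 2 22 ;; While 8 load_body ;;
           Plus 6 2 22 ;; While 6 prune_round ;;
           Plus 6 2 22 ;; While 6 test_body)
          Skip)
       Skip"

lemma well_addressed_decide: "well_addressed decide"
  by (simp add: decide_def load_body_def prune_round_def prune_z_def prune_body_def test_body_def
      test_arc_def test_z_def cand_body_def drop_body_def found_body_def both_def search_def search_body_def)

section \<open>Correctness and running time of the decision program\<close>

context numbered_net
begin

abbreviation "n \<equiv> card (verts G)"
abbreviation "m \<equiv> card (arcs G)"

lemma arcs_m: "e \<in> arcs G \<longleftrightarrow> e < m"
  using arcs_numbered by (metis lessThan_iff)

lemma verts_n: "x \<in> verts G \<longleftrightarrow> x < n"
  using verts_numbered by (metis lessThan_iff)

lemma encode_length: "length (encode_net G s t) = 4 + 2 * m"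
  by (simp add: encode_net_def length_concat comp_def sum_list_triv)

lemma concat_pairs_nth: "e < k \<Longrightarrow> concat (map (\<lambda>e. [f e, g e]) [0..<k]) ! (2 * e) = f e \<and>
    concat (map (\<lambda>e. [f e, g e]) [0..<k]) ! Suc (2 * e) = (g e :: nat)"
proof (induction k)
  case (Suc k)
  have len: "length (concat (map (\<lambda>e. [f e, g e]) [0..<k])) = 2 * k"
    by (simp add: length_concat comp_def sum_list_triv)
  show ?case
    using Suc by (cases "e = k") (auto simp: nth_append len)
qed simp

lemma encode_nth:
  "encode_net G s t ! 0 = n" "encode_net G s t ! 1 = m" "encode_net G s t ! 2 = s" "encode_net G s t ! 3 = t"
  "e < m \<Longrightarrow> encode_net G s t ! (e + e + 4) = tail G e"
  "e < m \<Longrightarrow> encode_net G s t ! (e + e + 5) = head G e"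
proof -
  show "encode_net G s t ! 0 = n" "encode_net G s t ! 1 = m" "encode_net G s t ! 2 = s" "encode_net G s t ! 3 = t"
    by (simp_all add: encode_net_def numeral_eq_Suc)
  assume e: "e < m"
  have *: "encode_net G s t ! (4 + i) = concat (map (\<lambda>e. [tail G e, head G e]) [0..<m]) ! i" for i
    by (simp add: encode_net_def nth_append)
  show "encode_net G s t ! (e + e + 4) = tail G e" "encode_net G s t ! (e + e + 5) = head G e"
  proof -
    have "e + e + 4 = 4 + 2 * e" "e + e + 5 = 4 + Suc (2 * e)" by simp_all
    then show "encode_net G s t ! (e + e + 4) = tail G e" "encode_net G s t ! (e + e + 5) = head G e"
      using concat_pairs_nth[OF e, of "tail G" "head G"] by (simp_all only: *)
  qed
qed

definition data where
  "data V A \<longleftrightarrow> V 1 = n \<and> V 2 = m \<and> V 3 = s \<and> V 4 = t \<and> V 5 = 1 \<and> V 22 = 0 \<and>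
     (\<forall>e<m. A 0 e = tail G e) \<and> (\<forall>e<m. A 1 e = head G e) \<and>
     (\<forall>x. A 4 x = ptr (adj (tail G) m 0 x)) \<and> (\<forall>e<m. A 3 e = ptr (adj (tail G) m (Suc e) (tail G e))) \<and>
     (\<forall>x. A 6 x = ptr (adj (head G) m 0 x)) \<and> (\<forall>e<m. A 5 e = ptr (adj (head G) m (Suc e) (head G e)))"
  for V :: "nat \<Rightarrow> nat" and A :: "nat \<Rightarrow> nat \<Rightarrow> nat"

definition marks where
  "marks V A \<longleftrightarrow> (\<forall>w. A 7 w \<le> V 15) \<and> (\<forall>w. A 8 w \<le> V 16)"
  for V :: "nat \<Rightarrow> nat" and A :: "nat \<Rightarrow> nat \<Rightarrow> nat"

definition alive where
  "alive A = {e. e < m \<and> A 2 e \<noteq> 0}" for A :: "nat \<Rightarrow> nat \<Rightarrow> nat"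

lemma data_unch:
  "data V A \<Longrightarrow> unch X J V A V' A' \<Longrightarrow> X \<inter> {1, 2, 3, 4, 5, 22} = {} \<Longrightarrow> J \<inter> {0, 1, 3, 4, 5, 6} = {} \<Longrightarrow> data V' A'"
proof -
  assume d: "data V A" and u: "unch X J V A V' A'" and X: "X \<inter> {1, 2, 3, 4, 5, 22} = {}"
    and J: "J \<inter> {0, 1, 3, 4, 5, 6} = {}"
  have "V' x = V x" if "x \<in> {1, 2, 3, 4, 5, 22}" for x using u X that unfolding unch_def by blast
  moreover have "A' j = A j" if "j \<in> {0, 1, 3, 4, 5, 6}" for j using u J that unfolding unch_def by blast
  ultimately show ?thesis using d by (simp add: data_def)
qed

lemma wp_load:
  assumes V: "V 1 = n" "V 2 = m" "V 3 = s" "V 4 = t" "V 5 = 1" "V 22 = 0" "V 0 = 0" "V 15 = 0" "V 16 = 0" "V 8 = m"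
    and A: "\<And>j i. A j i = 0"
    and Q: "\<And>k' V' A'. k' \<le> k + 18 * m + 1 \<Longrightarrow> data V' A' \<Longrightarrow> marks V' A' \<Longrightarrow> alive A' = arcs G \<Longrightarrow>
      V' 0 = 0 \<Longrightarrow> Q k' V' A'"
  shows "wp (encode_net G s t) (While 8 load_body) Q k V A"
proof -
  define I where "I i V' A' \<longleftrightarrow> unch {8, 9, 10, 18, 19, 20} {0, 1, 2, 3, 4, 5, 6} V A V' A' \<and> i \<le> m \<and>
     (\<forall>e<m. i \<le> e \<longrightarrow> A' 0 e = tail G e \<and> A' 1 e = head G e \<and> A' 2 e = 1 \<and>
        A' 3 e = ptr (adj (tail G) m (Suc e) (tail G e)) \<and> A' 5 e = ptr (adj (head G) m (Suc e) (head G e))) \<and>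
     (\<forall>x. A' 4 x = ptr (adj (tail G) m i x)) \<and> (\<forall>x. A' 6 x = ptr (adj (head G) m i x))"
    for i and V' :: "nat \<Rightarrow> nat" and A' :: "nat \<Rightarrow> nat \<Rightarrow> nat"
  show ?thesis
  proof (rule wp_for[where I = I and i = m and B = 17])
    show "V 8 = m" by fact
    have "adj f m m x = {}" for f x by (auto simp: adj_def)
    then show "I m V A" using A by (simp add: I_def unch_refl ptr_def)
  next
    fix k i V' A' assume I: "I (Suc i) V' A'" and i: "V' 8 = Suc i"
    have im: "i < m" and V5: "V' 5 = 1" using I V by (auto simp: I_def unch_def)
    have len: "i + i + 4 < length (encode_net G s t)" "i + i + 5 < length (encode_net G s t)"
      using im by (simp_all add: encode_length)
    have enc: "encode_net G s t ! (i + i + 4) = tail G i" "encode_net G s t ! (i + i + 5) = head G i"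
      using encode_nth(5,6)[OF im] .
    \<comment> \<open>\<open>Suc i\<close> is both the counter value and the list cell of arc
      \<open>i\<close>; storing it as first cell prepends the arc to the lists of its tail and of
      its head.\<close>
    let ?A = "A'(0 := (A' 0)(i := tail G i), 1 := (A' 1)(i := head G i), 2 := (A' 2)(i := 1),
      3 := (A' 3)(i := A' 4 (tail G i)), 4 := (A' 4)(tail G i := Suc i),
      5 := (A' 5)(i := A' 6 (head G i)), 6 := (A' 6)(head G i := Suc i))"
    have fin: "I i V'' ?A" if "unch {8, 9, 10, 18, 19, 20} {} V' A' V'' A'" for V''
      unfolding I_def
    proof (intro conjI)
      show "unch {8, 9, 10, 18, 19, 20} {0, 1, 2, 3, 4, 5, 6} V A V'' ?A"
        using that I by (simp add: I_def unch_def)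
      show "i \<le> m" using im by simp
      show "\<forall>e<m. i \<le> e \<longrightarrow> ?A 0 e = tail G e \<and> ?A 1 e = head G e \<and> ?A 2 e = 1 \<and>
        ?A 3 e = ptr (adj (tail G) m (Suc e) (tail G e)) \<and> ?A 5 e = ptr (adj (head G) m (Suc e) (head G e))"
        using I by (auto simp: I_def)
      show "\<forall>x. ?A 4 x = ptr (adj (tail G) m i x)" "\<forall>x. ?A 6 x = ptr (adj (head G) m i x)"
        using I by (simp_all add: I_def ptr_adj_Suc[OF im])
    qed
    show "wp (encode_net G s t) load_body (\<lambda>k' V'' A''. k' \<le> k + 17 \<and> V'' 8 = i \<and> I i V'' A'') k V' A'"
    proof -
      have "encode_net G s t ! (2 * i + 4) = tail G i" "encode_net G s t ! (5 + 2 * i) = head G i"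
      proof -
        have i4: "i + i + 4 = 2 * i + 4" and i5: "i + i + 5 = 5 + 2 * i" by simp_all
        show "encode_net G s t ! (2 * i + 4) = tail G i" using enc(1) unfolding i4 .
        show "encode_net G s t ! (5 + 2 * i) = head G i" using enc(2) unfolding i5 .
      qed
      moreover have "I i (V'(20 := i, 10 := 4, 18 := tail G i, 19 := head G i, 9 := A' 6 (head G i), 8 := i)) ?A"
        by (rule fin) (simp add: unch_def)
      ultimately show ?thesis unfolding load_body_def using i V5 len by simp
    qed
  next
    fix k' V' A' assume I: "I 0 V' A'" and k': "k' \<le> k + Suc 17 * m + 1"
    have "data V' A'" using I V by (simp add: I_def unch_def data_def)
    moreover have "marks V' A'" using I V A by (simp add: I_def unch_def marks_def)
    moreover have "alive A' = arcs G" using I by (auto simp: I_def alive_def arcs_m)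
    moreover have "V' 0 = 0" using I V by (simp add: I_def unch_def)
    ultimately show "Q k' V' A'" using Q k' by simp
  qed
qed

lemma wp_search_forward:
  assumes d: "data V A" and mk: "marks V A" and sv: "sv \<in> {3, 17}"
    and Q: "\<And>k' V' A'. k' \<le> k + 100 * Suc m \<Longrightarrow> unch {9, 10, 11, 12, 13, 14, 15, 18, 19} {7, 9} V A V' A' \<Longrightarrow>
      marks V' A' \<Longrightarrow> (\<And>w. V' 15 - A' 7 w = 0 \<longleftrightarrow> ae.conn (alive A) (- {V 7}) (V sv) w) \<Longrightarrow> Q k' V' A'"
  shows "wp xs (search sv 4 3 1 7 15) Q k V A"
proof (rule wp_search[where T = "tail G" and E = "head G" and m = m and F = "alive A"])
  fix k' V' A'
  assume *: "k' \<le> k + 100 * Suc m" "search_frame 7 15 V A V' A'" "V' 15 = Suc (V 15)"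
    "\<And>w. A' 7 w \<le> Suc (V 15)" "\<And>w. (A' 7 w = Suc (V 15)) = ae.conn (alive A) (- {V 7}) (V sv) w"
  show "Q k' V' A'"
  proof (rule Q[OF *(1)])
    show "unch {9, 10, 11, 12, 13, 14, 15, 18, 19} {7, 9} V A V' A'"
      using *(2) by (auto simp: unch_def search_frame_def)
    show "marks V' A'" using * mk by (simp add: marks_def search_frame_def)
    show "V' 15 - A' 7 w = 0 \<longleftrightarrow> ae.conn (alive A) (- {V 7}) (V sv) w" for w
      using *(3) *(4)[of w] *(5)[of w] by auto
  qed
qed (use d mk sv in \<open>auto simp: data_def marks_def alive_def\<close>)

lemma wp_search_backward:
  assumes d: "data V A" and mk: "marks V A"
    and Q: "\<And>k' V' A'. k' \<le> k + 100 * Suc m \<Longrightarrow> unch {9, 10, 11, 12, 13, 14, 16, 18, 19} {8, 9} V A V' A' \<Longrightarrow>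
      marks V' A' \<Longrightarrow> (\<And>w. V' 16 - A' 8 w = 0 \<longleftrightarrow> ae.conn (alive A) (- {V 7}) w t) \<Longrightarrow> Q k' V' A'"
  shows "wp xs (search 4 6 5 0 8 16) Q k V A"
proof (rule wp_search[where T = "head G" and E = "tail G" and m = m and F = "alive A"])
  fix k' V' A'
  assume *: "k' \<le> k + 100 * Suc m" "search_frame 8 16 V A V' A'" "V' 16 = Suc (V 16)"
    "\<And>w. A' 8 w \<le> Suc (V 16)"
    "\<And>w. (A' 8 w = Suc (V 16)) = arc_ends.conn (head G) (tail G) (alive A) (- {V 7}) (V 4) w"
  show "Q k' V' A'"
  proof (rule Q[OF *(1)])
    show "unch {9, 10, 11, 12, 13, 14, 16, 18, 19} {8, 9} V A V' A'"
      using *(2) by (auto simp: unch_def search_frame_def)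
    show "marks V' A'" using * mk by (simp add: marks_def search_frame_def)
    show "V' 16 - A' 8 w = 0 \<longleftrightarrow> ae.conn (alive A) (- {V 7}) w t" for w
      using *(3) *(4)[of w] *(5)[of w] d by (auto simp: data_def conn_reverse)
  qed
qed (use d mk in \<open>auto simp: data_def marks_def alive_def\<close>)

lemma wp_both:
  assumes d: "data V A" and mk: "marks V A" and z: "V 7 = z" and F: "alive A = F"
    and Q: "\<And>k' V' A'. k' \<le> k + 200 * Suc m \<Longrightarrow> unch {9, 10, 11, 12, 13, 14, 15, 16, 18, 19} {7, 8, 9} V A V' A' \<Longrightarrow>
      marks V' A' \<Longrightarrow> data V' A' \<Longrightarrow> alive A' = F \<Longrightarrow>
      (\<And>w. V' 15 - A' 7 w = 0 \<longleftrightarrow> ae.conn F (- {z}) s w) \<Longrightarrow>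
      (\<And>w. V' 16 - A' 8 w = 0 \<longleftrightarrow> ae.conn F (- {z}) w t) \<Longrightarrow> Q k' V' A'"
  shows "wp xs both Q k V A"
  unfolding both_def wp_Seq
proof (rule wp_search_forward[OF d mk])
  fix k1 V1 A1
  assume 1: "k1 \<le> k + 100 * Suc m" "unch {9, 10, 11, 12, 13, 14, 15, 18, 19} {7, 9} V A V1 A1" "marks V1 A1"
    "\<And>w. V1 15 - A1 7 w = 0 \<longleftrightarrow> ae.conn (alive A) (- {V 7}) (V 3) w"
  have d1: "data V1 A1" by (rule data_unch[OF d 1(2)]) auto
  have a1: "alive A1 = alive A" using 1(2) by (simp add: alive_def unch_def)
  show "wp xs (search 4 6 5 0 8 16) Q k1 V1 A1"
  proof (rule wp_search_backward[OF d1 1(3)])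
    fix k2 V2 A2
    assume 2: "k2 \<le> k1 + 100 * Suc m" "unch {9, 10, 11, 12, 13, 14, 16, 18, 19} {8, 9} V1 A1 V2 A2" "marks V2 A2"
      "\<And>w. V2 16 - A2 8 w = 0 \<longleftrightarrow> ae.conn (alive A1) (- {V1 7}) w t"
    have same: "V2 15 = V1 15" "A2 7 = A1 7" "V1 7 = V 7" using 1(2) 2(2) by (simp_all add: unch_def)
    show "Q k2 V2 A2"
    proof (rule Q)
      show "k2 \<le> k + 200 * Suc m" using 1(1) 2(1) by simp
      show "unch {9, 10, 11, 12, 13, 14, 15, 16, 18, 19} {7, 8, 9} V A V2 A2"
        using 1(2) 2(2) by (simp add: unch_def)
      show "data V2 A2" by (rule data_unch[OF d1 2(2)]) auto
      show "alive A2 = F" using 2(2) a1 F by (simp add: alive_def unch_def)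
      show "V2 15 - A2 7 w = 0 \<longleftrightarrow> ae.conn F (- {z}) s w" for w
        using 1(4)[of w] same F z d by (simp add: data_def)
      show "V2 16 - A2 8 w = 0 \<longleftrightarrow> ae.conn F (- {z}) w t" for w
        using 2(4)[of w] same F z a1 by simp
    qed (rule 2(3))
  qed
qed simp

text \<open>The loop clears presence flags but reads marks computed before it started, so all arcs
  are judged by the same arc set, as \<open>prune\<close> demands.\<close>

lemma wp_prune_loop:
  assumes d: "data V A" and V8: "V 8 = m"
    and P: "\<And>w. V 15 - A 7 w = 0 \<longleftrightarrow> P w" and R: "\<And>w. V 16 - A 8 w = 0 \<longleftrightarrow> R w"
    and Q: "\<And>k' V' A'. k' \<le> k + 12 * m + 1 \<Longrightarrow> unch {8, 9, 10, 18, 19, 20} {2} V A V' A' \<Longrightarrow>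
      alive A' = {e \<in> alive A. P (tail G e) \<or> R (head G e)} \<Longrightarrow> Q k' V' A'"
  shows "wp xs (While 8 prune_body) Q k V A"
proof -
  let ?dead = "\<lambda>e. V 15 - A 7 (tail G e) \<noteq> 0 \<and> V 16 - A 8 (head G e) \<noteq> 0"
  define I where "I i V' A' \<longleftrightarrow> unch {8, 9, 10, 18, 19, 20} {2} V A V' A' \<and> i \<le> m \<and>
     (\<forall>e<m. A' 2 e = (if i \<le> e \<and> ?dead e then 0 else A 2 e))"
    for i and V' :: "nat \<Rightarrow> nat" and A' :: "nat \<Rightarrow> nat \<Rightarrow> nat"
  show ?thesis
  proof (rule wp_for[where I = I and i = m and B = 11])
    show "V 8 = m" by fact
    show "I m V A" by (simp add: I_def unch_refl)
  next
    fix k i V' A' assume I: "I (Suc i) V' A'" and i: "V' 8 = Suc i"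
    have im: "i < m" using I by (simp add: I_def)
    have r: "V' 5 = 1" "V' 22 = 0" "V' 15 = V 15" "V' 16 = V 16" "A' 0 i = tail G i" "A' 1 i = head G i"
      "A' 7 = A 7" "A' 8 = A 8"
      using I d im by (simp_all add: I_def unch_def data_def)
    have fin: "I i V'' A''" if "unch {8, 9, 10, 18, 19, 20} {} V' A' V'' A'"
      "A'' = (if ?dead i then A'(2 := (A' 2)(i := 0)) else A')" for V'' A''
      unfolding I_def
    proof (intro conjI)
      show "unch {8, 9, 10, 18, 19, 20} {2} V A V'' A''"
        using that I by (simp add: I_def unch_def)
      show "i \<le> m" using im by simp
      have e: "i \<le> e \<longleftrightarrow> e = i \<or> Suc i \<le> e" for e by auto
      show "\<forall>e<m. A'' 2 e = (if i \<le> e \<and> ?dead e then 0 else A 2 e)"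
        using I that(2) unfolding I_def e by auto
    qed
    let ?V = "V'(20 := i, 18 := tail G i, 9 := V 15 - A 7 (tail G i), 19 := head G i,
      10 := V 16 - A 8 (head G i), 8 := i)"
    have f: "I i ?V (if ?dead i then A'(2 := (A' 2)(i := 0)) else A')" by (rule fin) (simp_all add: unch_def)
    show "wp xs prune_body (\<lambda>k' V'' A''. k' \<le> k + 11 \<and> V'' 8 = i \<and> I i V'' A'') k V' A'"
    proof (cases "?dead i")
      case True then show ?thesis unfolding prune_body_def using i r f by simp
    next
      case False then show ?thesis unfolding prune_body_def using i r f by auto
    qed
  next
    fix k' V' A' assume I: "I 0 V' A'" and k': "k' \<le> k + Suc 11 * m + 1"
    have "alive A' = {e \<in> alive A. P (tail G e) \<or> R (head G e)}"
      using I unfolding alive_def P[symmetric] R[symmetric] I_def by (auto split: if_splits)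
    then show "Q k' V' A'" using Q k' I by (simp add: I_def)
  qed
qed

lemma alive_prune:
  "alive A = F \<Longrightarrow> {e \<in> alive A. ae.conn F (- {z}) s (tail G e) \<or> ae.conn F (- {z}) (head G e) t} = prune z F"
  by (simp add: prune_def)

lemma wp_prune_z:
  assumes d: "data V A" and mk: "marks V A" and i: "V 21 = Suc i"
    and Q: "\<And>k' V' A'. k' \<le> k + 220 * Suc m \<Longrightarrow> V' 21 = i \<Longrightarrow>
      unch {7, 8, 9, 10, 11, 12, 13, 14, 15, 16, 18, 19, 20, 21} {2, 7, 8, 9} V A V' A' \<Longrightarrow>
      marks V' A' \<Longrightarrow> data V' A' \<Longrightarrow> alive A' = prune i (alive A) \<Longrightarrow> Q k' V' A'"
  shows "wp xs prune_z Q k V A"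
proof -
  have V5: "V 5 = 1" using d by (simp add: data_def)
  have d0: "data (V(7 := i)) A" by (rule data_unch[OF d, of "{7}" "{}"]) (auto simp: unch_def)
  have mk0: "marks (V(7 := i)) A" using mk by (simp add: marks_def)
  have "wp xs both (wp xs (Plus 8 2 22) (wp xs (While 8 prune_body) (wp xs (Minus 21 21 5) Q)))
    (Suc k) (V(7 := i)) A"
  proof (rule wp_both[OF d0 mk0 _ refl])
    show "(V(7 := i)) 7 = i" by simp
  next
    fix k1 V1 A1
    assume 1: "k1 \<le> Suc k + 200 * Suc m"
      "unch {9, 10, 11, 12, 13, 14, 15, 16, 18, 19} {7, 8, 9} (V(7 := i)) A V1 A1"
      "marks V1 A1" "data V1 A1" "alive A1 = alive A"
      "\<And>w. (V1 15 - A1 7 w = 0) = ae.conn (alive A) (- {i}) s w"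
      "\<And>w. (V1 16 - A1 8 w = 0) = ae.conn (alive A) (- {i}) w t"
    have V2: "V1 2 = m" "V1 22 = 0" using 1(4) by (simp_all add: data_def)
    have d2: "data (V1(8 := m)) A1" by (rule data_unch[OF 1(4), of "{8}" "{}"]) (auto simp: unch_def)
    have "wp xs (While 8 prune_body) (wp xs (Minus 21 21 5) Q) (Suc k1) (V1(8 := m)) A1"
    proof (rule wp_prune_loop[OF d2, where P = "ae.conn (alive A) (- {i}) s" and
          R = "\<lambda>w. ae.conn (alive A) (- {i}) w t"])
      fix k3 V3 A3
      assume 3: "k3 \<le> Suc k1 + 12 * m + 1" "unch {8, 9, 10, 18, 19, 20} {2} (V1(8 := m)) A1 V3 A3"
        "alive A3 = {e \<in> alive A1. ae.conn (alive A) (- {i}) s (tail G e) \<or> ae.conn (alive A) (- {i}) (head G e) t}"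
      have V3: "V3 21 = Suc i" "V3 5 = 1" using 3(2) 1(2) i V5 by (simp_all add: unch_def)
      have u: "unch {7, 8, 9, 10, 11, 12, 13, 14, 15, 16, 18, 19, 20, 21} {2, 7, 8, 9} V A (V3(21 := i)) A3"
        using 3(2) 1(2) by (simp add: unch_def)
      have "Q (Suc k3) (V3(21 := i)) A3"
      proof (rule Q[OF _ _ u])
        show "marks (V3(21 := i)) A3" using 1(3) 3(2) by (simp add: marks_def unch_def)
        show "data (V3(21 := i)) A3" by (rule data_unch[OF d u]) auto
        show "alive A3 = prune i (alive A)" unfolding 3(3) 1(5) by (rule alive_prune) (rule refl)
      qed (use 1(1) 3(1) in auto)
      then show "wp xs (Minus 21 21 5) Q k3 V3 A3" using V3 by simp
    qed (use 1 in simp_all)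
    then show "wp xs (Plus 8 2 22) (wp xs (While 8 prune_body) (wp xs (Minus 21 21 5) Q)) k1 V1 A1"
      using V2 by simp
  qed
  then show ?thesis unfolding prune_z_def using i V5 by simp
qed

lemma rev_upt_Suc: "i < j \<Longrightarrow> rev [i..<j] = rev [Suc i..<j] @ [i]"
  by (simp add: upt_conv_Cons)

text \<open>The counter runs down, so the nodes are treated in the order
  \<open>rev [0..<n]\<close>.\<close>

lemma wp_prune_round:
  assumes d: "data V A" and mk: "marks V A" and i: "V 6 = Suc i"
    and Q: "\<And>k' V' A'. k' \<le> k + 225 * Suc m * n \<Longrightarrow> V' 6 = i \<Longrightarrow> V' 0 = V 0 \<Longrightarrow>
      marks V' A' \<Longrightarrow> data V' A' \<Longrightarrow> alive A' = prune_all (rev [0..<n]) (alive A) \<Longrightarrow> Q k' V' A'"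
  shows "wp xs prune_round Q k V A"
proof -
  define I where "I j V' A' \<longleftrightarrow> V' 6 = Suc i \<and> V' 0 = V 0 \<and> marks V' A' \<and> data V' A' \<and> j \<le> n \<and>
      alive A' = prune_all (rev [j..<n]) (alive A)"
    for j and V' :: "nat \<Rightarrow> nat" and A' :: "nat \<Rightarrow> nat \<Rightarrow> nat"
  have V: "V 1 = n" "V 22 = 0" using d by (simp_all add: data_def)
  \<comment> \<open>\<open>s\<close> is a node, so \<open>n\<close> is positive and the product
    \<open>Suc m * n\<close> absorbs additive constants.\<close>
  have n0: "1 \<le> n" using source_in_verts verts_n by fastforce
  have "wp xs (While 21 prune_z) (wp xs (Minus 6 6 5) Q) (Suc k) (V(21 := n)) A"
  proof (rule wp_for[where I = I and i = n and B = "220 * Suc m"])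
    show "(V(21 := n)) 21 = n" by simp
    have "data (V(21 := n)) A" by (rule data_unch[OF d, of "{21}" "{}"]) (auto simp: unch_def)
    then show "I n (V(21 := n)) A" using mk i by (simp add: I_def marks_def prune_all_def)
  next
    fix k j V' A' assume I: "I (Suc j) V' A'" and j: "V' 21 = Suc j"
    show "wp xs prune_z (\<lambda>k' V'' A''. k' \<le> k + 220 * Suc m \<and> V'' 21 = j \<and> I j V'' A'') k V' A'"
    proof (rule wp_prune_z[where V = V' and A = A' and i = j])
      show "V' 21 = Suc j" by fact
      show "data V' A'" "marks V' A'" using I by (simp_all add: I_def)
      fix k2 V2 A2
      assume 2: "k2 \<le> k + 220 * Suc m" "V2 21 = j"
        "unch {7, 8, 9, 10, 11, 12, 13, 14, 15, 16, 18, 19, 20, 21} {2, 7, 8, 9} V' A' V2 A2"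
        "marks V2 A2" "data V2 A2" "alive A2 = prune j (alive A')"
      have "j < n" using I by (simp add: I_def)
      then have "alive A2 = prune_all (rev [j..<n]) (alive A)"
        using 2(6) I rev_upt_Suc[of j n] by (simp add: I_def prune_all_def)
      moreover have "V2 6 = Suc i" "V2 0 = V 0" using 2(3) I by (simp_all add: I_def unch_def)
      ultimately show "k2 \<le> k + 220 * Suc m \<and> V2 21 = j \<and> I j V2 A2"
        using 2 \<open>j < n\<close> by (simp add: I_def)
    qed
  next
    fix k' V' A' assume I: "I 0 V' A'" and k': "k' \<le> Suc k + Suc (220 * Suc m) * n + 1"
    have V': "V' 6 = Suc i" "V' 5 = 1" using I by (simp_all add: I_def data_def)
    have "Q (Suc k') (V'(6 := i)) A'"
    proof (rule Q)
      have "n * 3 \<le> 3 * (Suc m * n)" by simp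
      then show "Suc k' \<le> k + 225 * Suc m * n" using k' n0 by (simp add: algebra_simps)
      show "data (V'(6 := i)) A'" by (rule data_unch[of V' A' "{6}" "{}"]) (use I in \<open>auto simp: unch_def I_def\<close>)
    qed (use I in \<open>simp_all add: I_def marks_def\<close>)
    then show "wp xs (Minus 6 6 5) Q k' V' A'" using V' by simp
  qed
  then show ?thesis unfolding prune_round_def using V by simp
qed

lemma wp_prune:
  assumes d: "data V A" and mk: "marks V A" and V: "V 6 = m" "V 0 = 0" and a: "alive A = arcs G"
    and Q: "\<And>k' V' A'. k' \<le> k + Suc (225 * Suc m * n) * m + 1 \<Longrightarrow> V' 0 = 0 \<Longrightarrow>
      marks V' A' \<Longrightarrow> data V' A' \<Longrightarrow> alive A' = core (rev [0..<n]) \<Longrightarrow> Q k' V' A'"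
  shows "wp xs (While 6 prune_round) Q k V A"
proof -
  define I where "I j V' A' \<longleftrightarrow> V' 0 = 0 \<and> marks V' A' \<and> data V' A' \<and> j \<le> m \<and>
      alive A' = (prune_all (rev [0..<n]) ^^ (m - j)) (arcs G)"
    for j and V' :: "nat \<Rightarrow> nat" and A' :: "nat \<Rightarrow> nat \<Rightarrow> nat"
  show ?thesis
  proof (rule wp_for[where I = I and i = m and B = "225 * Suc m * n"])
    show "V 6 = m" by fact
    show "I m V A" using assms by (simp add: I_def)
  next
    fix k j V' A' assume I: "I (Suc j) V' A'" and j: "V' 6 = Suc j"
    show "wp xs prune_round (\<lambda>k' V'' A''. k' \<le> k + 225 * Suc m * n \<and> V'' 6 = j \<and> I j V'' A'') k V' A'"
    proof (rule wp_prune_round[where V = V' and A = A' and i = j])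
      show "V' 6 = Suc j" by fact
      show "data V' A'" "marks V' A'" using I by (simp_all add: I_def)
      fix k2 V2 A2
      assume 2: "k2 \<le> k + 225 * Suc m * n" "V2 6 = j" "V2 0 = V' 0" "marks V2 A2" "data V2 A2"
        "alive A2 = prune_all (rev [0..<n]) (alive A')"
      have "j < m" using I by (simp add: I_def Suc_le_eq)
      then have "m - j = Suc (m - Suc j)" by (simp add: Suc_diff_Suc)
      then show "k2 \<le> k + 225 * Suc m * n \<and> V2 6 = j \<and> I j V2 A2"
        using 2 I by (simp add: I_def)
    qed
  next
    fix k' V' A' assume "I 0 V' A'" "k' \<le> k + Suc (225 * Suc m * n) * m + 1"
    then show "Q k' V' A'" using Q by (simp add: I_def core_def)
  qed
qed

lemma wp_cand_loop:
  assumes d: "data V A" and V8: "V 8 = m" and F: "alive A = F"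
    and P: "\<And>w. V 15 - A 7 w = 0 \<longleftrightarrow> P w"
    and Q: "\<And>k' V' A'. k' \<le> k + 12 * m + 1 \<Longrightarrow> unch {8, 9, 10, 18, 20} {10} V A V' A' \<Longrightarrow>
      (\<And>e. e < m \<Longrightarrow> A' 10 e \<noteq> 0 \<longleftrightarrow> e \<in> F \<and> P (head G e)) \<Longrightarrow> Q k' V' A'"
  shows "wp xs (While 8 cand_body) Q k V A"
proof -
  define I where "I i V' A' \<longleftrightarrow> unch {8, 9, 10, 18, 20} {10} V A V' A' \<and> i \<le> m \<and>
     (\<forall>e<m. i \<le> e \<longrightarrow> (A' 10 e \<noteq> 0 \<longleftrightarrow> A 2 e \<noteq> 0 \<and> V 15 - A 7 (head G e) = 0))"
    for i and V' :: "nat \<Rightarrow> nat" and A' :: "nat \<Rightarrow> nat \<Rightarrow> nat"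
  show ?thesis
  proof (rule wp_for[where I = I and i = m and B = 11])
    show "V 8 = m" by fact
    show "I m V A" by (simp add: I_def unch_refl)
  next
    fix k i V' A' assume I: "I (Suc i) V' A'" and i: "V' 8 = Suc i"
    have im: "i < m" using I by (simp add: I_def)
    have r: "V' 5 = 1" "V' 15 = V 15" "A' 1 i = head G i" "A' 7 = A 7" "A' 2 = A 2"
      using I d im by (simp_all add: I_def unch_def data_def)
    let ?d = "V 15 - A 7 (head G i)"
    have fin: "I i V'' (A'(10 := (A' 10)(i := (if ?d \<noteq> 0 then 0 else A 2 i))))"
      if "unch {8, 9, 10, 18, 20} {} V' A' V'' A'" for V''
      unfolding I_def
    proof (intro conjI)
      show "unch {8, 9, 10, 18, 20} {10} V A V'' (A'(10 := (A' 10)(i := (if ?d \<noteq> 0 then 0 else A 2 i))))"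
        using that I by (simp add: I_def unch_def)
      show "i \<le> m" using im by simp
      have e: "i \<le> e \<longleftrightarrow> e = i \<or> Suc i \<le> e" for e by auto
      show "\<forall>e<m. i \<le> e \<longrightarrow> ((A'(10 := (A' 10)(i := (if ?d \<noteq> 0 then 0 else A 2 i)))) 10 e \<noteq> 0 \<longleftrightarrow>
          A 2 e \<noteq> 0 \<and> V 15 - A 7 (head G e) = 0)"
        using I unfolding I_def e by auto
    qed
    show "wp xs cand_body (\<lambda>k' V'' A''. k' \<le> k + 11 \<and> V'' 8 = i \<and> I i V'' A'') k V' A'"
    proof (cases "?d = 0")
      case True
      have "I i (V'(20 := i, 18 := head G i, 9 := 0, 10 := A 2 i, 8 := i)) (A'(10 := (A' 10)(i := A 2 i)))"
        using fin[of "V'(20 := i, 18 := head G i, 9 := 0, 10 := A 2 i, 8 := i)"] True by (simp add: unch_def)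
      then show ?thesis unfolding cand_body_def using i r True by simp
    next
      case False
      have "I i (V'(20 := i, 18 := head G i, 9 := ?d, 10 := 0, 8 := i)) (A'(10 := (A' 10)(i := 0)))"
        using fin[of "V'(20 := i, 18 := head G i, 9 := ?d, 10 := 0, 8 := i)"] False by (simp add: unch_def)
      then show ?thesis unfolding cand_body_def using i r False by simp
    qed
  next
    fix k' V' A' assume I: "I 0 V' A'" and k': "k' \<le> k + Suc 11 * m + 1"
    have "A' 10 e \<noteq> 0 \<longleftrightarrow> e \<in> F \<and> P (head G e)" if "e < m" for e
      using I that unfolding F[symmetric] alive_def P[symmetric] I_def by simp
    then show "Q k' V' A'" using Q k' I by (simp add: I_def)
  qed
qed

lemma wp_drop_loop:
  assumes d: "data V A" and V8: "V 8 = m"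
    and P: "\<And>w. V 15 - A 7 w = 0 \<longleftrightarrow> P w"
    and Q: "\<And>k' V' A'. k' \<le> k + 12 * m + 1 \<Longrightarrow> unch {8, 9, 10, 18, 20} {10} V A V' A' \<Longrightarrow>
      (\<And>e. e < m \<Longrightarrow> A' 10 e \<noteq> 0 \<longleftrightarrow> A 10 e \<noteq> 0 \<and> P (head G e)) \<Longrightarrow> Q k' V' A'"
  shows "wp xs (While 8 drop_body) Q k V A"
proof -
  define I where "I i V' A' \<longleftrightarrow> unch {8, 9, 10, 18, 20} {10} V A V' A' \<and> i \<le> m \<and>
     (\<forall>e<m. A' 10 e = (if i \<le> e \<and> V 15 - A 7 (head G e) \<noteq> 0 then 0 else A 10 e))"
    for i and V' :: "nat \<Rightarrow> nat" and A' :: "nat \<Rightarrow> nat \<Rightarrow> nat"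
  show ?thesis
  proof (rule wp_for[where I = I and i = m and B = 11])
    show "V 8 = m" by fact
    show "I m V A" by (simp add: I_def unch_refl)
  next
    fix k i V' A' assume I: "I (Suc i) V' A'" and i: "V' 8 = Suc i"
    have im: "i < m" using I by (simp add: I_def)
    have r: "V' 5 = 1" "V' 22 = 0" "V' 15 = V 15" "A' 1 i = head G i" "A' 7 = A 7"
      using I d im by (simp_all add: I_def unch_def data_def)
    let ?d = "V 15 - A 7 (head G i)"
    let ?V = "V'(20 := i, 18 := head G i, 9 := ?d, 8 := i)"
    have fin: "I i ?V A''" if "A'' = (if ?d \<noteq> 0 then A'(10 := (A' 10)(i := 0)) else A')" for A''
      unfolding I_def
    proof (intro conjI)
      show "unch {8, 9, 10, 18, 20} {10} V A ?V A''" using that I by (simp add: I_def unch_def)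
      show "i \<le> m" using im by simp
      have e: "i \<le> e \<longleftrightarrow> e = i \<or> Suc i \<le> e" for e by auto
      show "\<forall>e<m. A'' 10 e = (if i \<le> e \<and> V 15 - A 7 (head G e) \<noteq> 0 then 0 else A 10 e)"
        using I that unfolding I_def e by auto
    qed
    show "wp xs drop_body (\<lambda>k' V'' A''. k' \<le> k + 11 \<and> V'' 8 = i \<and> I i V'' A'') k V' A'"
    proof (cases "?d = 0")
      case True
      have "I i ?V A'" by (rule fin) (use True in simp)
      then show ?thesis unfolding drop_body_def using i r True by simp
    next
      case False
      have "I i ?V (A'(10 := (A' 10)(i := 0)))" by (rule fin) (use False in simp)
      then show ?thesis unfolding drop_body_def using i r False by simp
    qed
  next
    fix k' V' A' assume I: "I 0 V' A'" and k': "k' \<le> k + Suc 11 * m + 1"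
    have "A' 10 e \<noteq> 0 \<longleftrightarrow> A 10 e \<noteq> 0 \<and> P (head G e)" if "e < m" for e
      using I that unfolding P[symmetric] I_def by simp
    then show "Q k' V' A'" using Q k' I by (simp add: I_def)
  qed
qed

lemma wp_found_loop:
  assumes d: "data V A" and V8: "V 8 = m" and b: "V 0 = of_bool b"
    and Q: "\<And>k' V' A'. k' \<le> k + 12 * m + 1 \<Longrightarrow> unch {0, 8, 9, 20} {} V A V' A' \<Longrightarrow>
      V' 0 = of_bool (b \<or> (\<exists>e<m. A 10 e \<noteq> 0)) \<Longrightarrow> Q k' V' A'"
  shows "wp xs (While 8 found_body) Q k V A"
proof -
  define I where "I i V' A' \<longleftrightarrow> unch {0, 8, 9, 20} {} V A V' A' \<and> i \<le> m \<and>
     V' 0 = of_bool (b \<or> (\<exists>e<m. i \<le> e \<and> A 10 e \<noteq> 0))"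
    for i and V' :: "nat \<Rightarrow> nat" and A' :: "nat \<Rightarrow> nat \<Rightarrow> nat"
  show ?thesis
  proof (rule wp_for[where I = I and i = m and B = 11])
    show "V 8 = m" by fact
    have "\<not> (\<exists>e<m. m \<le> e \<and> A 10 e \<noteq> 0)" by auto
    then show "I m V A" by (simp add: I_def unch_refl b)
  next
    fix k i V' A' assume I: "I (Suc i) V' A'" and i: "V' 8 = Suc i"
    have im: "i < m" using I by (simp add: I_def)
    have r: "V' 5 = 1" "A' 10 = A 10"
      using I d im by (simp_all add: I_def unch_def data_def)
    have e: "i \<le> e \<longleftrightarrow> e = i \<or> Suc i \<le> e" for e by auto
    have ex: "(\<exists>e<m. i \<le> e \<and> A 10 e \<noteq> 0) \<longleftrightarrow> A 10 i \<noteq> 0 \<or> (\<exists>e<m. Suc i \<le> e \<and> A 10 e \<noteq> 0)"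
      unfolding e using im by blast
    show "wp xs found_body (\<lambda>k' V'' A''. k' \<le> k + 11 \<and> V'' 8 = i \<and> I i V'' A'') k V' A'"
    proof (cases "A 10 i = 0")
      case True
      have "I i (V'(20 := i, 9 := 0, 8 := i)) A'"
        using I im True unfolding I_def ex by (simp add: unch_def)
      then show ?thesis unfolding found_body_def using i r True by simp
    next
      case False
      have "I i (V'(20 := i, 9 := A 10 i, 0 := 1, 8 := i)) A'"
        using I im False unfolding I_def ex by (simp add: unch_def)
      then show ?thesis unfolding found_body_def using i r False by simp
    qed
  next
    fix k' V' A' assume I: "I 0 V' A'" and k': "k' \<le> k + Suc 11 * m + 1"
    then show "Q k' V' A'" using Q by (simp add: I_def)
  qed
qed

lemma wp_test_z:
  assumes d: "data V A" and mk: "marks V A" and i: "V 21 = Suc i" and F: "alive A = F"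
    and Q: "\<And>k' V' A'. k' \<le> k + 220 * Suc m \<Longrightarrow> V' 21 = i \<Longrightarrow>
      unch {7, 8, 9, 10, 11, 12, 13, 14, 15, 16, 18, 19, 20, 21} {7, 8, 9, 10} V A V' A' \<Longrightarrow>
      marks V' A' \<Longrightarrow>
      (\<And>e. e < m \<Longrightarrow> A' 10 e \<noteq> 0 \<longleftrightarrow> A 10 e \<noteq> 0 \<and>
        (ae.conn F (- {i}) s (head G e) \<or> ae.conn F (- {i}) (V 17) t)) \<Longrightarrow> Q k' V' A'"
  shows "wp xs test_z Q k V A"
proof -
  have V5: "V 5 = 1" using d by (simp add: data_def)
  have d0: "data (V(7 := i)) A" by (rule data_unch[OF d, of "{7}" "{}"]) (auto simp: unch_def)
  have mk0: "marks (V(7 := i)) A" using mk by (simp add: marks_def)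
  let ?rest = "Get 10 8 17 ;; Minus 10 16 10 ;; Cond 10 (Plus 8 2 22 ;; While 8 drop_body) Skip ;; Minus 21 21 5"
  have "wp xs both (wp xs ?rest Q) (Suc k) (V(7 := i)) A"
  proof (rule wp_both[OF d0 mk0 _ F])
    show "(V(7 := i)) 7 = i" by simp
  next
    fix k1 V1 A1
    assume 1: "k1 \<le> Suc k + 200 * Suc m"
      "unch {9, 10, 11, 12, 13, 14, 15, 16, 18, 19} {7, 8, 9} (V(7 := i)) A V1 A1"
      "marks V1 A1" "data V1 A1" "alive A1 = F"
      "\<And>w. (V1 15 - A1 7 w = 0) = ae.conn F (- {i}) s w"
      "\<And>w. (V1 16 - A1 8 w = 0) = ae.conn F (- {i}) w t"
    have V1: "V1 17 = V 17" "V1 21 = Suc i" "V1 5 = 1" "A1 10 = A 10" "V1 2 = m" "V1 22 = 0"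
      using 1(2) i V5 d by (simp_all add: unch_def data_def)
    show "wp xs ?rest Q k1 V1 A1"
    proof (cases "V1 16 - A1 8 (V 17) = 0")
      \<comment> \<open>The tail \<open>V 17\<close> reaches \<open>t\<close> around
        \<open>i\<close>, so the second alternative holds for every candidate.\<close>
      case True
      have "Q (Suc (Suc (Suc (Suc k1)))) (V1(10 := 0, 21 := i)) A1"
      proof (rule Q)
        show "unch {7, 8, 9, 10, 11, 12, 13, 14, 15, 16, 18, 19, 20, 21} {7, 8, 9, 10} V A (V1(10 := 0, 21 := i)) A1"
          using 1(2) by (simp add: unch_def)
        show "marks (V1(10 := 0, 21 := i)) A1" using 1(3) by (simp add: marks_def)
        show "A1 10 e \<noteq> 0 \<longleftrightarrow> A 10 e \<noteq> 0 \<and>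
          (ae.conn F (- {i}) s (head G e) \<or> ae.conn F (- {i}) (V 17) t)" for e
          using True 1(7)[of "V 17"] V1 by simp
      qed (use 1(1) in simp_all)
      then show ?thesis using True V1 by simp
    next
      case False
      define dd where "dd = V1 16 - A1 8 (V 17)"
      let ?V = "V1(10 := dd, 8 := m)"
      have d2: "data ?V A1" by (rule data_unch[OF 1(4), of "{8, 10}" "{}"]) (auto simp: unch_def)
      have "wp xs (While 8 drop_body) (wp xs (Minus 21 21 5) Q) (Suc (Suc (Suc (Suc k1)))) ?V A1"
      proof (rule wp_drop_loop[OF d2, where P = "ae.conn F (- {i}) s"])
        fix k3 V3 A3
        assume 3: "k3 \<le> Suc (Suc (Suc (Suc k1))) + 12 * m + 1" "unch {8, 9, 10, 18, 20} {10} ?V A1 V3 A3"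
          "\<And>e. e < m \<Longrightarrow> (A3 10 e \<noteq> 0) = (A1 10 e \<noteq> 0 \<and> ae.conn F (- {i}) s (head G e))"
        have V3: "V3 21 = Suc i" "V3 5 = 1" using 3(2) V1 by (simp_all add: unch_def)
        have "Q (Suc k3) (V3(21 := i)) A3"
        proof (rule Q)
          show "unch {7, 8, 9, 10, 11, 12, 13, 14, 15, 16, 18, 19, 20, 21} {7, 8, 9, 10} V A (V3(21 := i)) A3"
            using 1(2) 3(2) by (simp add: unch_def)
          show "marks (V3(21 := i)) A3" using 1(3) 3(2) by (simp add: marks_def unch_def)
          show "A3 10 e \<noteq> 0 \<longleftrightarrow> A 10 e \<noteq> 0 \<and>
            (ae.conn F (- {i}) s (head G e) \<or> ae.conn F (- {i}) (V 17) t)" if "e < m" for e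
            using False 1(7)[of "V 17"] V1 3(3)[OF that] by simp
        qed (use 1(1) 3(1) in simp_all)
        then show "wp xs (Minus 21 21 5) Q k3 V3 A3" using V3 by simp
      qed (use 1 in simp_all)
      then show ?thesis using False V1 by (simp add: dd_def)
    qed
  qed
  then show ?thesis unfolding test_z_def using i V5 by simp
qed

text \<open>What \<open>test\<close> asks of the pair of arcs \<open>r\<close> and \<open>e\<close>,
  with \<open>z\<close> restricted to the nodes.\<close>

definition crossing where
  "crossing F r e \<longleftrightarrow> e \<in> F \<and> ae.conn F UNIV (tail G r) (head G e) \<and>
     (\<forall>z<n. ae.conn F (- {z}) s (head G e) \<or> ae.conn F (- {z}) (tail G r) t)"

lemma wp_test_arc:
  assumes d: "data V A" and mk: "marks V A" and F: "alive A = F" and r: "V 23 = r" "r < m"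
    and b: "V 0 = of_bool b"
    and Q: "\<And>k' V' A'. k' \<le> k + 400 * Suc m * n \<Longrightarrow> V' 6 = V 6 \<Longrightarrow>
      marks V' A' \<Longrightarrow> data V' A' \<Longrightarrow> alive A' = F \<Longrightarrow>
      V' 0 = of_bool (b \<or> (\<exists>e. crossing F r e)) \<Longrightarrow> Q k' V' A'"
  shows "wp xs test_arc Q k V A"
proof -
  define u where "u = tail G r"
  have V: "V 1 = n" "V 22 = 0" "A 0 r = u" using d r by (simp_all add: data_def u_def)
  have n0: "1 \<le> n" using source_in_verts verts_n by fastforce
  have uv: "u \<in> verts G" using r arcs_m by (simp add: u_def)
  have nv: "n \<notin> verts G" by (simp add: verts_n)
  have FG: "F \<subseteq> arcs G" using F arcs_m by (auto simp: alive_def)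
  have total: "ae.conn F (- {n}) u w \<longleftrightarrow> ae.conn F UNIV u w" for w
    using conn_avoid_nonvertex[OF FG _ uv nv] ae.conn_mono[of F "- {n}" u w F UNIV] by blast
  let ?V0 = "V(17 := u, 7 := n)"
  have d0: "data ?V0 A" by (rule data_unch[OF d, of "{7, 17}" "{}"]) (auto simp: unch_def)
  have mk0: "marks ?V0 A" using mk by (simp add: marks_def)
  let ?r4 = "wp xs (Plus 8 2 22) (wp xs (While 8 found_body) Q)"
  let ?r3 = "wp xs (Plus 21 1 22) (wp xs (While 21 test_z) ?r4)"
  let ?r2 = "wp xs (Plus 8 2 22) (wp xs (While 8 cand_body) ?r3)"
  have "wp xs (search 17 4 3 1 7 15) ?r2 (Suc (Suc k)) ?V0 A"
  proof (rule wp_search_forward[OF d0 mk0])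
    fix k1 V1 A1
    assume 1: "k1 \<le> Suc (Suc k) + 100 * Suc m" "unch {9, 10, 11, 12, 13, 14, 15, 18, 19} {7, 9} ?V0 A V1 A1"
      "marks V1 A1" "\<And>w. (V1 15 - A1 7 w = 0) = ae.conn (alive A) (- {?V0 7}) (?V0 17) w"
    have d1: "data V1 A1" by (rule data_unch[OF d0 1(2)]) auto
    have a1: "alive A1 = F" using 1(2) F by (simp add: alive_def unch_def)
    have V1: "V1 2 = m" "V1 22 = 0" using d1 by (simp_all add: data_def)
    have d1': "data (V1(8 := m)) A1" by (rule data_unch[OF d1, of "{8}" "{}"]) (auto simp: unch_def)
    have "wp xs (While 8 cand_body) ?r3 (Suc k1) (V1(8 := m)) A1"
    proof (rule wp_cand_loop[OF d1' _ a1, where P = "ae.conn F UNIV u"])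
      show "((V1(8 := m)) 15 - A1 7 w = 0) = ae.conn F UNIV u w" for w
        using 1(4)[of w] total F by simp
    next
      fix k2 V2 A2
      assume 2: "k2 \<le> Suc k1 + 12 * m + 1" "unch {8, 9, 10, 18, 20} {10} (V1(8 := m)) A1 V2 A2"
        "\<And>e. e < m \<Longrightarrow> (A2 10 e \<noteq> 0) = (e \<in> F \<and> ae.conn F UNIV u (head G e))"
      have d2: "data V2 A2" by (rule data_unch[OF d1' 2(2)]) auto
      have V2: "V2 1 = n" "V2 22 = 0" "V2 17 = u" "V2 6 = V 6" "V2 0 = V 0" using d2 1(2) 2(2) by (simp_all add: data_def unch_def)
      have mk2: "marks V2 A2" using 1(3) 2(2) by (simp add: marks_def unch_def)
      have a2: "alive A2 = F" using 2(2) a1 by (simp add: alive_def unch_def)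
      define I where "I j V' A' \<longleftrightarrow> V' 17 = u \<and> V' 6 = V 6 \<and> V' 0 = V 0 \<and> marks V' A' \<and> data V' A' \<and>
          alive A' = F \<and> j \<le> n \<and>
          (\<forall>e<m. A' 10 e \<noteq> 0 \<longleftrightarrow> e \<in> F \<and> ae.conn F UNIV u (head G e) \<and>
             (\<forall>z<n. j \<le> z \<longrightarrow> ae.conn F (- {z}) s (head G e) \<or> ae.conn F (- {z}) u t))"
        for j and V' :: "nat \<Rightarrow> nat" and A' :: "nat \<Rightarrow> nat \<Rightarrow> nat"
      have "wp xs (While 21 test_z) ?r4 (Suc k2) (V2(21 := n)) A2"
      proof (rule wp_for[where I = I and i = n and B = "220 * Suc m"])
        show "(V2(21 := n)) 21 = n" by simp
        have "data (V2(21 := n)) A2" by (rule data_unch[OF d2, of "{21}" "{}"]) (auto simp: unch_def)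
        then show "I n (V2(21 := n)) A2" using V2 mk2 a2 2(3) by (simp add: I_def marks_def)
      next
        fix k j V' A' assume I: "I (Suc j) V' A'" and j: "V' 21 = Suc j"
        show "wp xs test_z (\<lambda>k' V'' A''. k' \<le> k + 220 * Suc m \<and> V'' 21 = j \<and> I j V'' A'') k V' A'"
        proof (rule wp_test_z[where V = V' and A = A' and i = j and F = F])
          show "V' 21 = Suc j" by fact
          show "data V' A'" "marks V' A'" "alive A' = F" using I by (simp_all add: I_def)
          fix k3 V3 A3
          assume 3: "k3 \<le> k + 220 * Suc m" "V3 21 = j"
            "unch {7, 8, 9, 10, 11, 12, 13, 14, 15, 16, 18, 19, 20, 21} {7, 8, 9, 10} V' A' V3 A3"
            "marks V3 A3"
            "\<And>e. e < m \<Longrightarrow> (A3 10 e \<noteq> 0) = (A' 10 e \<noteq> 0 \<and>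
              (ae.conn F (- {j}) s (head G e) \<or> ae.conn F (- {j}) (V' 17) t))"
          have d3: "data V3 A3" by (rule data_unch[OF _ 3(3), of]) (use I in \<open>auto simp: I_def\<close>)
          have jn: "j < n" using I by (simp add: I_def)
          have z: "(\<forall>z<n. j \<le> z \<longrightarrow> P z) \<longleftrightarrow> P j \<and> (\<forall>z<n. Suc j \<le> z \<longrightarrow> P z)" for P :: "nat \<Rightarrow> bool"
            using jn by (metis Suc_leD Suc_leI le_eq_less_or_eq)
          have "\<forall>e<m. A3 10 e \<noteq> 0 \<longleftrightarrow> e \<in> F \<and> ae.conn F UNIV u (head G e) \<and>
             (\<forall>z<n. j \<le> z \<longrightarrow> ae.conn F (- {z}) s (head G e) \<or> ae.conn F (- {z}) u t)"
            unfolding z using 3(5) I unfolding I_def by blast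
          moreover have "V3 17 = u" "V3 6 = V 6" "V3 0 = V 0" "alive A3 = F"
            using 3(3) I by (simp_all add: I_def unch_def alive_def)
          ultimately show "k3 \<le> k + 220 * Suc m \<and> V3 21 = j \<and> I j V3 A3"
            using 3(1,2,4) d3 jn by (simp add: I_def)
        qed
      next
        fix k4 V4 A4 assume I: "I 0 V4 A4" and k4: "k4 \<le> Suc k2 + Suc (220 * Suc m) * n + 1"
        have d4: "data V4 A4" using I by (simp add: I_def)
        have V4: "V4 2 = m" "V4 22 = 0" using d4 by (simp_all add: data_def)
        have d4': "data (V4(8 := m)) A4" by (rule data_unch[OF d4, of "{8}" "{}"]) (auto simp: unch_def)
        have cr: "(\<exists>e<m. A4 10 e \<noteq> 0) \<longleftrightarrow> (\<exists>e. crossing F r e)"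
        proof -
          have "A4 10 e \<noteq> 0 \<longleftrightarrow> crossing F r e" if "e < m" for e
            using I that unfolding I_def crossing_def u_def by simp
          moreover have "e < m" if "crossing F r e" for e
            using that F by (auto simp: crossing_def alive_def)
          ultimately show ?thesis by blast
        qed
        have "wp xs (While 8 found_body) Q (Suc k4) (V4(8 := m)) A4"
        proof (rule wp_found_loop[OF d4', where b = b])
          show "(V4(8 := m)) 8 = m" by simp
          show "(V4(8 := m)) 0 = of_bool b" using I b by (simp add: I_def)
          fix k5 V5 A5
          assume 5: "k5 \<le> Suc k4 + 12 * m + 1" "unch {0, 8, 9, 20} {} (V4(8 := m)) A4 V5 A5"
            "V5 0 = of_bool (b \<or> (\<exists>e<m. A4 10 e \<noteq> 0))"
          show "Q k5 V5 A5"
          proof (rule Q)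
            \<comment> \<open>One search and two loops over the arcs account for
              \<open>150 * Suc m\<close>, the loop over the nodes for the other term.\<close>
            have "k5 \<le> k + 150 * Suc m + 221 * (Suc m * n)" using 5(1) k4 2(1) 1(1) by (simp add: algebra_simps)
            moreover have "Suc m \<le> Suc m * n" using n0 mult_le_mono2[of 1 n "Suc m"] by simp
            ultimately show "k5 \<le> k + 400 * Suc m * n" by (simp add: algebra_simps)
            show "V5 6 = V 6" "marks V5 A5" "alive A5 = F"
              using 5(2) I by (simp_all add: I_def unch_def marks_def alive_def)
            show "data V5 A5" by (rule data_unch[OF d4' 5(2)]) auto
            show "V5 0 = of_bool (b \<or> (\<exists>e. crossing F r e))" using 5(3) cr by simp
          qed
        qed
        then show "wp xs (Plus 8 2 22) (wp xs (While 8 found_body) Q) k4 V4 A4" using V4 by simp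
      qed
      then show "?r3 k2 V2 A2" using V2 by simp
    qed simp
    then show "?r2 k1 V1 A1" using V1 by simp
  qed simp
  then show ?thesis unfolding test_arc_def using V r by simp
qed

lemma wp_test:
  assumes d: "data V A" and mk: "marks V A" and V: "V 6 = m" "V 0 = 0" and F: "alive A = F"
    and Q: "\<And>k' V' A'. k' \<le> k + Suc (410 * Suc m * n) * m + 1 \<Longrightarrow>
      V' 0 = of_bool (\<exists>r\<in>F. \<exists>e. crossing F r e) \<Longrightarrow> Q k' V' A'"
  shows "wp xs (While 6 test_body) Q k V A"
proof -
  define I where "I j V' A' \<longleftrightarrow> marks V' A' \<and> data V' A' \<and> j \<le> m \<and> alive A' = F \<and>
      V' 0 = of_bool (\<exists>r\<in>F. j \<le> r \<and> (\<exists>e. crossing F r e))"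
    for j and V' :: "nat \<Rightarrow> nat" and A' :: "nat \<Rightarrow> nat \<Rightarrow> nat"
  have n0: "1 \<le> n" using source_in_verts verts_n by fastforce
  then have mn: "Suc m \<le> Suc m * n" using mult_le_mono2[of 1 n "Suc m"] by simp
  have Fm: "r < m" if "r \<in> F" for r using that F by (auto simp: alive_def)
  show ?thesis
  proof (rule wp_for[where I = I and i = m and B = "410 * Suc m * n"])
    show "V 6 = m" by fact
    have "\<not> (\<exists>r\<in>F. m \<le> r \<and> (\<exists>e. crossing F r e))" using Fm by force
    then show "I m V A" using d mk F V by (simp add: I_def)
  next
    fix k j V' A' assume I: "I (Suc j) V' A'" and j: "V' 6 = Suc j"
    have jm: "j < m" using I by (simp add: I_def)
    have V5: "V' 5 = 1" using I by (simp add: I_def data_def)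
    have le: "j \<le> r \<longleftrightarrow> r = j \<or> Suc j \<le> r" for r by auto
    have ex: "(\<exists>r\<in>F. j \<le> r \<and> (\<exists>e. crossing F r e)) \<longleftrightarrow>
        (j \<in> F \<and> (\<exists>e. crossing F j e)) \<or> (\<exists>r\<in>F. Suc j \<le> r \<and> (\<exists>e. crossing F r e))"
      unfolding le by blast
    have alive: "A' 2 j \<noteq> 0 \<longleftrightarrow> j \<in> F" using I jm by (auto simp: I_def alive_def)
    let ?V = "V'(23 := j, 9 := A' 2 j)"
    have dV: "data ?V A'" by (rule data_unch[of V' A' "{9, 23}" "{}"]) (use I in \<open>auto simp: unch_def I_def\<close>)
    have mV: "marks ?V A'" using I by (simp add: I_def marks_def)
    show "wp xs test_body (\<lambda>k' V'' A''. k' \<le> k + 410 * Suc m * n \<and> V'' 6 = j \<and> I j V'' A'') k V' A'"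
    proof (cases "j \<in> F")
      case True
      let ?R = "\<lambda>k' V'' A''. k' \<le> k + 410 * Suc m * n \<and> V'' 6 = j \<and> I j V'' A''"
      have "wp xs test_arc (wp xs (Minus 6 6 5) ?R) (Suc (Suc (Suc k))) ?V A'"
      proof (rule wp_test_arc[OF dV mV, where r = j and b = "\<exists>r\<in>F. Suc j \<le> r \<and> (\<exists>e. crossing F r e)" and F = F])
        show "alive A' = F" using I by (simp add: I_def)
        show "?V 23 = j" "j < m" using jm by simp_all
        show "?V 0 = of_bool (\<exists>r\<in>F. Suc j \<le> r \<and> (\<exists>e. crossing F r e))" using I by (simp add: I_def)
        fix k2 V2 A2
        assume 2: "k2 \<le> Suc (Suc (Suc k)) + 400 * Suc m * n" "V2 6 = ?V 6" "marks V2 A2" "data V2 A2" "alive A2 = F"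
          "V2 0 = of_bool ((\<exists>r\<in>F. Suc j \<le> r \<and> (\<exists>e. crossing F r e)) \<or> (\<exists>e. crossing F j e))"
        have V2: "V2 6 = Suc j" "V2 5 = 1" using 2 j by (simp_all add: data_def)
        have d3: "data (V2(6 := j)) A2" by (rule data_unch[OF 2(4), of "{6}" "{}"]) (auto simp: unch_def)
        have "V2 0 = of_bool (\<exists>r\<in>F. j \<le> r \<and> (\<exists>e. crossing F r e))" unfolding 2(6) ex using True by (simp add: disj_commute)
        then have "I j (V2(6 := j)) A2" using d3 2(3,5) jm by (simp add: I_def marks_def)
        moreover have "Suc k2 \<le> k + 410 * Suc m * n" using 2(1) mn by (simp add: algebra_simps)
        ultimately show "wp xs (Minus 6 6 5) ?R k2 V2 A2" using V2 by simp
      qed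
      then show ?thesis unfolding test_body_def using j V5 alive True by simp
    next
      case False
      have d3: "data (V'(23 := j, 9 := 0, 6 := j)) A'"
        by (rule data_unch[of V' A' "{6, 9, 23}" "{}"]) (use I in \<open>auto simp: unch_def I_def\<close>)
      have "V' 0 = of_bool (\<exists>r\<in>F. j \<le> r \<and> (\<exists>e. crossing F r e))" unfolding ex using False I by (simp add: I_def)
      then have "I j (V'(23 := j, 9 := 0, 6 := j)) A'" using d3 I jm by (simp add: I_def marks_def)
      moreover have "A' 2 j = 0" using alive False by simp
      moreover have "Suc (Suc (Suc (Suc k))) \<le> k + 410 * Suc m * n" using mn by (simp add: algebra_simps)
      ultimately show ?thesis unfolding test_body_def using j V5 by simp
    qed
  next
    fix k' V' A' assume "I 0 V' A'" "k' \<le> k + Suc (410 * Suc m * n) * m + 1"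
    then show "Q k' V' A'" using Q by (simp add: I_def)
  qed
qed

lemma vulnerable_iff_crossing:
  "vulnerable G s t \<longleftrightarrow> s \<noteq> t \<and> (\<exists>r\<in>core (rev [0..<n]). \<exists>e. crossing (core (rev [0..<n])) r e)"
proof -
  have "set (rev [0..<n]) = {..<n}" by (simp add: atLeast0LessThan)
  then have "set (rev [0..<n]) = verts G" using verts_numbered by (rule trans[OF _ sym])
  from vulnerable_iff[OF this] show ?thesis
    unfolding crossing_def Ball_def Bex_def verts_n by blast
qed

lemma wp_decide:
  "wp (encode_net G s t) decide (\<lambda>k V A. k \<le> 2000 * (n * m\<^sup>2) + 2000 \<and> V 0 = of_bool (vulnerable G s t))
    0 (\<lambda>_. 0) (\<lambda>_ _. 0)"
proof -
  let ?xs = "encode_net G s t"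
  let ?Q = "\<lambda>k V (A :: nat \<Rightarrow> nat \<Rightarrow> nat). k \<le> 2000 * (n * m\<^sup>2) + 2000 \<and> V 0 = of_bool (vulnerable G s t)"
  have len: "3 < length ?xs" by (simp add: encode_length)
  have nth: "?xs ! 0 = n" "?xs ! Suc 0 = m" "?xs ! 2 = s" "?xs ! 3 = t"
    using encode_nth by simp_all
  have n0: "1 \<le> n" using source_in_verts verts_n by fastforce
  show ?thesis
  proof (cases "m = 0 \<or> s = t")
    case True
    have "\<not> vulnerable G s t"
    proof
      assume v: "vulnerable G s t"
      then have "m = 0" using True vulnerable_iff_crossing by blast
      then have "arcs G = {}" by simp
      then show False using v vulnerable_iff_crossing core_facts(1) by blast
    qed
    then show ?thesis
      using True len nth unfolding decide_def by (auto simp: numeral_2_eq_2[symmetric])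
  next
    case False
    have "m \<noteq> 0" using False by (rule contrapos_nn) (rule disjI1)
    moreover have "s \<noteq> t" using False by (rule contrapos_nn) (rule disjI2)
    ultimately have m0: "1 \<le> m" and st: "s - t + (t - s) \<noteq> 0" by linarith+
    let ?V = "(\<lambda>_. 0)(5 := Suc 0, Suc 0 := n, 2 := m, 3 := s, 4 := t, 10 := t - s,
      9 := s - t + (t - s), 8 := m)"
    have main: "wp ?xs (While 8 load_body) (wp ?xs (Plus 6 2 22) (wp ?xs (While 6 prune_round)
        (wp ?xs (Plus 6 2 22) (wp ?xs (While 6 test_body) ?Q)))) k0 ?V (\<lambda>_ _. 0)"
      if k0: "k0 \<le> 14" for k0
    proof (rule wp_load)
      fix k1 V1 A1
      assume 1: "k1 \<le> k0 + 18 * m + 1" "data V1 A1" "marks V1 A1" "alive A1 = arcs G" "V1 0 = 0"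
      have V1: "V1 2 = m" "V1 22 = 0" using 1 by (simp_all add: data_def)
      have d1: "data (V1(6 := m)) A1" by (rule data_unch[OF 1(2), of "{6}" "{}"]) (auto simp: unch_def)
      have "wp ?xs (While 6 prune_round) (wp ?xs (Plus 6 2 22) (wp ?xs (While 6 test_body) ?Q)) (Suc k1) (V1(6 := m)) A1"
      proof (rule wp_prune[OF d1])
        fix k2 V2 A2
        assume 2: "k2 \<le> Suc k1 + Suc (225 * Suc m * n) * m + 1" "V2 0 = 0" "marks V2 A2" "data V2 A2"
          "alive A2 = core (rev [0..<n])"
        have V2: "V2 2 = m" "V2 22 = 0" using 2 by (simp_all add: data_def)
        have d2: "data (V2(6 := m)) A2" by (rule data_unch[OF 2(4), of "{6}" "{}"]) (auto simp: unch_def)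
        have "wp ?xs (While 6 test_body) ?Q (Suc k2) (V2(6 := m)) A2"
        proof (rule wp_test[OF d2 _ _ _ 2(5)])
          show "marks (V2(6 := m)) A2" using 2(3) by (simp add: marks_def)
          show "(V2(6 := m)) 6 = m" "(V2(6 := m)) 0 = 0" using 2(2) by simp_all
          fix k3 V3 A3
          assume 3: "k3 \<le> Suc k2 + Suc (410 * Suc m * n) * m + 1"
            "V3 0 = of_bool (\<exists>r\<in>core (rev [0..<n]). \<exists>e. crossing (core (rev [0..<n])) r e)"
          \<comment> \<open>As \<open>m\<close> and \<open>n\<close> are positive, both
            \<open>m\<close> and \<open>m * n\<close> are at most \<open>N\<close>. The two phases
            then cost about twice 225 and twice 410 times \<open>N\<close>, and 2000 leaves room for
            the rest.\<close>
          define N where "N = n * m\<^sup>2"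
          have "m * 1 \<le> m * (m * n)" using m0 n0 by (intro mult_le_mono2) simp
          then have a: "m \<le> N" by (simp add: N_def power2_eq_square mult_ac)
          have "m * (n * 1) \<le> m * (n * m)" using m0 by (intro mult_le_mono2) simp
          then have b: "m * n \<le> N" by (simp add: N_def power2_eq_square mult_ac)
          have c: "Suc (c * Suc m * n) * m = m + c * (m * n) + c * N" for c
            by (simp add: N_def power2_eq_square algebra_simps)
          have "k3 \<le> 2000 * N + 2000" using 3(1) 2(1) 1(1) k0 a b unfolding c by linarith
          moreover have "s \<noteq> t" using False by blast
          ultimately show "?Q k3 V3 A3" using 3(2) vulnerable_iff_crossing unfolding N_def by simp
        qed
        then show "wp ?xs (Plus 6 2 22) (wp ?xs (While 6 test_body) ?Q) k2 V2 A2" using V2 by simp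
      qed (use 1 in \<open>simp_all add: marks_def\<close>)
      then show "wp ?xs (Plus 6 2 22) (wp ?xs (While 6 prune_round)
        (wp ?xs (Plus 6 2 22) (wp ?xs (While 6 test_body) ?Q))) k1 V1 A1" using V1 by simp
    qed simp_all
    have "wp ?xs decide Q 0 (\<lambda>_. 0) (\<lambda>_ _. 0) =
        wp ?xs (While 8 load_body) (wp ?xs (Plus 6 2 22) (wp ?xs (While 6 prune_round)
          (wp ?xs (Plus 6 2 22) (wp ?xs (While 6 test_body) Q))))
        (Suc (Suc (Suc (Suc (Suc (Suc (Suc (Suc (Suc (Suc (Suc (Suc (Suc (Suc 0)))))))))))))) ?V (\<lambda>_ _. 0)" for Q
      using len nth st m0 unfolding decide_def by auto
    then show ?thesis using main by simp
  qed
qed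

end

text \<open>Ten machine steps per tick turn the constant 2000 into 20000.\<close>

lemma vulnerability_decidable_cubic:
  "vulnerability_decidable_in_time (\<lambda>n m. 20000 * (n * m ^ 2) + 20000)"
  unfolding vulnerability_decidable_in_time_def
proof (intro exI[of _ "compile 0 decide"] allI impI)
  fix G :: "(nat, nat) pre_digraph" and s t
  assume "numbered_net G s t"
  then interpret numbered_net G s t .
  show "answers_within (compile 0 decide) (encode_net G s t)
      (20000 * (card (verts G) * (card (arcs G))\<^sup>2) + 20000) (vulnerable G s t)"
    by (rule compile_answers[OF wp_decide well_addressed_decide]) simp
qed

theorem theorem5p3:
  shows "(\<exists>c k :: nat. vulnerability_decidable_in_time (\<lambda>n m. c * (n + m) ^ k + c)) \<and>
         (\<exists>c :: nat. vulnerability_decidable_in_time (\<lambda>n m. c * (n * m ^ 2) + c))"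
proof
  obtain P where P: "\<And>G s t. numbered_net G s t \<Longrightarrow> answers_within P (encode_net G s t)
      (20000 * (card (verts G) * (card (arcs G))\<^sup>2) + 20000) (vulnerable G s t)"
    using vulnerability_decidable_cubic unfolding vulnerability_decidable_in_time_def by blast
  \<comment> \<open>A halted machine keeps its configuration, so a time bound may be enlarged; this
    derives the polynomial bound from the sharper one.\<close>
  have mono: "answers_within P xs T' b" if "answers_within P xs T b" "T \<le> T'" for xs T T' b
  proof -
    obtain pc R where s: "(step P xs ^^ T) (0, \<lambda>_. 0) = (pc, R)" by (rule prod.exhaust)
    note 1 = s that(1)[unfolded answers_within_def s prod.case, THEN conjunct1]
      that(1)[unfolded answers_within_def s prod.case, THEN conjunct2]
    have "(step P xs ^^ i) (pc, R) = (pc, R)" for i using 1(2) by (induction i) (auto simp: step_def)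
    then have "(step P xs ^^ (T + (T' - T))) (0, \<lambda>_. 0) = (pc, R)" using steps_add[OF 1(1)] by blast
    then show ?thesis using 1 that(2) unfolding answers_within_def by simp
  qed
  have "n * m\<^sup>2 \<le> (n + m) ^ 3" for n m :: nat
  proof -
    have "n * m\<^sup>2 \<le> (n + m) * (n + m)\<^sup>2" by (intro mult_le_mono power_mono) auto
    then show ?thesis by (simp add: power3_eq_cube power2_eq_square mult_ac)
  qed
  then have "vulnerability_decidable_in_time (\<lambda>n m. 20000 * (n + m) ^ 3 + 20000)"
    unfolding vulnerability_decidable_in_time_def using P mono by (meson add_le_mono1 mult_le_mono2)
  then show "\<exists>c k :: nat. vulnerability_decidable_in_time (\<lambda>n m. c * (n + m) ^ k + c)" by blast
  show "\<exists>c :: nat. vulnerability_decidable_in_time (\<lambda>n m. c * (n * m ^ 2) + c)"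
    using vulnerability_decidable_cubic by blast
qed

end
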